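(* Assume $\mathbb P$ is stationary and ergodic and that $$\mathbf E|X(z)|<\infty,\qquad \int_0^\infty \bigl\{1-\mathbb E(F_0(x))\bigr\}^{1/2}\,dx<\infty,\qquad \int_0^\infty \operatorname*{ess\,sup}_{\mathbb P}\,(1-F_0(x))\,dx<\infty .$$ Then for all $(x,y)\in(0,\infty)^2$ the last-passage time constant $$\Psi(x,y)=\lim_{n\to\infty}\frac1n\,T(\lfloor nx\rfloor,\lfloor ny\rfloor)$$ exists as a (deterministic) limit both $\mathbf P$-almost surely and in $L^1(\mathbf P)$. Furthermore, $\Psi$ is a homogeneous ($\Psi(cx,cy)=c\Psi(x,y)$ for $c>0$), concave and continuous function on $(0,\infty)^2$.
   Context: $\mathbb Z_+=\{0,1,2,\dots\}$. $\mathbb P$ is a probability measure on the space of sequences $(F_j)_{j\in\mathbb Z_+}$ of Borel probability distributions on $\mathbb R$ (the environment), with expectation $\mathbb E$; $F_j(\cdot)$ also denotes the distribution function. Given $(F_j)$, the weights $\{X(z):z\in\mathbb Z_+^2\}$ are independent real random variables with $X(i,j)\sim F_j$. $\mathbf P,\mathbf E$ denote probability and expectation on the joint space of environment and weights. For $z_1\le z_2$ (coordinatewise) in $\mathbb Z_+^2$, $\Pi[z_1,z_2)$ is the set of nearest-neighbor lattice paths from $z_1$ to $z_2$ whose steps are $(1,0)$ or $(0,1)$, with $z_1$ included and $z_2$ excluded from the path. The last-passage time is $T(z_1,z_2)=\max_{\pi\in\Pi[z_1,z_2)}\sum_{z\in\pi}X(z)$, and $T(k,\ell)=T((0,0),(k,\ell))$.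 $\operatorname{ess\,sup}_{\mathbb P} f=\inf\{s\in\mathbb R:\mathbb P(f>s)=0\}$. *)

theory Defs
  imports "HOL-Probability.Probability"
begin

section \<open>Environment and weights\<close>

definition env_space :: "(nat \<Rightarrow> real measure) measure" where
  "env_space = (\<Pi>\<^sub>M j\<in>UNIV. prob_algebra borel)"

definition env_shift :: "(nat \<Rightarrow> real measure) \<Rightarrow> (nat \<Rightarrow> real measure)" where
  "env_shift F = (\<lambda>j. F (Suc j))"

definition stationary_env :: "(nat \<Rightarrow> real measure) measure \<Rightarrow> bool" where
  "stationary_env P \<longleftrightarrow> distr P env_space env_shift = P"

definition ergodic_env :: "(nat \<Rightarrow> real measure) measure \<Rightarrow> bool" where
  "ergodic_env P \<longleftrightarrow>
     (\<forall>A\<in>sets P. env_shift -` A \<inter> space P = A \<longrightarrow> measure P A = 0 \<or> measure P A = 1)"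

definition weight_space :: "(nat \<times> nat \<Rightarrow> real) measure" where
  "weight_space = (\<Pi>\<^sub>M z\<in>UNIV. borel)"

text \<open>Law of the weights given the environment: independent, and the weight at a site
  depends on the environment only through the second coordinate (the row) of the site.\<close>

definition quenched :: "(nat \<Rightarrow> real measure) \<Rightarrow> (nat \<times> nat \<Rightarrow> real) measure" where
  "quenched F = (\<Pi>\<^sub>M z\<in>UNIV. F (snd z))"

definition joint_measure ::
    "(nat \<Rightarrow> real measure) measure \<Rightarrow> ((nat \<Rightarrow> real measure) \<times> (nat \<times> nat \<Rightarrow> real)) measure" where
  "joint_measure P =
     P \<bind> (\<lambda>F. distr (quenched F) (env_space \<Otimes>\<^sub>M weight_space) (\<lambda>X. (F, X)))"


section \<open>Last-passage times\<close>

definition lattice_step :: "nat \<times> nat \<Rightarrow> nat \<times> nat \<Rightarrow> bool" where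
  "lattice_step u v \<longleftrightarrow> v = (fst u + 1, snd u) \<or> v = (fst u, snd u + 1)"

text \<open>A path is the list of the points it visits; \<^term>\<open>butlast\<close> removes the endpoint
  \<open>z\<^sub>2\<close>. For \<open>z\<^sub>1 = z\<^sub>2\<close> the only path is the empty one.\<close>

definition paths :: "nat \<times> nat \<Rightarrow> nat \<times> nat \<Rightarrow> (nat \<times> nat) list set" where
  "paths z\<^sub>1 z\<^sub>2 =
     butlast ` {p. p \<noteq> [] \<and> hd p = z\<^sub>1 \<and> last p = z\<^sub>2 \<and> successively lattice_step p}"

definition last_passage :: "(nat \<times> nat \<Rightarrow> real) \<Rightarrow> nat \<times> nat \<Rightarrow> nat \<times> nat \<Rightarrow> real" where
  "last_passage X z\<^sub>1 z\<^sub>2 = Max ((\<lambda>p. \<Sum>z\<leftarrow>p. X z) ` paths z\<^sub>1 z\<^sub>2)"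


section \<open>Well-definedness\<close>

lemma env_space_component:
  assumes "F \<in> space env_space"
  shows "sets (F j) = sets borel" "prob_space (F j)"
  using assms by (auto simp: env_space_def space_PiM space_prob_algebra PiE_iff)

lemma prob_space_quenched:
  assumes "F \<in> space env_space"
  shows "prob_space (quenched F)" "sets (quenched F) = sets weight_space"
  unfolding quenched_def weight_space_def
  using env_space_component[OF assms] by (auto intro!: prob_space_PiM sets_PiM_cong)

lemma measurable_quenched: "quenched \<in> env_space \<rightarrow>\<^sub>M prob_algebra weight_space"
proof (rule measurable_prob_algebra_generated[OF _ Int_stable_prod_algebra prod_algebra_sets_into_space])
  show "sets weight_space = sigma_sets (\<Pi>\<^sub>E z\<in>UNIV. space borel) (prod_algebra UNIV (\<lambda>_::nat\<times>nat. borel :: real measure))"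
    unfolding weight_space_def by (rule sets_PiM)
next
  fix A assume "A \<in> prod_algebra UNIV (\<lambda>_::nat\<times>nat. borel :: real measure)"
  then obtain J E where A: "A = prod_emb UNIV (\<lambda>_. borel) J (\<Pi>\<^sub>E j\<in>J. E j)"
    and J: "finite J" "\<And>j. j \<in> J \<Longrightarrow> E j \<in> sets (borel :: real measure)"
    by (rule prod_algebraE) blast
  have "emeasure (quenched F) A = (\<Prod>z\<in>J. emeasure (F (snd z)) (E z))"
    if F: "F \<in> space env_space" for F
  proof -
    have sp: "space (F j) = UNIV" for j
      using sets_eq_imp_space_eq[OF env_space_component(1)[OF F, of j]] by simp
    have "A = prod_emb UNIV (\<lambda>z. F (snd z)) J (\<Pi>\<^sub>E j\<in>J. E j)"
      unfolding A prod_emb_def by (simp add: sp)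
    then show ?thesis
      unfolding quenched_def using J env_space_component[OF F]
      by (simp add: emeasure_PiM_emb)
  qed
  moreover have "(\<lambda>F. \<Prod>z\<in>J. emeasure (F (snd z)) (E z)) \<in> borel_measurable env_space"
  proof (rule borel_measurable_prod_ennreal)
    fix z assume z: "z \<in> J"
    have "(\<lambda>F. F (snd z)) \<in> env_space \<rightarrow>\<^sub>M subprob_algebra borel"
      unfolding env_space_def
      by (rule measurable_prob_algebraD) (rule measurable_component_singleton, simp)
    from measurable_compose[OF this measurable_emeasure_subprob_algebra[OF J(2)[OF z]]]
    show "(\<lambda>F. emeasure (F (snd z)) (E z)) \<in> borel_measurable env_space" .
  qed
  ultimately show "(\<lambda>F. emeasure (quenched F) A) \<in> borel_measurable env_space"
    by (simp cong: measurable_cong)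
qed (simp_all only: prob_space_quenched)

lemma measurable_joint_kernel:
  "(\<lambda>F. distr (quenched F) (env_space \<Otimes>\<^sub>M weight_space) (\<lambda>X. (F, X)))
     \<in> env_space \<rightarrow>\<^sub>M prob_algebra (env_space \<Otimes>\<^sub>M weight_space)"
  by (rule measurable_distr_prob_space2[OF measurable_quenched])
     (simp add: case_prod_unfold)

lemma
  assumes "prob_space P" "sets P = sets env_space"
  shows prob_space_joint_measure: "prob_space (joint_measure P)"
    and sets_joint_measure: "sets (joint_measure P) = sets (env_space \<Otimes>\<^sub>M weight_space)"
proof -
  have P: "P \<in> space (prob_algebra env_space)"
    using assms by (simp add: space_prob_algebra)
  show "prob_space (joint_measure P)"
    unfolding joint_measure_def by (rule prob_space_bind'[OF P measurable_joint_kernel])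
  show "sets (joint_measure P) = sets (env_space \<Otimes>\<^sub>M weight_space)"
    unfolding joint_measure_def by (rule sets_bind'[OF P measurable_joint_kernel])
qed

lemma emeasure_joint_measure:
  assumes "prob_space P" "sets P = sets env_space" "A \<in> sets (env_space \<Otimes>\<^sub>M weight_space)"
  shows "emeasure (joint_measure P) A = (\<integral>\<^sup>+F. emeasure (quenched F) (Pair F -` A) \<partial>P)"
proof -
  have P: "P \<in> space (prob_algebra env_space)"
    using assms by (simp add: space_prob_algebra)
  have "emeasure (joint_measure P) A =
      (\<integral>\<^sup>+F. emeasure (distr (quenched F) (env_space \<Otimes>\<^sub>M weight_space) (\<lambda>X. (F, X))) A \<partial>P)"
    unfolding joint_measure_def
    by (rule emeasure_bind_prob_algebra[OF P measurable_joint_kernel assms(3)])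
  also have "\<dots> = (\<integral>\<^sup>+F. emeasure (quenched F) (Pair F -` A) \<partial>P)"
  proof (rule nn_integral_cong)
    fix F assume "F \<in> space P"
    then have F: "F \<in> space env_space"
      using sets_eq_imp_space_eq[OF assms(2)] by simp
    have m: "(\<lambda>X. (F, X)) \<in> quenched F \<rightarrow>\<^sub>M env_space \<Otimes>\<^sub>M weight_space"
      using F prob_space_quenched(2)[OF F] measurable_Pair1'[of F env_space weight_space]
      by (simp cong: measurable_cong_sets)
    have "space (quenched F) = UNIV"
      using sets_eq_imp_space_eq[OF prob_space_quenched(2)[OF F]]
      by (simp add: weight_space_def space_PiM)
    then show "emeasure (distr (quenched F) (env_space \<Otimes>\<^sub>M weight_space) (\<lambda>X. (F, X))) A =
        emeasure (quenched F) (Pair F -` A)"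
      using emeasure_distr[OF m assms(3)] by simp
  qed
  finally show ?thesis .
qed

lemma successively_lattice_step_bound:
  assumes "successively lattice_step p" "p \<noteq> []"
  shows "set p \<subseteq> {..fst (last p)} \<times> {..snd (last p)} \<and>
    length p + fst (hd p) + snd (hd p) = fst (last p) + snd (last p) + 1"
  using assms
proof (induction p)
  case (Cons u p)
  show ?case
  proof (cases "p = []")
    case False
    with Cons show ?thesis
      by (cases p) (auto simp: lattice_step_def mem_Times_iff split: if_splits)
  qed (auto simp: mem_Times_iff)
qed simp

lemma finite_paths: "finite (paths z\<^sub>1 z\<^sub>2)"
proof -
  let ?S = "{..fst z\<^sub>2} \<times> {..snd z\<^sub>2}"
  have "{p. p \<noteq> [] \<and> hd p = z\<^sub>1 \<and> last p = z\<^sub>2 \<and> successively lattice_step p}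
      \<subseteq> {p. set p \<subseteq> ?S \<and> length p \<le> fst z\<^sub>2 + snd z\<^sub>2 + 1}"
    using successively_lattice_step_bound by fastforce
  moreover have "finite {p. set p \<subseteq> ?S \<and> length p \<le> fst z\<^sub>2 + snd z\<^sub>2 + 1}"
    by (rule finite_lists_length_le) simp
  ultimately show ?thesis
    unfolding paths_def by (blast intro: finite_subset)
qed

lemma paths_origin_nonempty: "paths (0, 0) (k, l) \<noteq> {}"
proof -
  let ?Q = "\<lambda>z. \<exists>p. p \<noteq> [] \<and> hd p = (0, 0) \<and> last p = z \<and> successively lattice_step p"
  have snoc: "?Q v" if "?Q u" "lattice_step u v" for u v
  proof -
    from that(1) obtain p where "p \<noteq> []" "hd p = (0, 0)" "last p = u" "successively lattice_step p"
      by blast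
    with that(2) show ?thesis
      by (intro exI[of _ "p @ [v]"]) (auto simp: successively_append_iff)
  qed
  have "?Q (k, 0)"
  proof (induction k)
    case 0
    show ?case by (rule exI[of _ "[(0, 0)]"]) simp
  next
    case (Suc k)
    then show ?case by (rule snoc) (simp add: lattice_step_def)
  qed
  then have "?Q (k, l)"
  proof (induction l)
    case (Suc l)
    from Suc.IH[OF Suc.prems] show ?case by (rule snoc) (simp add: lattice_step_def)
  qed simp
  then show ?thesis unfolding paths_def by blast
qed

text \<open>The library's essential supremum lives in complete linear orders. Read in
  \<^typ>\<open>ennreal\<close>, it agrees for bounded nonnegative functions with the infimum over real
  levels.\<close>

lemma esssup_ennreal_eq_Inf:
  assumes "prob_space M" and f[measurable]: "f \<in> borel_measurable M"
    and bounds: "\<And>x. 0 \<le> f x" "\<And>x. f x \<le> (c::real)"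
  shows "esssup M (\<lambda>x. ennreal (f x)) = ennreal (Inf {s. emeasure M {x \<in> space M. s < f x} = 0})"
proof -
  interpret prob_space M by fact
  let ?S = "{s. emeasure M {x \<in> space M. s < f x} = 0}"
  have S_AE: "s \<in> ?S \<longleftrightarrow> (AE x in M. f x \<le> s)" for s
    by (subst AE_iff_measurable[OF _ refl]) (auto simp: not_le)
  have nonneg: "0 \<le> s" if "s \<in> ?S" for s
  proof (rule ccontr)
    assume "\<not> 0 \<le> s"
    then have "{x \<in> space M. s < f x} = space M"
      using less_le_trans[OF _ bounds(1)] by (auto simp: not_le)
    with that emeasure_space_1 show False by simp
  qed
  have c: "c \<in> ?S" using S_AE bounds(2) by simp
  have bdd: "bdd_below ?S" using nonneg by (rule bdd_belowI)
  have "esssup M (\<lambda>x. ennreal (f x)) = Inf {z. AE x in M. ennreal (f x) \<le> z}"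
    by (rule esssup_eq_AE) measurable
  also have "\<dots> = ennreal (Inf ?S)"
  proof (rule antisym)
    have "Inf ?S \<in> ?S"
    proof -
      have "AE x in M. \<forall>n::nat. f x \<le> Inf ?S + 1 / Suc n"
      proof (subst AE_all_countable, rule allI)
        fix n :: nat
        obtain s where "s \<in> ?S" "s < Inf ?S + 1 / Suc n"
          using cInf_lessD[of ?S "Inf ?S + 1 / Suc n"] c by auto
        then show "AE x in M. f x \<le> Inf ?S + 1 / Suc n"
          using S_AE by (auto elim!: eventually_mono)
      qed
      then have "AE x in M. f x \<le> Inf ?S"
      proof eventually_elim
        case (elim x)
        show ?case
        proof (rule field_le_epsilon)
          fix e :: real assume "0 < e"
          then obtain n where "1 / Suc n < e" using nat_approx_posE by auto
          with elim[rule_format, of n] show "f x \<le> Inf ?S + e" by linarith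
        qed
      qed
      then show ?thesis using S_AE by blast
    qed
    then have "AE x in M. f x \<le> Inf ?S" using S_AE by blast
    then have "AE x in M. ennreal (f x) \<le> ennreal (Inf ?S)"
      by eventually_elim (rule ennreal_leI)
    then show "Inf {z. AE x in M. ennreal (f x) \<le> z} \<le> ennreal (Inf ?S)"
      by (intro Inf_lower) simp
  next
    show "ennreal (Inf ?S) \<le> Inf {z. AE x in M. ennreal (f x) \<le> z}"
    proof (rule Inf_greatest)
      fix z assume "z \<in> {z. AE x in M. ennreal (f x) \<le> z}"
      then have z: "AE x in M. ennreal (f x) \<le> z" by simp
      show "ennreal (Inf ?S) \<le> z"
      proof (cases z)
        case (real r)
        then have "AE x in M. f x \<le> r" using z by simp
        then have "Inf ?S \<le> r" using S_AE bdd by (intro cInf_lower) auto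
        then show ?thesis using real by (simp add: ennreal_leI)
      qed simp
    qed
  qed
  finally show ?thesis .
qed

end

theory Submission
  imports Defs
begin

text \<open>
  Only the law of the weights matters, and it is invariant under all translations of the quadrant.
  Along the discretised ray \<open>(\<lfloor>t + n \<alpha>\<rfloor>, n)\<close> with a uniform phase \<open>t \<in> [0, 1)\<close> the passage
  times form a stationary superadditive process, for irrational \<open>\<alpha>\<close> as well, so Kingman's theorem
  gives the limit in direction \<open>(\<alpha>, 1)\<close>. Any other lattice approximation of a ray of the same
  direction stays between two of its points at bounded distance, and bounded gaps cost \<open>o(n)\<close>.

  Kingman's theorem follows from the inequality \<open>E limsup a\<^sub>n / n \<le> sup E a\<^sub>n / n\<close>
  for nonnegative superadditive processes, proved by the covering argument of Katznelson and Weiss,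
  applied to the process and to its additive minorants.

  The linear bound on the mean comes from slicing the weights into the indicators of \<open>X > u\<close>, \<open>u \<ge> 0\<close>.
  For 0-1 weights \<open>2\<^sup>T\<close> is dominated by a polymer partition function whose quenched mean solves
  a linear recursion with explicit product supersolutions. Optimising over them gives
  \<open>E T \<le> C (k + l) (sqrt p + q)\<close>, where \<open>p\<close> and \<open>q\<close> are the mean and the essential supremum of
  \<open>1 - F\<^sub>0(u)\<close>; the hypotheses make this integrable in \<open>u\<close>.

  The limit is constant since given the environment the columns are i.i.d., and since the
  environment is ergodic. Concavity is superadditivity and homogeneity of the limit of the means.
\<close>

section \<open>Superadditive processes over a measure-preserving map\<close>

text \<open>Rounding a ray of irrational slope leaves no stationary increments. With a uniform
  phase, translating the weights and rotating the phase together preserve the product measure, and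
  the increments match exactly. The limit could then depend on the phase; comparison with lattice
  points that do not involve it removes this. Weights may be negative and are merely integrable, so
  bounded gaps are charged by absolute values and handled by Borel-Cantelli instead of monotonicity.
  A union bound over paths would pay for exponentially many paths even if nearly all 0-1 weights
  vanish. The partition function counts chains of ones instead; it is 1 for zero weights and carries
  no path entropy. Its supersolutions cost about q per column and p/q per row, where q must dominate
  the tail of every row; balancing the two gives sqrt p, the constraint gives the essential
  supremum. In Kingman's theorem the lower half comes from a nearly optimal additive minorant: the
  remainder is nonnegative with small mean, so the limsup inequality controls it. Ergodicity is
  assumed for the environment and not for the ray shift, so the limit is first found as a random
  variable.\<close>

locale mpt = prob_space +
  fixes S :: "'a \<Rightarrow> 'a"
  assumes S_measurable [measurable]: "S \<in> measurable M M"
    and distr_S: "distr M M S = M"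
begin

lemma funpow_measurable [measurable]: "S ^^ n \<in> measurable M M"
  by (induction n) (auto intro: measurable_comp)

lemma distr_funpow: "distr M M (S ^^ n) = M"
proof (induction n)
  case 0
  then show ?case by (simp add: id_def)
next
  case (Suc n)
  have "distr M M (S ^^ Suc n) = distr (distr M M (S ^^ n)) M S"
    by (simp only: funpow.simps distr_distr[OF S_measurable funpow_measurable])
  then show ?case using Suc distr_S by (simp only:)
qed

lemma mpt_funpow: "mpt M (S ^^ n)"
  using distr_funpow by (unfold_locales) auto

lemma nn_integral_funpow:
  assumes [measurable]: "f \<in> borel_measurable M"
  shows "(\<integral>\<^sup>+\<omega>. f ((S ^^ n) \<omega>) \<partial>M) = (\<integral>\<^sup>+\<omega>. f \<omega> \<partial>M)"
proof -
  have "(\<integral>\<^sup>+\<omega>. f \<omega> \<partial>distr M M (S ^^ n)) = (\<integral>\<^sup>+\<omega>. f ((S ^^ n) \<omega>) \<partial>M)"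
    by (rule nn_integral_distr) auto
  then show ?thesis using distr_funpow by simp
qed

lemma integrable_funpow:
  fixes f :: "'a \<Rightarrow> real"
  assumes "integrable M f"
  shows "integrable M (\<lambda>\<omega>. f ((S ^^ n) \<omega>))"
proof -
  have "integrable (distr M M (S ^^ n)) f" using assms distr_funpow by simp
  then show ?thesis by (subst (asm) integrable_distr_eq) (use assms in auto)
qed

lemma integral_funpow:
  fixes f :: "'a \<Rightarrow> real"
  assumes [measurable]: "f \<in> borel_measurable M"
  shows "(\<integral>\<omega>. f ((S ^^ n) \<omega>) \<partial>M) = (\<integral>\<omega>. f \<omega> \<partial>M)"
proof -
  have "(\<integral>\<omega>. f \<omega> \<partial>distr M M (S ^^ n)) = (\<integral>\<omega>. f ((S ^^ n) \<omega>) \<partial>M)"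
    by (rule integral_distr) auto
  then show ?thesis using distr_funpow by simp
qed

lemma funpow_in_space: "\<omega> \<in> space M \<Longrightarrow> (S ^^ n) \<omega> \<in> space M"
  using measurable_space[OF funpow_measurable] by auto

end

section \<open>The limsup inequality for nonnegative superadditive processes\<close>

lemma ennreal_diff_less:
  fixes x d :: ennreal
  assumes "x < top" "0 < d" "x - d \<noteq> 0"
  shows "x - d < x"
  using assms by (cases x; cases d) (auto simp: ennreal_minus ennreal_less_iff ennreal_eq_0_iff intro!: ennreal_lessI)

lemma ennreal_le_mult_of_divide_le:
  fixes x y c :: ennreal
  assumes "x / y \<le> c" "y \<noteq> 0" "y < top"
  shows "x \<le> c * y"
proof -
  have "x / y * y = x"
    using assms(2,3)
    by (cases x; cases y) (auto simp: divide_ennreal ennreal_mult[symmetric] ennreal_top_divide ennreal_top_mult)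
  then show ?thesis using mult_right_mono[OF assms(1), of y] by simp
qed

text \<open>Think of \<open>h\<close> as slightly less than the limsup of \<open>a n / n\<close>.
  From each point, jump over a block of length \<open>l\<close> on which \<open>a\<close> gains at
  least \<open>l * h\<close>; superadditivity adds up the gains. As \<open>h\<close> can only
  decrease along an orbit, its value at the start of a block bounds all its values inside the
  block.\<close>

lemma (in mpt) superadditive_limsup_le_aux:
  fixes a :: "nat \<Rightarrow> 'a \<Rightarrow> ennreal" and h :: "'a \<Rightarrow> ennreal" and \<gamma> K :: ennreal
  assumes a [measurable]: "\<And>n. a n \<in> borel_measurable M"
    and h [measurable]: "h \<in> borel_measurable M"
    and super: "\<And>m n \<omega>. \<omega> \<in> space M \<Longrightarrow> a m \<omega> + a n ((S ^^ m) \<omega>) \<le> a (m + n) \<omega>"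
    and mean: "\<And>n. (\<integral>\<^sup>+\<omega>. a n \<omega> \<partial>M) \<le> of_nat n * \<gamma>"
    and dec: "\<And>\<omega>. \<omega> \<in> space M \<Longrightarrow> h (S \<omega>) \<le> h \<omega>"
    and hit: "\<And>\<omega>. \<omega> \<in> space M \<Longrightarrow> \<exists>l\<ge>1. of_nat l * h \<omega> \<le> a l \<omega>"
    and bound: "\<And>\<omega>. h \<omega> \<le> K" and K: "K < top"
  shows "(\<integral>\<^sup>+\<omega>. h \<omega> \<partial>M) \<le> \<gamma>"
proof -
  \<comment> \<open>The hitting time \<open>l\<close> is finite but unbounded. Only points with
    \<open>l \<le> N\<close> count; at the others \<open>h'\<close> is 0, so a jump of length one
    costs nothing there.\<close>
  define good where "good N \<omega> \<longleftrightarrow> (\<exists>l\<in>{1..N}. of_nat l * h \<omega> \<le> a l \<omega>)" for N \<omega>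
  define h' where "h' N \<omega> = (if good N \<omega> then h \<omega> else 0)" for N \<omega>
  have good_meas [measurable]: "Measurable.pred M (good N)" for N
    unfolding good_def by measurable
  have h'_meas [measurable]: "h' N \<in> borel_measurable M" for N
    unfolding h'_def by measurable
  have h'_le: "h' N \<omega> \<le> h \<omega>" for N \<omega> by (simp add: h'_def)
  have dec_pow: "h ((S ^^ i) \<omega>) \<le> h \<omega>" if "\<omega> \<in> space M" for \<omega> i
    using that
  proof (induction i)
    case (Suc i)
    then show ?case
      using dec[OF funpow_in_space[OF Suc.prems, of i]] by (auto intro: order_trans)
  qed simp
  \<comment> \<open>The error \<open>N * K\<close> pays for the final stretch of at most
    \<open>N\<close> times, which a block could overshoot; each of them contributes at most
    \<open>K\<close>.\<close>
  have cover: "(\<Sum>i<n. h' N ((S ^^ i) \<omega>)) \<le> a n \<omega> + of_nat N * K" if "\<omega> \<in> space M" for n N \<omega>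
    using that
  proof (induction n arbitrary: \<omega> rule: less_induct)
    case (less n)
    note sp = funpow_in_space[OF less.prems]
    show ?case
    proof (cases "n \<le> N")
      case True
      have "(\<Sum>i<n. h' N ((S ^^ i) \<omega>)) \<le> (\<Sum>i<n. K)"
        by (intro sum_mono order_trans[OF h'_le bound])
      also have "\<dots> \<le> of_nat N * K" using True by (simp add: mult_right_mono)
      finally show ?thesis by (simp add: add_increasing)
    next
      case False
      have step: "(\<Sum>i<n. h' N ((S ^^ i) \<omega>)) \<le> a n \<omega> + of_nat N * K"
        if l: "1 \<le> l" "l \<le> n" and first: "(\<Sum>i<l. h' N ((S ^^ i) \<omega>)) \<le> a l \<omega>" for l
      proof -
        have "{..<n} = {..<l} \<union> (\<lambda>i. i + l) ` {..<n - l}"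
          using l(2) by (auto simp: image_iff Bex_def) presburger
        moreover have "{..<l} \<inter> (\<lambda>i. i + l) ` {..<n - l} = {}" by auto
        ultimately have "(\<Sum>i<n. h' N ((S ^^ i) \<omega>)) =
            (\<Sum>i<l. h' N ((S ^^ i) \<omega>)) + (\<Sum>i<n - l. h' N ((S ^^ (i + l)) \<omega>))"
          by (simp add: sum.union_disjoint sum.reindex)
        also have "\<dots> \<le> a l \<omega> + (a (n - l) ((S ^^ l) \<omega>) + of_nat N * K)"
          using less.IH[of "n - l", OF _ sp, of l] l False first
          by (intro add_mono) (auto simp: funpow_add)
        also have "\<dots> \<le> a n \<omega> + of_nat N * K"
          using super[OF less.prems, of l "n - l"] l by (auto simp: add.assoc[symmetric] intro: add_right_mono)
        finally show ?thesis .
      qed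
      show ?thesis
      proof (cases "good N \<omega>")
        case True
        then obtain l where l: "1 \<le> l" "l \<le> N" "of_nat l * h \<omega> \<le> a l \<omega>"
          unfolding good_def by auto
        have "(\<Sum>i<l. h' N ((S ^^ i) \<omega>)) \<le> (\<Sum>i<l. h \<omega>)"
          by (intro sum_mono order_trans[OF h'_le dec_pow] less.prems)
        also have "\<dots> \<le> a l \<omega>" using l by simp
        finally show ?thesis using step[of l] l False by auto
      next
        case bad: False
        show ?thesis using step[of 1] bad False by (simp add: h'_def)
      qed
    qed
  qed
  \<comment> \<open>The covering error does not grow with \<open>n\<close>, so it disappears after
    integrating \<open>cover\<close>, dividing by \<open>n\<close> and letting \<open>n\<close>
    grow.\<close>
  have h'_int: "(\<integral>\<^sup>+\<omega>. h' N \<omega> \<partial>M) \<le> \<gamma>" for N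
  proof (cases "\<gamma> = top")
    case False
    let ?I = "\<integral>\<^sup>+\<omega>. h' N \<omega> \<partial>M"
    have "of_nat n * ?I \<le> of_nat n * \<gamma> + of_nat N * K" for n
    proof -
      have "of_nat n * ?I = (\<integral>\<^sup>+\<omega>. (\<Sum>i<n. h' N ((S ^^ i) \<omega>)) \<partial>M)"
        by (subst nn_integral_sum) (auto simp: nn_integral_funpow)
      also have "\<dots> \<le> (\<integral>\<^sup>+\<omega>. a n \<omega> + of_nat N * K \<partial>M)"
        by (intro nn_integral_mono cover)
      also have "\<dots> \<le> of_nat n * \<gamma> + of_nat N * K"
        using mean[of n] by (subst nn_integral_add) (auto simp: emeasure_space_1 intro: add_right_mono)
      finally show ?thesis .
    qed
    note le = this
    have fin: "?I < top"
    proof -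
      have "?I \<le> (\<integral>\<^sup>+\<omega>. K \<partial>M)" by (intro nn_integral_mono order_trans[OF h'_le bound])
      also have "\<dots> < top" using K by (simp add: emeasure_space_1)
      finally show ?thesis .
    qed
    obtain i where i: "?I = ennreal i" "i \<ge> 0" using fin by (cases ?I) auto
    obtain g where g: "\<gamma> = ennreal g" "g \<ge> 0" using False by (cases \<gamma>) auto
    obtain k where k: "K = ennreal k" "k \<ge> 0" using K by (cases K) auto
    have "real n * i \<le> real n * g + real N * k" for n
      using le[of n] unfolding i(1) g(1) k(1) using i g k
      by (simp add: ennreal_of_nat_eq_real_of_nat ennreal_mult[symmetric] ennreal_plus[symmetric] del: ennreal_plus)
    then have *: "real n * (i - g) \<le> real N * k" for n by (simp add: algebra_simps)
    have "i \<le> g"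
    proof (rule ccontr)
      assume "\<not> i \<le> g"
      then obtain n where "real N * k < real n * (i - g)"
        using reals_Archimedean3[of "i - g"] by auto
      with *[of n] show False by simp
    qed
    then show ?thesis using i g by (simp add: ennreal_leI)
  qed simp
  have "(\<integral>\<^sup>+\<omega>. h \<omega> \<partial>M) = (\<integral>\<^sup>+\<omega>. (SUP N. h' N \<omega>) \<partial>M)"
  proof (rule nn_integral_cong)
    fix \<omega> assume "\<omega> \<in> space M"
    then obtain l where "l \<ge> 1" "of_nat l * h \<omega> \<le> a l \<omega>" using hit by blast
    then have "h' l \<omega> = h \<omega>" unfolding h'_def good_def by auto
    then show "h \<omega> = (SUP N. h' N \<omega>)"
      by (metis SUP_upper UNIV_I SUP_least antisym h'_le)
  qed
  also have "\<dots> = (SUP N. \<integral>\<^sup>+\<omega>. h' N \<omega> \<partial>M)"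
  proof (rule nn_integral_monotone_convergence_SUP)
    have "h' N \<omega> \<le> h' N' \<omega>" if "N \<le> N'" for N N' \<omega>
      unfolding h'_def good_def using that by force
    then show "incseq h'" by (auto simp: mono_def le_fun_def)
  qed auto
  also have "\<dots> \<le> \<gamma>" using h'_int by (rule SUP_least)
  finally show ?thesis .
qed

text \<open>The covering argument wants a bounded function that is reached at a finite time. Capping
  the limsup \<open>f\<close> at \<open>j\<close> and lowering it by \<open>1 / Suc j\<close> gives
  one: where it is positive it lies strictly below \<open>f\<close>, so some \<open>a l / l\<close>
  reaches it. Monotone convergence in \<open>j\<close> recovers \<open>f\<close>, even where
  \<open>f\<close> is infinite.\<close>

lemma (in mpt) superadditive_limsup_le:
  fixes a :: "nat \<Rightarrow> 'a \<Rightarrow> ennreal"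
  assumes a [measurable]: "\<And>n. a n \<in> borel_measurable M"
    and super: "\<And>m n \<omega>. \<omega> \<in> space M \<Longrightarrow> a m \<omega> + a n ((S ^^ m) \<omega>) \<le> a (m + n) \<omega>"
    and mean: "\<And>n. (\<integral>\<^sup>+\<omega>. a n \<omega> \<partial>M) \<le> of_nat n * \<gamma>"
  shows "(\<integral>\<^sup>+\<omega>. limsup (\<lambda>n. a n \<omega> / of_nat n) \<partial>M) \<le> \<gamma>"
proof -
  define f where "f \<omega> = limsup (\<lambda>n. a n \<omega> / of_nat n)" for \<omega>
  have f_meas [measurable]: "f \<in> borel_measurable M" unfolding f_def by measurable
  define h where "h j \<omega> = min (f \<omega>) (of_nat j) - ennreal (1 / Suc j)" for j \<omega>
  have h_meas [measurable]: "h j \<in> borel_measurable M" for j unfolding h_def by measurable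
  \<comment> \<open>Superadditivity with a first block of length 1 gives
    \<open>a n (S \<omega>) \<le> a (Suc n) \<omega>\<close>; the ratio of \<open>Suc n\<close> to
    \<open>n\<close> is absorbed by the distance between \<open>c'\<close> and
    \<open>c\<close>.\<close>
  have f_dec: "f (S \<omega>) \<le> f \<omega>" if sp: "\<omega> \<in> space M" for \<omega>
  proof (rule dense_ge)
    fix c assume "f \<omega> < c"
    then obtain c' where c': "f \<omega> < c'" "c' < c" using dense by blast
    obtain r' where r': "c' = ennreal r'" "r' \<ge> 0" using c'(2) by (cases c') auto
    have "0 < c'" using c'(1) by (rule le_less_trans[rotated]) simp
    then have "0 < r'" using r' by simp
    show "f (S \<omega>) \<le> c"
    proof (cases c)
      case (real r)
      have "r' < r" using c'(2) real r' by (simp add: ennreal_less_iff)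
      obtain k :: nat where k: "r' / (r - r') < real k" using reals_Archimedean2 by blast
      have "eventually (\<lambda>n. a n \<omega> / of_nat n < c') sequentially"
        using c'(1) unfolding f_def by (rule Limsup_lessD)
      then have "eventually (\<lambda>n. a (Suc n) \<omega> / of_nat (Suc n) < c') sequentially"
        by (rule eventually_compose_filterlim) (rule filterlim_Suc)
      then have "eventually (\<lambda>n. a n (S \<omega>) / of_nat n \<le> c) sequentially"
        using eventually_ge_at_top[of "max 1 k"]
      proof eventually_elim
        case (elim n)
        have n: "n \<ge> 1" "real k \<le> real n" using elim by auto
        have "a n (S \<omega>) \<le> a (Suc n) \<omega>"
          using super[OF sp, of 1 n] by (auto intro: order_trans[rotated])
        also have "\<dots> \<le> c' * of_nat (Suc n)"
          using elim(1) by (intro ennreal_le_mult_of_divide_le) (auto simp: less_imp_le of_nat_less_top simp del: of_nat_Suc)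
        also have "\<dots> \<le> c * of_nat n"
        proof -
          have "r' < real n * (r - r')"
            using k n \<open>r' < r\<close> by (smt (verit) divide_less_eq mult.commute)
          then have "r' * real (Suc n) \<le> r * real n" by (simp add: algebra_simps)
          then show ?thesis unfolding r'(1) real ennreal_of_nat_eq_real_of_nat
            using r' real by (simp add: ennreal_mult[symmetric] ennreal_leI del: of_nat_Suc)
        qed
        finally show ?case using n
          by (intro divide_le_posI_ennreal) (auto simp: mult.commute)
      qed
      then show ?thesis unfolding f_def by (rule Limsup_bounded)
    qed simp
  qed
  have h_int: "(\<integral>\<^sup>+\<omega>. h j \<omega> \<partial>M) \<le> \<gamma>" for j
  proof (rule superadditive_limsup_le_aux[where K="of_nat j", OF a h_meas super mean])
    fix \<omega> assume sp: "\<omega> \<in> space M"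
    show "h j (S \<omega>) \<le> h j \<omega>"
      unfolding h_def by (intro ennreal_minus_mono min.mono f_dec sp) auto
    show "\<exists>l\<ge>1. of_nat l * h j \<omega> \<le> a l \<omega>"
    proof (cases "h j \<omega> = 0")
      case False
      have "h j \<omega> < min (f \<omega>) (of_nat j)" using False unfolding h_def
        by (intro ennreal_diff_less) (auto simp: min_less_iff_disj of_nat_less_top)
      then have less: "h j \<omega> < f \<omega>" by simp
      show ?thesis
      proof (rule ccontr)
        assume "\<not> ?thesis"
        then have neg: "a l \<omega> < of_nat l * h j \<omega>" if "l \<ge> 1" for l using that not_le by blast
        have "eventually (\<lambda>n. a n \<omega> / of_nat n \<le> h j \<omega>) sequentially"
          using eventually_ge_at_top[of 1]
        proof eventually_elim
          case (elim n)
          show ?case using neg[OF elim] elim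
            by (intro divide_le_posI_ennreal) (auto simp: mult.commute less_imp_le)
        qed
        then have "f \<omega> \<le> h j \<omega>" unfolding f_def by (rule Limsup_bounded)
        with less show False by simp
      qed
    qed auto
  next
    fix \<omega> show "h j \<omega> \<le> of_nat j" unfolding h_def
      by (meson diff_le_self_ennreal min.cobounded2 order_trans)
  qed (simp_all add: of_nat_less_top)
  have h_mono: "h j \<omega> \<le> h j' \<omega>" if "j \<le> j'" for j j' \<omega>
    unfolding h_def using that
    by (intro ennreal_minus_mono min.mono) (auto simp: frac_le intro!: ennreal_leI)
  have "(SUP j. h j \<omega>) = f \<omega>" for \<omega>
  proof (rule antisym)
    show "(SUP j. h j \<omega>) \<le> f \<omega>" unfolding h_def
      by (rule SUP_least) (meson diff_le_self_ennreal min.cobounded1 order_trans)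
    show "f \<omega> \<le> (SUP j. h j \<omega>)"
    proof (rule dense_le)
      fix c assume "c < f \<omega>"
      then obtain c' where c': "c < c'" "c' < f \<omega>" using dense by blast
      obtain r r' where r: "c = ennreal r" "r \<ge> 0" "c' = ennreal r'" "r' \<ge> 0"
        using c' by (cases c; cases c') auto
      then have "r < r'" using c' by (simp add: ennreal_less_iff)
      then obtain j1 :: nat where j1: "1 / Suc j1 < r' - r" using nat_approx_posE[of "r' - r"] by auto
      obtain j2 :: nat where j2: "r' < real j2" using reals_Archimedean2 by blast
      define j where "j = max j1 j2"
      have j: "1 / Suc j \<le> r' - r" "r' \<le> real j"
        using j1 j2 unfolding j_def
        by (auto simp: max_def intro: order_trans[OF _ less_imp_le[OF j1]] simp: frac_le)
      have "c \<le> ennreal r' - ennreal (1 / Suc j)"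
        using j r by (simp add: ennreal_minus ennreal_leI)
      also have "\<dots> \<le> h j \<omega>" unfolding h_def
        using c' r j by (intro ennreal_minus_mono) (auto simp: ennreal_of_nat_eq_real_of_nat ennreal_leI)
      also have "\<dots> \<le> (SUP j. h j \<omega>)" by (rule SUP_upper) simp
      finally show "c \<le> (SUP j. h j \<omega>)" .
    qed
  qed
  then have "(\<integral>\<^sup>+\<omega>. f \<omega> \<partial>M) = (\<integral>\<^sup>+\<omega>. (SUP j. h j \<omega>) \<partial>M)" by simp
  also have "\<dots> = (SUP j. \<integral>\<^sup>+\<omega>. h j \<omega> \<partial>M)"
    by (rule nn_integral_monotone_convergence_SUP) (auto simp: mono_def le_fun_def h_mono)
  also have "\<dots> \<le> \<gamma>" using h_int by (rule SUP_least)
  finally show ?thesis unfolding f_def .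
qed

section \<open>Convergence almost surely and in mean\<close>

context prob_space
begin

text \<open>Both modes of convergence are bundled with integrability, so that each passage to
  another process, subsequence or measure is made once for both.\<close>

definition conv_L1 :: "(nat \<Rightarrow> 'a \<Rightarrow> real) \<Rightarrow> ('a \<Rightarrow> real) \<Rightarrow> bool" where
  "conv_L1 x f \<longleftrightarrow> (\<forall>n. integrable M (x n)) \<and> integrable M f \<and>
     (AE \<omega> in M. (\<lambda>n. x n \<omega>) \<longlonglongrightarrow> f \<omega>) \<and> (\<lambda>n. \<integral>\<omega>. \<bar>x n \<omega> - f \<omega>\<bar> \<partial>M) \<longlonglongrightarrow> 0"

lemma conv_L1_I:
  assumes "\<And>n. integrable M (x n)" "integrable M f" "AE \<omega> in M. (\<lambda>n. x n \<omega>) \<longlonglongrightarrow> f \<omega>"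
    and le: "\<And>n. (\<integral>\<omega>. \<bar>x n \<omega> - f \<omega>\<bar> \<partial>M) \<le> e n" and e: "e \<longlonglongrightarrow> 0"
  shows "conv_L1 x f"
proof -
  have "(\<lambda>n. \<integral>\<omega>. \<bar>x n \<omega> - f \<omega>\<bar> \<partial>M) \<longlonglongrightarrow> 0"
    by (rule tendsto_sandwich[OF _ _ tendsto_const e]) (use le in \<open>auto intro!: always_eventually\<close>)
  then show ?thesis unfolding conv_L1_def using assms by blast
qed

lemma conv_L1D:
  assumes "conv_L1 x f"
  shows "integrable M (x n)" "integrable M f" "AE \<omega> in M. (\<lambda>n. x n \<omega>) \<longlonglongrightarrow> f \<omega>"
    "(\<lambda>n. \<integral>\<omega>. \<bar>x n \<omega> - f \<omega>\<bar> \<partial>M) \<longlonglongrightarrow> 0"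
  using assms unfolding conv_L1_def by auto

lemma conv_L1_add:
  assumes x: "conv_L1 x f" and y: "conv_L1 y g"
  shows "conv_L1 (\<lambda>n \<omega>. x n \<omega> + y n \<omega>) (\<lambda>\<omega>. f \<omega> + g \<omega>)"
proof (rule conv_L1_I)
  note [simp] = conv_L1D(1,2)[OF x] conv_L1D(1,2)[OF y]
  show "integrable M (\<lambda>\<omega>. x n \<omega> + y n \<omega>)" "integrable M (\<lambda>\<omega>. f \<omega> + g \<omega>)" for n by auto
  show "AE \<omega> in M. (\<lambda>n. x n \<omega> + y n \<omega>) \<longlonglongrightarrow> f \<omega> + g \<omega>"
    using conv_L1D(3)[OF x] conv_L1D(3)[OF y] by eventually_elim (rule tendsto_add)
  show "(\<integral>\<omega>. \<bar>x n \<omega> + y n \<omega> - (f \<omega> + g \<omega>)\<bar> \<partial>M) \<le>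
      (\<integral>\<omega>. \<bar>x n \<omega> - f \<omega>\<bar> \<partial>M) + (\<integral>\<omega>. \<bar>y n \<omega> - g \<omega>\<bar> \<partial>M)" for n
  proof -
    have "(\<integral>\<omega>. \<bar>x n \<omega> + y n \<omega> - (f \<omega> + g \<omega>)\<bar> \<partial>M) \<le>
        (\<integral>\<omega>. \<bar>x n \<omega> - f \<omega>\<bar> + \<bar>y n \<omega> - g \<omega>\<bar> \<partial>M)"
      by (intro integral_mono) auto
    then show ?thesis by (subst (asm) Bochner_Integration.integral_add) auto
  qed
  show "(\<lambda>n. (\<integral>\<omega>. \<bar>x n \<omega> - f \<omega>\<bar> \<partial>M) + (\<integral>\<omega>. \<bar>y n \<omega> - g \<omega>\<bar> \<partial>M)) \<longlonglongrightarrow> 0"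
    using tendsto_add[OF conv_L1D(4)[OF x] conv_L1D(4)[OF y]] by simp
qed

lemma conv_L1_scale:
  assumes x: "conv_L1 x f" and c: "c \<longlonglongrightarrow> (d::real)"
  shows "conv_L1 (\<lambda>n \<omega>. c n * x n \<omega>) (\<lambda>\<omega>. d * f \<omega>)"
proof (rule conv_L1_I)
  note [simp] = conv_L1D(1,2)[OF x]
  show "integrable M (\<lambda>\<omega>. c n * x n \<omega>)" "integrable M (\<lambda>\<omega>. d * f \<omega>)" for n by auto
  show "AE \<omega> in M. (\<lambda>n. c n * x n \<omega>) \<longlonglongrightarrow> d * f \<omega>"
    using conv_L1D(3)[OF x] by eventually_elim (rule tendsto_mult[OF c])
  have *: "\<bar>c n * x n \<omega> - d * f \<omega>\<bar> \<le> \<bar>c n\<bar> * \<bar>x n \<omega> - f \<omega>\<bar> + \<bar>c n - d\<bar> * \<bar>f \<omega>\<bar>" for n \<omega>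
  proof -
    have "c n * x n \<omega> - d * f \<omega> = c n * (x n \<omega> - f \<omega>) + (c n - d) * f \<omega>"
      by (simp add: algebra_simps)
    then show ?thesis by (simp only: abs_mult[symmetric] abs_triangle_ineq)
  qed
  show "(\<integral>\<omega>. \<bar>c n * x n \<omega> - d * f \<omega>\<bar> \<partial>M) \<le>
      \<bar>c n\<bar> * (\<integral>\<omega>. \<bar>x n \<omega> - f \<omega>\<bar> \<partial>M) + \<bar>c n - d\<bar> * (\<integral>\<omega>. \<bar>f \<omega>\<bar> \<partial>M)" for n
  proof -
    have "(\<integral>\<omega>. \<bar>c n * x n \<omega> - d * f \<omega>\<bar> \<partial>M) \<le>
        (\<integral>\<omega>. \<bar>c n\<bar> * \<bar>x n \<omega> - f \<omega>\<bar> + \<bar>c n - d\<bar> * \<bar>f \<omega>\<bar> \<partial>M)"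
      by (intro integral_mono *) auto
    then show ?thesis by (subst (asm) Bochner_Integration.integral_add) auto
  qed
  show "(\<lambda>n. \<bar>c n\<bar> * (\<integral>\<omega>. \<bar>x n \<omega> - f \<omega>\<bar> \<partial>M) + \<bar>c n - d\<bar> * (\<integral>\<omega>. \<bar>f \<omega>\<bar> \<partial>M)) \<longlonglongrightarrow> 0"
    using conv_L1D(4)[OF x] c by (auto intro!: tendsto_eq_intros)
qed

lemma conv_L1_subseq:
  assumes x: "conv_L1 x f" and r: "filterlim r sequentially sequentially"
  shows "conv_L1 (\<lambda>n. x (r n)) f"
  using assms filterlim_compose[OF conv_L1D(4)[OF x] r]
  unfolding conv_L1_def by (auto elim!: eventually_mono intro: filterlim_compose)

lemma conv_L1_cong:
  assumes "conv_L1 x f" "\<And>n \<omega>. \<omega> \<in> space M \<Longrightarrow> y n \<omega> = x n \<omega>"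
  shows "conv_L1 y f"
  using assms unfolding conv_L1_def
  by (auto cong: Bochner_Integration.integral_cong Bochner_Integration.integrable_cong AE_cong)

lemma conv_L1_integral:
  assumes "conv_L1 x f"
  shows "(\<lambda>n. \<integral>\<omega>. x n \<omega> \<partial>M) \<longlonglongrightarrow> (\<integral>\<omega>. f \<omega> \<partial>M)"
proof (rule LIM_zero_cancel, rule tendsto_rabs_zero_cancel,
    rule tendsto_sandwich[OF _ _ tendsto_const conv_L1D(4)[OF assms]])
  note [simp] = conv_L1D(1,2)[OF assms]
  have "\<bar>(\<integral>\<omega>. x n \<omega> \<partial>M) - (\<integral>\<omega>. f \<omega> \<partial>M)\<bar> \<le> (\<integral>\<omega>. \<bar>x n \<omega> - f \<omega>\<bar> \<partial>M)" for n
    using integral_abs_bound[of M "\<lambda>\<omega>. x n \<omega> - f \<omega>"] by simp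
  then show "eventually (\<lambda>n. \<bar>(\<integral>\<omega>. x n \<omega> \<partial>M) - (\<integral>\<omega>. f \<omega> \<partial>M)\<bar> \<le> (\<integral>\<omega>. \<bar>x n \<omega> - f \<omega>\<bar> \<partial>M)) sequentially"
    by simp
qed simp

text \<open>Fatou's lemma in the second index turns the Cauchy bound into a bound on the distance to
  the almost sure limit, whose integrability comes out as well.\<close>

lemma L1_Cauchy_tendsto:
  assumes int: "\<And>n. integrable M (x n)"
    and f [measurable]: "f \<in> borel_measurable M"
    and ae: "AE \<omega> in M. (\<lambda>n. x n \<omega>) \<longlonglongrightarrow> f \<omega>"
    and cauchy: "\<And>e. e > 0 \<Longrightarrow> \<exists>N. \<forall>m\<ge>N. \<forall>n\<ge>N. (\<integral>\<omega>. \<bar>x m \<omega> - x n \<omega>\<bar> \<partial>M) \<le> e"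
  shows "conv_L1 x f"
proof -
  note [simp] = int
  have [measurable]: "x n \<in> borel_measurable M" for n using int by blast
  have key: "\<exists>N. \<forall>n\<ge>N. (\<integral>\<^sup>+\<omega>. ennreal \<bar>x n \<omega> - f \<omega>\<bar> \<partial>M) \<le> ennreal e" if e: "e > 0" for e
  proof -
    obtain N where N: "\<forall>m\<ge>N. \<forall>n\<ge>N. (\<integral>\<omega>. \<bar>x m \<omega> - x n \<omega>\<bar> \<partial>M) \<le> e" using cauchy[OF e] by blast
    have "(\<integral>\<^sup>+\<omega>. ennreal \<bar>x n \<omega> - f \<omega>\<bar> \<partial>M) \<le> ennreal e" if n: "n \<ge> N" for n
    proof -
      have "(\<integral>\<^sup>+\<omega>. ennreal \<bar>x n \<omega> - f \<omega>\<bar> \<partial>M) = (\<integral>\<^sup>+\<omega>. liminf (\<lambda>m. ennreal \<bar>x n \<omega> - x m \<omega>\<bar>) \<partial>M)"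
      proof (rule nn_integral_cong_AE)
        show "AE \<omega> in M. ennreal \<bar>x n \<omega> - f \<omega>\<bar> = liminf (\<lambda>m. ennreal \<bar>x n \<omega> - x m \<omega>\<bar>)"
          using ae
        proof eventually_elim
          case (elim \<omega>)
          have "(\<lambda>m. ennreal \<bar>x n \<omega> - x m \<omega>\<bar>) \<longlonglongrightarrow> ennreal \<bar>x n \<omega> - f \<omega>\<bar>"
            using elim by (intro tendsto_intros)
          from lim_imp_Liminf[OF _ this] show ?case by simp
        qed
      qed
      also have "\<dots> \<le> liminf (\<lambda>m. \<integral>\<^sup>+\<omega>. ennreal \<bar>x n \<omega> - x m \<omega>\<bar> \<partial>M)"
        by (rule nn_integral_liminf) auto
      also have "\<dots> \<le> liminf (\<lambda>m. ennreal e)"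
      proof (rule Liminf_mono, use eventually_ge_at_top[of N] in eventually_elim)
        case (elim m)
        have "(\<integral>\<^sup>+\<omega>. ennreal \<bar>x n \<omega> - x m \<omega>\<bar> \<partial>M) = ennreal (\<integral>\<omega>. \<bar>x n \<omega> - x m \<omega>\<bar> \<partial>M)"
          by (rule nn_integral_eq_integral) auto
        then show ?case using N n elim by (auto intro!: ennreal_leI)
      qed
      also have "\<dots> = ennreal e" by (simp add: Liminf_const)
      finally show ?thesis .
    qed
    then show ?thesis by blast
  qed
  have diff: "integrable M (\<lambda>\<omega>. x n \<omega> - f \<omega>)" if "(\<integral>\<^sup>+\<omega>. ennreal \<bar>x n \<omega> - f \<omega>\<bar> \<partial>M) \<le> ennreal e" for n e
    using that by (intro integrableI_bounded) (auto intro: le_less_trans)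
  obtain N where "(\<integral>\<^sup>+\<omega>. ennreal \<bar>x N \<omega> - f \<omega>\<bar> \<partial>M) \<le> ennreal 1" using key[of 1] by auto
  from Bochner_Integration.integrable_diff[OF int[of N] diff[OF this]] have fint: "integrable M f" by simp
  have "(\<lambda>n. \<integral>\<omega>. \<bar>x n \<omega> - f \<omega>\<bar> \<partial>M) \<longlonglongrightarrow> 0"
  proof (rule LIMSEQ_I)
    fix r :: real assume r: "0 < r"
    then obtain N where N: "\<And>n. n \<ge> N \<Longrightarrow> (\<integral>\<^sup>+\<omega>. ennreal \<bar>x n \<omega> - f \<omega>\<bar> \<partial>M) \<le> ennreal (r / 2)"
      using key[of "r / 2"] by auto
    have "norm ((\<integral>\<omega>. \<bar>x n \<omega> - f \<omega>\<bar> \<partial>M) - 0) < r" if "n \<ge> N" for n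
    proof -
      have "(\<integral>\<^sup>+\<omega>. ennreal \<bar>x n \<omega> - f \<omega>\<bar> \<partial>M) = ennreal (\<integral>\<omega>. \<bar>x n \<omega> - f \<omega>\<bar> \<partial>M)"
        using fint by (intro nn_integral_eq_integral) auto
      then show ?thesis using N[OF that] r by (simp add: ennreal_le_iff)
    qed
    then show "\<exists>no. \<forall>n\<ge>no. norm ((\<integral>\<omega>. \<bar>x n \<omega> - f \<omega>\<bar> \<partial>M) - 0) < r" by blast
  qed
  then show ?thesis unfolding conv_L1_def using int fint ae by blast
qed

text \<open>The pointwise error may be a random \<open>L\<close> with small mean, since the limsup
  inequality controls only means. The limits \<open>g\<close> of the approximants need not be
  compared with each other; convergence of \<open>x\<close> follows from the Cauchy
  property.\<close>

lemma conv_L1_approx: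
  assumes int: "\<And>n. integrable M (x n)"
    and approx: "\<And>\<epsilon>. \<epsilon> > 0 \<Longrightarrow> \<exists>y g L. conv_L1 y g \<and> L \<in> borel_measurable M \<and>
      (\<integral>\<^sup>+\<omega>. L \<omega> \<partial>M) \<le> ennreal \<epsilon> \<and>
      (AE \<omega> in M. \<forall>e>0. eventually (\<lambda>n. ennreal \<bar>x n \<omega> - y n \<omega>\<bar> \<le> L \<omega> + ennreal e) sequentially) \<and>
      eventually (\<lambda>n. (\<integral>\<omega>. \<bar>x n \<omega> - y n \<omega>\<bar> \<partial>M) \<le> \<epsilon>) sequentially"
  shows "\<exists>f. conv_L1 x f"
proof -
  note [simp] = int
  have [measurable]: "x n \<in> borel_measurable M" for n using int by blast
  have "\<forall>k. \<exists>y g L. conv_L1 y g \<and> L \<in> borel_measurable M \<and>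
      (\<integral>\<^sup>+\<omega>. L \<omega> \<partial>M) \<le> ennreal (1 / Suc k) \<and>
      (AE \<omega> in M. \<forall>e>0. eventually (\<lambda>n. ennreal \<bar>x n \<omega> - y n \<omega>\<bar> \<le> L \<omega> + ennreal e) sequentially) \<and>
      eventually (\<lambda>n. (\<integral>\<omega>. \<bar>x n \<omega> - y n \<omega>\<bar> \<partial>M) \<le> 1 / Suc k) sequentially"
    by (intro allI approx) simp
  then obtain y g L where y: "\<And>k. conv_L1 (y k) (g k)" and L [measurable]: "\<And>k. L k \<in> borel_measurable M"
    and Lint: "\<And>k::nat. (\<integral>\<^sup>+\<omega>. L k \<omega> \<partial>M) \<le> ennreal (1 / Suc k)"
    and Lae: "\<And>k. AE \<omega> in M. \<forall>e>0. eventually (\<lambda>n. ennreal \<bar>x n \<omega> - y k n \<omega>\<bar> \<le> L k \<omega> + ennreal e) sequentially"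
    and yL1: "\<And>k. eventually (\<lambda>n. (\<integral>\<omega>. \<bar>x n \<omega> - y k n \<omega>\<bar> \<partial>M) \<le> 1 / Suc k) sequentially"
    by (simp only: choice_iff) blast
  have "(\<integral>\<^sup>+\<omega>. (INF k. L k \<omega>) \<partial>M) \<le> 0"
  proof (rule ennreal_le_epsilon)
    fix e :: real assume "0 < e"
    then obtain k :: nat where k: "1 / Suc k < e" using nat_approx_posE by blast
    have "(\<integral>\<^sup>+\<omega>. (INF k. L k \<omega>) \<partial>M) \<le> (\<integral>\<^sup>+\<omega>. L k \<omega> \<partial>M)"
      by (intro nn_integral_mono INF_lower) simp
    also have "\<dots> \<le> ennreal e" using k by (intro order_trans[OF Lint] ennreal_leI) simp
    finally show "(\<integral>\<^sup>+\<omega>. (INF k. L k \<omega>) \<partial>M) \<le> 0 + ennreal e" by simp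
  qed
  \<comment> \<open>No single \<open>L k\<close> is small everywhere, but their infimum vanishes
    almost everywhere, so at almost every point some approximant is eventually as close as
    desired.\<close>
  then have "AE \<omega> in M. (INF k. L k \<omega>) = 0"
    by (subst (asm) le_zero_eq, subst (asm) nn_integral_0_iff_AE) auto
  moreover have "AE \<omega> in M. \<forall>k. \<forall>e>0. eventually (\<lambda>n. ennreal \<bar>x n \<omega> - y k n \<omega>\<bar> \<le> L k \<omega> + ennreal e) sequentially"
    using Lae by (simp add: AE_all_countable)
  moreover have "AE \<omega> in M. \<forall>k. (\<lambda>n. y k n \<omega>) \<longlonglongrightarrow> g k \<omega>"
    using conv_L1D(3)[OF y] by (simp add: AE_all_countable)
  ultimately have conv: "AE \<omega> in M. (\<lambda>n. x n \<omega>) \<longlonglongrightarrow> lim (\<lambda>n. x n \<omega>)"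
  proof eventually_elim
    case (elim \<omega>)
    have "Cauchy (\<lambda>n. x n \<omega>)"
    proof (rule metric_CauchyI)
      fix e :: real assume e: "0 < e"
      have "(INF k. L k \<omega>) < ennreal (e / 6)" using elim(1) e by simp
      then obtain k where k: "L k \<omega> < ennreal (e / 6)" by (auto simp: INF_less_iff)
      have "eventually (\<lambda>n. ennreal \<bar>x n \<omega> - y k n \<omega>\<bar> \<le> L k \<omega> + ennreal (e / 6)) sequentially"
        using elim(2) e by simp
      then have "eventually (\<lambda>n. \<bar>x n \<omega> - y k n \<omega>\<bar> < e / 3) sequentially"
      proof eventually_elim
        case (elim n)
        have "ennreal \<bar>x n \<omega> - y k n \<omega>\<bar> < ennreal (e / 6) + ennreal (e / 6)"
          using elim k ennreal_add_left_cancel_less[of "ennreal (e/6)" "L k \<omega>" "ennreal (e/6)"]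
          by (auto simp: add.commute intro: le_less_trans)
        also have "\<dots> = ennreal (e / 3)" using e by (simp add: ennreal_plus[symmetric] del: ennreal_plus)
        finally show ?case by (simp add: ennreal_less_iff)
      qed
      moreover have "eventually (\<lambda>n. \<bar>y k n \<omega> - g k \<omega>\<bar> < e / 6) sequentially"
        using elim(3) e tendstoD[of "\<lambda>n. y k n \<omega>" "g k \<omega>" sequentially "e / 6"] by (auto simp: dist_real_def)
      ultimately have "eventually (\<lambda>n. \<bar>x n \<omega> - g k \<omega>\<bar> < e / 2) sequentially"
        by eventually_elim linarith
      then obtain N where N: "\<And>n. n \<ge> N \<Longrightarrow> \<bar>x n \<omega> - g k \<omega>\<bar> < e / 2"
        by (auto simp: eventually_sequentially)
      show "\<exists>N. \<forall>m\<ge>N. \<forall>n\<ge>N. dist (x m \<omega>) (x n \<omega>) < e"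
      proof (intro exI[of _ N] allI impI)
        fix m n assume "m \<ge> N" "n \<ge> N"
        then show "dist (x m \<omega>) (x n \<omega>) < e"
          using N[of m] N[of n] unfolding dist_real_def by linarith
      qed
    qed
    then show ?case by (simp add: Cauchy_convergent_iff convergent_LIMSEQ_iff)
  qed
  have "conv_L1 x (\<lambda>\<omega>. lim (\<lambda>n. x n \<omega>))"
  proof (rule L1_Cauchy_tendsto[OF int _ conv])
    show "(\<lambda>\<omega>. lim (\<lambda>n. x n \<omega>)) \<in> borel_measurable M" by measurable
    fix e :: real assume e: "e > 0"
    obtain k :: nat where k: "1 / Suc k < e / 4" using nat_approx_posE[of "e / 4"] e by auto
    note [simp] = conv_L1D(1,2)[OF y[of k]]
    have "eventually (\<lambda>n. (\<integral>\<omega>. \<bar>y k n \<omega> - g k \<omega>\<bar> \<partial>M) < e / 4) sequentially"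
      using order_tendstoD(2)[OF conv_L1D(4)[OF y[of k]], of "e / 4"] e by simp
    with yL1[of k] have "eventually (\<lambda>n. (\<integral>\<omega>. \<bar>x n \<omega> - g k \<omega>\<bar> \<partial>M) \<le> e / 2) sequentially"
    proof eventually_elim
      case (elim n)
      have "(\<integral>\<omega>. \<bar>x n \<omega> - g k \<omega>\<bar> \<partial>M) \<le> (\<integral>\<omega>. \<bar>x n \<omega> - y k n \<omega>\<bar> + \<bar>y k n \<omega> - g k \<omega>\<bar> \<partial>M)"
        by (intro integral_mono) auto
      also have "\<dots> = (\<integral>\<omega>. \<bar>x n \<omega> - y k n \<omega>\<bar> \<partial>M) + (\<integral>\<omega>. \<bar>y k n \<omega> - g k \<omega>\<bar> \<partial>M)"
        by (rule Bochner_Integration.integral_add) auto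
      finally show ?case using elim k by linarith
    qed
    then obtain N where N: "\<And>n. n \<ge> N \<Longrightarrow> (\<integral>\<omega>. \<bar>x n \<omega> - g k \<omega>\<bar> \<partial>M) \<le> e / 2"
      by (auto simp: eventually_sequentially)
    have "(\<integral>\<omega>. \<bar>x m \<omega> - x n \<omega>\<bar> \<partial>M) \<le> e" if "m \<ge> N" "n \<ge> N" for m n
    proof -
      have "(\<integral>\<omega>. \<bar>x m \<omega> - x n \<omega>\<bar> \<partial>M) \<le> (\<integral>\<omega>. \<bar>x m \<omega> - g k \<omega>\<bar> + \<bar>x n \<omega> - g k \<omega>\<bar> \<partial>M)"
        by (intro integral_mono) auto
      also have "\<dots> = (\<integral>\<omega>. \<bar>x m \<omega> - g k \<omega>\<bar> \<partial>M) + (\<integral>\<omega>. \<bar>x n \<omega> - g k \<omega>\<bar> \<partial>M)"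
        by (rule Bochner_Integration.integral_add) auto
      finally show ?thesis using N[OF that(1)] N[OF that(2)] by linarith
    qed
    then show "\<exists>N. \<forall>m\<ge>N. \<forall>n\<ge>N. (\<integral>\<omega>. \<bar>x m \<omega> - x n \<omega>\<bar> \<partial>M) \<le> e" by blast
  qed
  then show ?thesis by blast
qed

text \<open>Borel-Cantelli for the events \<open>e * n < \<bar>Y n\<bar>\<close>: their
  probabilities are dominated by those of \<open>e * n < \<bar>Z\<bar>\<close>, which are summable
  as \<open>Z\<close> is integrable. Only marginal tails enter, so the lemma covers values along
  orbits and at moving sites.\<close>

lemma AE_tail_dominated_div_tendsto_0:
  fixes Y :: "nat \<Rightarrow> 'a \<Rightarrow> real" and Z :: "'a \<Rightarrow> real"
  assumes [measurable]: "\<And>n. Y n \<in> borel_measurable M" and Z: "integrable M Z"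
    and tail: "\<And>n t. prob {\<omega>\<in>space M. t < \<bar>Y n \<omega>\<bar>} \<le> prob {\<omega>\<in>space M. t < \<bar>Z \<omega>\<bar>}"
  shows "AE \<omega> in M. (\<lambda>n. Y n \<omega> / real n) \<longlonglongrightarrow> 0"
proof -
  have [measurable]: "Z \<in> borel_measurable M" using Z by blast
  have ev: "AE \<omega> in M. eventually (\<lambda>n. \<bar>Y n \<omega>\<bar> \<le> e * real n) sequentially" if e: "e > 0" for e
  proof -
    define A where "A n = {\<omega>\<in>space M. e * real n < \<bar>Y n \<omega>\<bar>}" for n
    define B where "B n = {\<omega>\<in>space M. e * real n < \<bar>Z \<omega>\<bar>}" for n
    have [measurable]: "A n \<in> sets M" "B n \<in> sets M" for n unfolding A_def B_def by measurable
    have sum_B: "(\<Sum>n<N. prob (B n)) \<le> 1 + (\<integral>\<omega>. \<bar>Z \<omega>\<bar> \<partial>M) / e" for N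
    proof -
      \<comment> \<open>The left side counts the \<open>n\<close> with
        \<open>e * n < \<bar>Z\<bar>\<close>; the extra 1 is for \<open>n = 0\<close>.\<close>
      have pt: "(\<Sum>n<N. indicator (B n) \<omega> :: real) \<le> 1 + \<bar>Z \<omega>\<bar> / e" for \<omega>
      proof -
        have "(\<Sum>n<N. indicator (B n) \<omega> :: real) = real (card {n\<in>{..<N}. \<omega> \<in> B n})"
          by (simp add: indicator_def sum.If_cases Int_def)
        also have "\<dots> \<le> real (card {..nat \<lfloor>\<bar>Z \<omega>\<bar> / e\<rfloor>})"
        proof (intro of_nat_mono card_mono subsetI)
          fix n assume "n \<in> {n \<in> {..<N}. \<omega> \<in> B n}"
          then have "real n < \<bar>Z \<omega>\<bar> / e" using e by (auto simp: B_def field_simps)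
          then show "n \<in> {..nat \<lfloor>\<bar>Z \<omega>\<bar> / e\<rfloor>}" by (simp add: le_nat_iff le_floor_iff)
        qed simp
        also have "\<dots> \<le> 1 + \<bar>Z \<omega>\<bar> / e" using e by simp
        finally show ?thesis .
      qed
      have "(\<Sum>n<N. prob (B n)) = (\<integral>\<omega>. (\<Sum>n<N. indicator (B n) \<omega>) \<partial>M)"
        by (subst Bochner_Integration.integral_sum) (auto simp: emeasure_eq_measure)
      also have "\<dots> \<le> (\<integral>\<omega>. 1 + \<bar>Z \<omega>\<bar> / e \<partial>M)"
        using Z by (intro integral_mono pt Bochner_Integration.integrable_sum) (auto simp: emeasure_eq_measure)
      also have "\<dots> = 1 + (\<integral>\<omega>. \<bar>Z \<omega>\<bar> \<partial>M) / e"
        using Z by (simp add: prob_space)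
      finally show ?thesis .
    qed
    have "summable (\<lambda>n. prob (B n))"
      by (rule summableI_nonneg_bounded[OF _ sum_B]) simp
    then have "summable (\<lambda>n. prob (A n))"
      by (rule summable_comparison_test'[where N=0]) (use tail in \<open>auto simp: A_def B_def\<close>)
    then have "AE \<omega> in M. eventually (\<lambda>n. \<omega> \<in> space M - A n) sequentially"
      by (intro borel_cantelli_AE1) (auto simp: emeasure_eq_measure)
    then show ?thesis
    proof eventually_elim
      case (elim \<omega>)
      then show ?case by eventually_elim (auto simp: A_def not_less)
    qed
  qed
  have "AE \<omega> in M. \<forall>k. eventually (\<lambda>n. \<bar>Y n \<omega>\<bar> \<le> (1 / real (Suc k)) * real n) sequentially"
    unfolding AE_all_countable by (intro allI ev) simp
  then show ?thesis
  proof eventually_elim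
    case (elim \<omega>)
    show ?case
    proof (rule tendstoI)
      fix r :: real assume "0 < r"
      then obtain k :: nat where k: "1 / Suc k < r" using nat_approx_posE by blast
      from elim[rule_format, of k] eventually_gt_at_top[of 0]
      show "eventually (\<lambda>n. dist (Y n \<omega> / real n) 0 < r) sequentially"
      proof eventually_elim
        case (elim n)
        then have "\<bar>Y n \<omega>\<bar> / real n \<le> 1 / Suc k" by (simp add: divide_le_eq)
        then show ?case using k by (simp add: dist_real_def)
      qed
    qed
  qed
qed

end

section \<open>Birkhoff's and Kingman's theorems\<close>

context mpt
begin

abbreviation birkhoff_sum :: "('a \<Rightarrow> real) \<Rightarrow> nat \<Rightarrow> 'a \<Rightarrow> real" where
  "birkhoff_sum h n \<omega> \<equiv> \<Sum>i<n. h ((S ^^ i) \<omega>)"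

lemma sum_orbit_split:
  fixes h :: "'a \<Rightarrow> 'b :: comm_monoid_add"
  shows "(\<Sum>i<m + n. h ((S ^^ i) \<omega>)) = (\<Sum>i<m. h ((S ^^ i) \<omega>)) + (\<Sum>i<n. h ((S ^^ i) ((S ^^ m) \<omega>)))"
  by (induction n) (auto simp: add.assoc funpow_add[symmetric] add.commute[of m] simp del: funpow.simps simp flip: comp_apply[of "S ^^ _" "S ^^ _"])

lemma integrable_birkhoff_sum [simp]: "integrable M h \<Longrightarrow> integrable M (birkhoff_sum h n)"
  by (auto intro: integrable_funpow)

lemma integral_birkhoff_sum:
  assumes "integrable M h"
  shows "(\<integral>\<omega>. birkhoff_sum h n \<omega> \<partial>M) = real n * (\<integral>\<omega>. h \<omega> \<partial>M)"
  using assms by (subst Bochner_Integration.integral_sum) (auto simp: integrable_funpow integral_funpow)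

lemma limsup_average_le:
  assumes [measurable]: "g \<in> borel_measurable M"
  shows "(\<integral>\<^sup>+\<omega>. limsup (\<lambda>n. (\<Sum>i<n. g ((S ^^ i) \<omega>)) / of_nat n) \<partial>M) \<le> (\<integral>\<^sup>+\<omega>. g \<omega> \<partial>M)"
proof (rule superadditive_limsup_le)
  show "(\<integral>\<^sup>+\<omega>. (\<Sum>i<n. g ((S ^^ i) \<omega>)) \<partial>M) \<le> of_nat n * (\<integral>\<^sup>+\<omega>. g \<omega> \<partial>M)" for n
    by (subst nn_integral_sum) (auto simp: nn_integral_funpow)
qed (auto simp: sum_orbit_split)

lemma eventually_le_limsup_add:
  fixes u :: "nat \<Rightarrow> ennreal"
  assumes "e > 0"
  shows "eventually (\<lambda>n. u n \<le> limsup u + ennreal e) sequentially"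
proof (cases "limsup u = top")
  case False
  then have "limsup u < limsup u + ennreal e"
    using assms by (cases "limsup u") (auto simp: ennreal_plus[symmetric] ennreal_less_iff simp del: ennreal_plus)
  from Limsup_lessD[OF this] show ?thesis by eventually_elim simp
qed simp

text \<open>Apply the limsup inequality to \<open>K + h\<close> and to \<open>K - h\<close>. The
  means of the two limsups \<open>U\<close> and \<open>V\<close> add up to at most
  \<open>2 * K\<close>, while \<open>U + V \<ge> 2 * K\<close> pointwise. Hence
  \<open>U + V = 2 * K\<close> almost everywhere, which says that the limsup and the liminf of the
  averages agree.\<close>

lemma birkhoff_bounded:
  fixes h :: "'a \<Rightarrow> real"
  assumes [measurable]: "h \<in> borel_measurable M" and K: "\<And>\<omega>. \<bar>h \<omega>\<bar> \<le> K"
  shows "\<exists>f. conv_L1 (\<lambda>n \<omega>. birkhoff_sum h n \<omega> / real n) f"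
proof -
  define x where "x n \<omega> = birkhoff_sum h n \<omega> / real n" for n \<omega>
  have K0: "0 \<le> K" using K[of undefined] by linarith
  have [measurable]: "x n \<in> borel_measurable M" for n unfolding x_def by measurable
  have h_int: "integrable M h" using K by (intro integrable_const_bound[of _ K]) auto
  have xK: "\<bar>x n \<omega>\<bar> \<le> K" for n \<omega>
  proof (cases "n = 0")
    case False
    have "\<bar>birkhoff_sum h n \<omega>\<bar> \<le> (\<Sum>i<n. K)" by (rule order_trans[OF sum_abs sum_mono]) (rule K)
    then show ?thesis using False by (simp add: x_def field_simps)
  qed (simp add: x_def K0)
  define U where "U \<omega> = limsup (\<lambda>n. ennreal (x n \<omega> + K))" for \<omega>
  define V where "V \<omega> = limsup (\<lambda>n. ennreal (K - x n \<omega>))" for \<omega>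
  have [measurable]: "U \<in> borel_measurable M" "V \<in> borel_measurable M" unfolding U_def V_def by measurable
  \<comment> \<open>The sign \<open>s\<close> treats \<open>K + h\<close> and \<open>K - h\<close>
    at once.\<close>
  have lim_eq: "limsup (\<lambda>n. ennreal (K + s * x n \<omega>)) =
      limsup (\<lambda>n. (\<Sum>i<n. ennreal (K + s * h ((S ^^ i) \<omega>))) / of_nat n)" if s: "\<bar>s\<bar> = 1" for s \<omega>
  proof (rule Limsup_eq, use eventually_gt_at_top[of 0] in eventually_elim)
    case (elim n)
    have "0 \<le> K + s * h \<omega>" for \<omega> using K[of \<omega>] s by (auto simp: abs_if split: if_splits)
    then have "(\<Sum>i<n. ennreal (K + s * h ((S ^^ i) \<omega>))) = ennreal (\<Sum>i<n. K + s * h ((S ^^ i) \<omega>))"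
      and "0 \<le> (\<Sum>i<n. K + s * h ((S ^^ i) \<omega>))"
      by (auto intro: sum_nonneg)
    then show ?case using elim
      by (simp add: x_def sum.distrib sum_distrib_left[symmetric] ennreal_of_nat_eq_real_of_nat divide_ennreal
          add_divide_distrib)
  qed
  have int_le: "(\<integral>\<^sup>+\<omega>. limsup (\<lambda>n. ennreal (K + s * x n \<omega>)) \<partial>M) \<le> ennreal (K + s * (\<integral>\<omega>. h \<omega> \<partial>M))"
    if s: "\<bar>s\<bar> = 1" for s
  proof -
    have nn: "0 \<le> K + s * h \<omega>" for \<omega> using K[of \<omega>] s by (auto simp: abs_if split: if_splits)
    have "(\<integral>\<^sup>+\<omega>. limsup (\<lambda>n. ennreal (K + s * x n \<omega>)) \<partial>M) \<le> (\<integral>\<^sup>+\<omega>. ennreal (K + s * h \<omega>) \<partial>M)"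
      unfolding lim_eq[OF s] by (rule limsup_average_le) measurable
    also have "\<dots> = ennreal (\<integral>\<omega>. K + s * h \<omega> \<partial>M)"
      using h_int nn by (intro nn_integral_eq_integral) auto
    also have "(\<integral>\<omega>. K + s * h \<omega> \<partial>M) = K + s * (\<integral>\<omega>. h \<omega> \<partial>M)"
      using h_int by (simp add: prob_space)
    finally show ?thesis .
  qed
  have hK: "\<bar>\<integral>\<omega>. h \<omega> \<partial>M\<bar> \<le> K"
  proof -
    have "\<bar>\<integral>\<omega>. h \<omega> \<partial>M\<bar> \<le> (\<integral>\<omega>. \<bar>h \<omega>\<bar> \<partial>M)" by (rule integral_abs_bound)
    also have "\<dots> \<le> (\<integral>\<omega>. K \<partial>M)" using h_int K by (intro integral_mono) auto
    finally show ?thesis by (simp add: prob_space)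
  qed
  have UV_ge: "ennreal (2 * K) \<le> U \<omega> + V \<omega>" for \<omega>
  proof (rule ennreal_le_epsilon)
    fix e :: real assume e: "0 < e"
    have "eventually (\<lambda>n. ennreal (x n \<omega> + K) \<le> U \<omega> + ennreal (e / 2)) sequentially"
      "eventually (\<lambda>n. ennreal (K - x n \<omega>) \<le> V \<omega> + ennreal (e / 2)) sequentially"
      unfolding U_def V_def by (rule eventually_le_limsup_add, use e in simp)+
    then have "eventually (\<lambda>n. ennreal (2 * K) \<le> U \<omega> + V \<omega> + ennreal e) sequentially"
    proof eventually_elim
      case (elim n)
      have "ennreal (2 * K) = ennreal (x n \<omega> + K) + ennreal (K - x n \<omega>)"
        using xK[of n \<omega>] by (subst ennreal_plus[symmetric]) auto
      also have "\<dots> \<le> (U \<omega> + ennreal (e / 2)) + (V \<omega> + ennreal (e / 2))" using elim by (rule add_mono)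
      also have "\<dots> = (U \<omega> + V \<omega>) + (ennreal (e / 2) + ennreal (e / 2))" by (simp add: ac_simps)
      also have "ennreal (e / 2) + ennreal (e / 2) = ennreal e"
        using e by (subst ennreal_plus[symmetric]) auto
      finally show ?case .
    qed
    then show "ennreal (2 * K) \<le> U \<omega> + V \<omega> + ennreal e" by simp
  qed
  have "(\<integral>\<^sup>+\<omega>. U \<omega> + V \<omega> \<partial>M) \<le> ennreal (2 * K)"
  proof -
    have "(\<integral>\<^sup>+\<omega>. U \<omega> + V \<omega> \<partial>M) = (\<integral>\<^sup>+\<omega>. U \<omega> \<partial>M) + (\<integral>\<^sup>+\<omega>. V \<omega> \<partial>M)"
      by (rule nn_integral_add) auto
    also have "\<dots> \<le> ennreal (K + 1 * (\<integral>\<omega>. h \<omega> \<partial>M)) + ennreal (K + (- 1) * (\<integral>\<omega>. h \<omega> \<partial>M))"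
      unfolding U_def V_def using int_le[of 1] int_le[of "-1"] by (intro add_mono) (auto simp: add.commute)
    also have "\<dots> = ennreal (2 * K)" using hK by (subst ennreal_plus[symmetric]) auto
    finally show ?thesis .
  qed
  moreover have "(\<integral>\<^sup>+\<omega>. ennreal (2 * K) \<partial>M) = ennreal (2 * K)" by (simp add: emeasure_space_1)
  ultimately have "(\<integral>\<^sup>+\<omega>. (U \<omega> + V \<omega>) - ennreal (2 * K) \<partial>M) = 0"
    using UV_ge
    by (subst nn_integral_diff) (auto simp: emeasure_space_1 diff_eq_0_iff_ennreal intro: le_less_trans)
  then have "AE \<omega> in M. (U \<omega> + V \<omega>) - ennreal (2 * K) = 0"
    by (subst (asm) nn_integral_0_iff_AE) (intro borel_measurable_minus_ennreal borel_measurable_add borel_measurable_const, fact+)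
  then have UV: "AE \<omega> in M. U \<omega> + V \<omega> = ennreal (2 * K)"
  proof eventually_elim
    case (elim \<omega>)
    then have "U \<omega> + V \<omega> \<le> ennreal (2 * K)" by (simp only: diff_eq_0_iff_ennreal)
    then show ?case using UV_ge by (rule antisym)
  qed
  define f where "f \<omega> = enn2real (U \<omega>) - K" for \<omega>
  have lim: "AE \<omega> in M. (\<lambda>n. x n \<omega>) \<longlonglongrightarrow> f \<omega>"
    using UV
  proof eventually_elim
    case (elim \<omega>)
    have "U \<omega> \<le> U \<omega> + V \<omega>" "V \<omega> \<le> U \<omega> + V \<omega>" by simp_all
    note this[THEN le_less_trans, of top, unfolded elim, OF ennreal_less_top]
    then obtain u v where uv: "U \<omega> = ennreal u" "u \<ge> 0" "V \<omega> = ennreal v" "v \<ge> 0"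
      by (cases "U \<omega>"; cases "V \<omega>") auto
    have sum: "u + v = 2 * K" using elim uv K0 by (simp add: ennreal_plus[symmetric] del: ennreal_plus)
    have "(\<lambda>n. x n \<omega>) \<longlonglongrightarrow> u - K"
    proof (rule tendstoI)
      fix e :: real assume e: "0 < e"
      have "eventually (\<lambda>n. ennreal (x n \<omega> + K) \<le> U \<omega> + ennreal (e / 2)) sequentially"
        "eventually (\<lambda>n. ennreal (K - x n \<omega>) \<le> V \<omega> + ennreal (e / 2)) sequentially"
        unfolding U_def V_def by (rule eventually_le_limsup_add, use e in simp)+
      then show "eventually (\<lambda>n. dist (x n \<omega>) (u - K) < e) sequentially"
      proof eventually_elim
        case (elim n)
        then have "x n \<omega> + K \<le> u + e / 2" "K - x n \<omega> \<le> v + e / 2"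
          using uv e by (auto simp: ennreal_plus[symmetric] ennreal_le_iff simp del: ennreal_plus)
        then show ?case using sum e by (auto simp: dist_real_def abs_if)
      qed
    qed
    then show ?case using uv by (simp add: f_def)
  qed
  have f_meas [measurable]: "f \<in> borel_measurable M" unfolding f_def by measurable
  have "conv_L1 x f"
    unfolding conv_L1_def
  proof (intro conjI allI lim)
    show "integrable M (x n)" for n using xK by (intro integrable_const_bound[of _ K]) auto
    show fi: "integrable M f"
    proof (rule integrable_const_bound[of _ K])
      show "AE \<omega> in M. norm (f \<omega>) \<le> K"
        using lim
      proof eventually_elim
        case (elim \<omega>)
        from Lim_bounded[OF tendsto_rabs[OF elim]] xK show ?case by simp
      qed
    qed simp
    have "(\<lambda>n. \<integral>\<omega>. \<bar>x n \<omega> - f \<omega>\<bar> \<partial>M) \<longlonglongrightarrow> (\<integral>\<omega>. 0 \<partial>M)"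
    proof (rule integral_dominated_convergence[where w="\<lambda>\<omega>. K + \<bar>f \<omega>\<bar>"])
      show "AE \<omega> in M. (\<lambda>n. \<bar>x n \<omega> - f \<omega>\<bar>) \<longlonglongrightarrow> 0"
        using lim by eventually_elim (auto intro: tendsto_rabs_zero LIM_zero)
      show "AE \<omega> in M. norm \<bar>x n \<omega> - f \<omega>\<bar> \<le> K + \<bar>f \<omega>\<bar>" for n
      proof (rule AE_I2)
        fix \<omega>
        show "norm \<bar>x n \<omega> - f \<omega>\<bar> \<le> K + \<bar>f \<omega>\<bar>" using xK[of n \<omega>] by simp
      qed
    qed (use fi in auto)
    then show "(\<lambda>n. \<integral>\<omega>. \<bar>x n \<omega> - f \<omega>\<bar> \<partial>M) \<longlonglongrightarrow> 0" by simp
  qed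
  then show ?thesis unfolding x_def[abs_def] by blast
qed

text \<open>Truncation reduces to the bounded case. The averages of the truncation error
  \<open>d\<close> have a limsup whose mean is at most the integral of \<open>d\<close>; this limsup
  is the random error allowed by \<open>conv_L1_approx\<close>.\<close>

theorem birkhoff:
  fixes h :: "'a \<Rightarrow> real"
  assumes h: "integrable M h"
  shows "\<exists>f. conv_L1 (\<lambda>n \<omega>. birkhoff_sum h n \<omega> / real n) f"
proof (rule conv_L1_approx)
  have [measurable]: "h \<in> borel_measurable M" using h by blast
  show "integrable M (\<lambda>\<omega>. birkhoff_sum h n \<omega> / real n)" for n
    using integrable_birkhoff_sum[OF h] by auto
  fix \<epsilon> :: real assume \<epsilon>: "\<epsilon> > 0"
  define t where "t K \<omega> = max (- real K) (min (real K) (h \<omega>))" for K \<omega>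
  have [measurable]: "t K \<in> borel_measurable M" for K unfolding t_def by measurable
  have t_h: "\<bar>t K \<omega>\<bar> \<le> \<bar>h \<omega>\<bar>" for K \<omega> by (auto simp: t_def)
  have t_int [simp]: "integrable M (t K)" for K
    using t_h by (intro Bochner_Integration.integrable_bound[OF h]) auto
  have "(\<lambda>K. \<integral>\<omega>. \<bar>h \<omega> - t K \<omega>\<bar> \<partial>M) \<longlonglongrightarrow> (\<integral>\<omega>. 0 \<partial>M)"
  proof (rule integral_dominated_convergence[where w="\<lambda>\<omega>. 2 * \<bar>h \<omega>\<bar>"])
    show "AE \<omega> in M. (\<lambda>K. \<bar>h \<omega> - t K \<omega>\<bar>) \<longlonglongrightarrow> 0"
    proof (rule AE_I2, rule tendsto_eventually)
      fix \<omega>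
      obtain K0 :: nat where K0: "\<bar>h \<omega>\<bar> \<le> real K0" using real_arch_simple by blast
      show "\<forall>\<^sub>F K in sequentially. \<bar>h \<omega> - t K \<omega>\<bar> = 0"
        using eventually_ge_at_top[of K0]
      proof eventually_elim
        case (elim K)
        then have "\<bar>h \<omega>\<bar> \<le> real K" using K0 by linarith
        then show ?case by (auto simp: t_def)
      qed
    qed
    show "AE \<omega> in M. norm \<bar>h \<omega> - t K \<omega>\<bar> \<le> 2 * \<bar>h \<omega>\<bar>" for K
    proof (rule AE_I2)
      fix \<omega>
      show "norm \<bar>h \<omega> - t K \<omega>\<bar> \<le> 2 * \<bar>h \<omega>\<bar>" using t_h[of K \<omega>] by simp
    qed
  qed (use h in auto)
  then have "eventually (\<lambda>K. (\<integral>\<omega>. \<bar>h \<omega> - t K \<omega>\<bar> \<partial>M) < \<epsilon>) sequentially"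
    using \<epsilon> by (intro order_tendstoD(2)) auto
  then obtain K where K: "(\<integral>\<omega>. \<bar>h \<omega> - t K \<omega>\<bar> \<partial>M) < \<epsilon>" by (auto simp: eventually_sequentially)
  define d where "d \<omega> = \<bar>h \<omega> - t K \<omega>\<bar>" for \<omega>
  have d_int: "integrable M d" unfolding d_def using h by auto
  have [measurable]: "d \<in> borel_measurable M" using d_int by blast
  have d0: "0 \<le> d \<omega>" for \<omega> by (simp add: d_def)
  obtain g where g: "conv_L1 (\<lambda>n \<omega>. birkhoff_sum (t K) n \<omega> / real n) g"
    using birkhoff_bounded[of "t K" "real K"] unfolding t_def by (force simp: abs_le_iff)
  define L where "L \<omega> = limsup (\<lambda>n. (\<Sum>i<n. ennreal (d ((S ^^ i) \<omega>))) / of_nat n)" for \<omega>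
  have [measurable]: "L \<in> borel_measurable M" unfolding L_def by measurable
  have diff: "\<bar>birkhoff_sum h n \<omega> / real n - birkhoff_sum (t K) n \<omega> / real n\<bar> \<le> birkhoff_sum d n \<omega> / real n" for n \<omega>
  proof -
    have "\<bar>birkhoff_sum h n \<omega> / real n - birkhoff_sum (t K) n \<omega> / real n\<bar> =
        \<bar>\<Sum>i<n. h ((S ^^ i) \<omega>) - t K ((S ^^ i) \<omega>)\<bar> / real n"
      by (simp add: sum_subtractf diff_divide_distrib[symmetric])
    also have "\<dots> \<le> birkhoff_sum d n \<omega> / real n"
      unfolding d_def by (intro divide_right_mono sum_abs) auto
    finally show ?thesis .
  qed
  show "\<exists>y g L. conv_L1 y g \<and> L \<in> borel_measurable M \<and> (\<integral>\<^sup>+\<omega>. L \<omega> \<partial>M) \<le> ennreal \<epsilon> \<and>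
      (AE \<omega> in M. \<forall>e>0. \<forall>\<^sub>F n in sequentially. ennreal \<bar>birkhoff_sum h n \<omega> / real n - y n \<omega>\<bar> \<le> L \<omega> + ennreal e) \<and>
      (\<forall>\<^sub>F n in sequentially. (\<integral>\<omega>. \<bar>birkhoff_sum h n \<omega> / real n - y n \<omega>\<bar> \<partial>M) \<le> \<epsilon>)"
  proof (intro exI conjI)
    show "conv_L1 (\<lambda>n \<omega>. birkhoff_sum (t K) n \<omega> / real n) g" by (rule g)
    show "L \<in> borel_measurable M" by measurable
    have "(\<integral>\<^sup>+\<omega>. L \<omega> \<partial>M) \<le> (\<integral>\<^sup>+\<omega>. ennreal (d \<omega>) \<partial>M)"
      unfolding L_def by (rule limsup_average_le) measurable
    also have "\<dots> = ennreal (\<integral>\<omega>. d \<omega> \<partial>M)" using d_int d0 by (intro nn_integral_eq_integral) auto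
    also have "\<dots> \<le> ennreal \<epsilon>" using K by (auto simp: d_def intro!: ennreal_leI)
    finally show "(\<integral>\<^sup>+\<omega>. L \<omega> \<partial>M) \<le> ennreal \<epsilon>" .
    show "AE \<omega> in M. \<forall>e>0. \<forall>\<^sub>F n in sequentially.
        ennreal \<bar>birkhoff_sum h n \<omega> / real n - birkhoff_sum (t K) n \<omega> / real n\<bar> \<le> L \<omega> + ennreal e"
    proof (intro AE_I2 allI impI)
      fix \<omega> and e :: real assume "0 < e"
      from eventually_le_limsup_add[OF this, of "\<lambda>n. (\<Sum>i<n. ennreal (d ((S ^^ i) \<omega>))) / of_nat n"]
        eventually_gt_at_top[of 0]
      show "\<forall>\<^sub>F n in sequentially.
        ennreal \<bar>birkhoff_sum h n \<omega> / real n - birkhoff_sum (t K) n \<omega> / real n\<bar> \<le> L \<omega> + ennreal e"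
      proof eventually_elim
        case (elim n)
        have "ennreal \<bar>birkhoff_sum h n \<omega> / real n - birkhoff_sum (t K) n \<omega> / real n\<bar> \<le>
            ennreal (birkhoff_sum d n \<omega> / real n)" by (rule ennreal_leI[OF diff])
        also have "\<dots> = (\<Sum>i<n. ennreal (d ((S ^^ i) \<omega>))) / of_nat n"
          using elim d0 by (simp add: ennreal_of_nat_eq_real_of_nat divide_ennreal sum_nonneg)
        also have "\<dots> \<le> L \<omega> + ennreal e" using elim unfolding L_def by simp
        finally show ?case .
      qed
    qed
    show "\<forall>\<^sub>F n in sequentially. (\<integral>\<omega>. \<bar>birkhoff_sum h n \<omega> / real n - birkhoff_sum (t K) n \<omega> / real n\<bar> \<partial>M) \<le> \<epsilon>"
      using eventually_gt_at_top[of 0]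
    proof eventually_elim
      case (elim n)
      have "(\<integral>\<omega>. \<bar>birkhoff_sum h n \<omega> / real n - birkhoff_sum (t K) n \<omega> / real n\<bar> \<partial>M) \<le>
          (\<integral>\<omega>. birkhoff_sum d n \<omega> / real n \<partial>M)"
        using integrable_birkhoff_sum[OF h] integrable_birkhoff_sum[OF t_int] integrable_birkhoff_sum[OF d_int]
        by (intro integral_mono diff) auto
      also have "\<dots> = (\<integral>\<omega>. d \<omega> \<partial>M)" using elim integral_birkhoff_sum[OF d_int, of n] by simp
      finally show ?case using K by (simp add: d_def)
    qed
  qed
qed


text \<open>Choose a block length \<open>m\<close> whose mean per step is within \<epsilon>/2 of the
  supremum \<gamma>. The sum \<open>A\<close> of \<open>c m\<close> over consecutive blocks is
  additive and converges by Birkhoff's theorem for \<open>S ^^ m\<close>. The remainder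
  \<open>b\<close> is nonnegative and superadditive over \<open>S ^^ m\<close> with mean at most
  \<open>m * \<epsilon> / 2\<close> per block, so the limsup inequality makes it small.\<close>

lemma nonneg_superadditive_conv_L1:
  fixes c :: "nat \<Rightarrow> 'a \<Rightarrow> real"
  assumes int: "\<And>n. integrable M (c n)"
    and zero: "\<And>\<omega>. \<omega> \<in> space M \<Longrightarrow> c 0 \<omega> = 0"
    and nonneg: "\<And>n \<omega>. \<omega> \<in> space M \<Longrightarrow> 0 \<le> c n \<omega>"
    and super: "\<And>m n \<omega>. \<omega> \<in> space M \<Longrightarrow> c m \<omega> + c n ((S ^^ m) \<omega>) \<le> c (m + n) \<omega>"
    and mean: "\<And>n. (\<integral>\<omega>. c n \<omega> \<partial>M) \<le> real n * C"
  shows "\<exists>f. conv_L1 (\<lambda>n \<omega>. c n \<omega> / real n) f"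
proof (rule conv_L1_approx)
  note [simp] = int
  have [measurable]: "c n \<in> borel_measurable M" for n using int by blast
  show "integrable M (\<lambda>\<omega>. c n \<omega> / real n)" for n by simp
  have c_mono: "c m \<omega> \<le> c n \<omega>" if "\<omega> \<in> space M" "m \<le> n" for m n \<omega>
    using super[OF that(1), of m "n - m"] nonneg[OF funpow_in_space[OF that(1)], of "n - m" m] that(2) by simp
  define \<gamma> where "\<gamma> = (SUP n\<in>{1..}. (\<integral>\<omega>. c n \<omega> \<partial>M) / real n)"
  have bdd: "bdd_above ((\<lambda>n. (\<integral>\<omega>. c n \<omega> \<partial>M) / real n) ` {1..})"
    using mean by (intro bdd_aboveI2[of _ _ C]) (auto simp: divide_le_eq mult.commute)
  have mean\<gamma>: "(\<integral>\<omega>. c n \<omega> \<partial>M) \<le> real n * \<gamma>" for n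
  proof (cases "n = 0")
    case True
    have "(\<integral>\<omega>. c 0 \<omega> \<partial>M) = (\<integral>\<omega>. 0 \<partial>M)" using zero by (intro Bochner_Integration.integral_cong) auto
    then show ?thesis using True by simp
  next
    case False
    have "(\<integral>\<omega>. c n \<omega> \<partial>M) / real n \<le> \<gamma>"
      unfolding \<gamma>_def using bdd False by (intro cSUP_upper) auto
    then show ?thesis using False by (simp add: divide_le_eq mult.commute)
  qed
  fix \<epsilon> :: real assume \<epsilon>: "\<epsilon> > 0"
  have "\<gamma> - \<epsilon> / 2 < \<gamma>" using \<epsilon> by simp
  then have "\<exists>m\<in>{1..}. \<gamma> - \<epsilon> / 2 < (\<integral>\<omega>. c m \<omega> \<partial>M) / real m"
    using less_cSUP_iff[OF _ bdd, of "\<gamma> - \<epsilon> / 2"] unfolding \<gamma>_def[symmetric] by simp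
  then obtain m where m: "m \<ge> 1" "\<gamma> - \<epsilon> / 2 < (\<integral>\<omega>. c m \<omega> \<partial>M) / real m" by auto
  define g where "g = (\<integral>\<omega>. c m \<omega> \<partial>M)"
  have g: "real m * (\<gamma> - \<epsilon> / 2) < g" using m by (simp add: g_def field_simps)
  have g0: "0 \<le> g" unfolding g_def using nonneg by (intro integral_nonneg_AE AE_I2) auto
  interpret Sm: mpt M "S ^^ m" by (rule mpt_funpow)
  define A where "A q \<omega> = (\<Sum>i<q. c m (((S ^^ m) ^^ i) \<omega>))" for q \<omega>
  have A_int [simp]: "integrable M (A q)" for q
    unfolding A_def by (rule Sm.integrable_birkhoff_sum) simp
  have A_mean: "(\<integral>\<omega>. A q \<omega> \<partial>M) = real q * g" for q
    unfolding A_def g_def by (rule Sm.integral_birkhoff_sum) simp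
  have [measurable]: "A q \<in> borel_measurable M" for q using A_int by blast
  have A_Suc: "A (Suc q) \<omega> = A q \<omega> + c m ((S ^^ (m * q)) \<omega>)" for q \<omega>
    by (simp add: A_def funpow_mult mult.commute)
  have A_le: "A q \<omega> \<le> c (m * q) \<omega>" if "\<omega> \<in> space M" for q \<omega>
  proof (induction q)
    case (Suc q)
    then show ?case using super[OF that, of "m * q" m] unfolding A_Suc by (simp add: add.commute)
  qed (simp add: A_def zero that)
  have A_add: "A (p + q) \<omega> = A p \<omega> + A q (((S ^^ m) ^^ p) \<omega>)" for p q \<omega>
    unfolding A_def by (rule Sm.sum_orbit_split)
  define b where "b q \<omega> = c (m * q) \<omega> - A q \<omega>" for q \<omega>
  have b_int [simp]: "integrable M (b q)" for q unfolding b_def by auto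
  have [measurable]: "b q \<in> borel_measurable M" for q using b_int by blast
  have b0: "0 \<le> b q \<omega>" if "\<omega> \<in> space M" for q \<omega> using A_le[OF that] by (simp add: b_def)
  define L0 where "L0 \<omega> = limsup (\<lambda>q. ennreal (b q \<omega>) / of_nat q)" for \<omega>
  have [measurable]: "L0 \<in> borel_measurable M" unfolding L0_def by measurable
  have L0: "(\<integral>\<^sup>+\<omega>. L0 \<omega> \<partial>M) \<le> ennreal (real m * \<epsilon> / 2)"
    unfolding L0_def
  proof (rule Sm.superadditive_limsup_le)
    fix p q \<omega> assume sp: "\<omega> \<in> space M"
    have "b p \<omega> + b q (((S ^^ m) ^^ p) \<omega>) \<le> b (p + q) \<omega>"
      using super[OF sp, of "m * p" "m * q"] unfolding b_def A_add
      by (simp add: funpow_mult distrib_left mult.commute)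
    then show "ennreal (b p \<omega>) + ennreal (b q (((S ^^ m) ^^ p) \<omega>)) \<le> ennreal (b (p + q) \<omega>)"
      using b0[OF sp, of p] b0[OF Sm.funpow_in_space[OF sp], of q p]
      by (simp add: ennreal_plus[symmetric] ennreal_leI del: ennreal_plus)
  next
    fix q
    have "(\<integral>\<^sup>+\<omega>. ennreal (b q \<omega>) \<partial>M) = ennreal (\<integral>\<omega>. b q \<omega> \<partial>M)"
      using b0 by (intro nn_integral_eq_integral) auto
    also have "(\<integral>\<omega>. b q \<omega> \<partial>M) = (\<integral>\<omega>. c (m * q) \<omega> \<partial>M) - real q * g"
      unfolding b_def by (simp add: A_mean)
    also have "\<dots> \<le> real q * (real m * \<epsilon> / 2)"
    proof -
      have "real q * (real m * (\<gamma> - \<epsilon> / 2)) \<le> real q * g" using g by (intro mult_left_mono) auto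
      then show ?thesis using mean\<gamma>[of "m * q"] by (simp add: algebra_simps)
    qed
    finally show "(\<integral>\<^sup>+\<omega>. ennreal (b q \<omega>) \<partial>M) \<le> of_nat q * ennreal (real m * \<epsilon> / 2)"
      using \<epsilon> by (simp add: ennreal_of_nat_eq_real_of_nat ennreal_mult[symmetric] ennreal_leI)
  qed simp
  obtain f where f: "conv_L1 (\<lambda>q \<omega>. A q \<omega> / real q) f"
    using Sm.birkhoff[of "c m"] unfolding A_def by auto
  have div_lim: "(\<lambda>n. real (n div m) / real n) \<longlonglongrightarrow> 1 / real m"
  proof (rule tendsto_sandwich)
    show "\<forall>\<^sub>F n in sequentially. (real n / real m - 1) / real n \<le> real (n div m) / real n"
    proof (rule always_eventually, rule allI, rule divide_right_mono)
      fix n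
      have "real n < (real (n div m) + 1) * real m"
        using div_mult_mod_eq[of n m] mod_less_divisor[of m n] m(1)
        by (metis add.commute less_eq_Suc_le of_nat_Suc of_nat_less_iff of_nat_mult dividend_less_div_times mult.commute mult_Suc_right One_nat_def)
      then show "real n / real m - 1 \<le> real (n div m)" using m(1) by (simp add: field_simps)
    qed simp
    show "\<forall>\<^sub>F n in sequentially. real (n div m) / real n \<le> 1 / real m"
      using eventually_gt_at_top[of 0]
    proof eventually_elim
      case (elim n)
      have "real (n div m) * real m \<le> real n" by (metis div_times_less_eq_dividend of_nat_le_iff of_nat_mult)
      then show ?case using elim m(1) by (simp add: field_simps)
    qed
    have "(\<lambda>n. 1 / real m - 1 / real n) \<longlonglongrightarrow> 1 / real m - 0"
      by (intro tendsto_intros lim_1_over_n)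
    moreover have "\<forall>\<^sub>F n in sequentially. 1 / real m - 1 / real n = (real n / real m - 1) / real n"
      using eventually_gt_at_top[of 0] by eventually_elim (use m in \<open>auto simp: field_simps\<close>)
    ultimately show "(\<lambda>n. (real n / real m - 1) / real n) \<longlonglongrightarrow> 1 / real m"
      by (auto intro: Lim_transform_eventually)
  qed simp
  have div_top: "filterlim (\<lambda>n. n div m) sequentially sequentially"
    unfolding filterlim_at_top
  proof
    fix Z
    show "\<forall>\<^sub>F n in sequentially. Z \<le> n div m"
      using eventually_ge_at_top[of "Z * m"]
      by eventually_elim (use m in \<open>auto simp: less_eq_div_iff_mult_less_eq\<close>)
  qed
  define y where "y n \<omega> = A (n div m) \<omega> / real n" for n \<omega>
  have "conv_L1 (\<lambda>n \<omega>. (real (n div m) / real n) * (A (n div m) \<omega> / real (n div m))) (\<lambda>\<omega>. 1 / real m * f \<omega>)"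
    by (rule conv_L1_scale[OF conv_L1_subseq[OF f div_top] div_lim])
  then have y: "conv_L1 y (\<lambda>\<omega>. 1 / real m * f \<omega>)"
    by (rule conv_L1_cong) (auto simp: y_def A_def)
  \<comment> \<open>If \<open>q = n div m\<close>, then \<open>c n\<close> is at most
    \<open>c (m * Suc q)\<close>, which splits into \<open>b (Suc q)\<close>, \<open>A q\<close> and
    the value of \<open>c m\<close> on the last block; that value has to be o(q).\<close>
  have cm0: "AE \<omega> in M. (\<lambda>q. c m ((S ^^ (m * q)) \<omega>) / real q) \<longlonglongrightarrow> 0"
  proof (rule AE_tail_dominated_div_tendsto_0[where Z="c m"])
    show "prob {\<omega> \<in> space M. t < \<bar>c m ((S ^^ (m * n)) \<omega>)\<bar>} \<le> prob {\<omega> \<in> space M. t < \<bar>c m \<omega>\<bar>}" for n t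
    proof -
      have "prob {\<omega> \<in> space M. t < \<bar>c m \<omega>\<bar>} = measure (distr M M (S ^^ (m * n))) {\<omega> \<in> space M. t < \<bar>c m \<omega>\<bar>}"
        by (simp add: distr_funpow)
      also have "\<dots> = prob ((S ^^ (m * n)) -` {\<omega> \<in> space M. t < \<bar>c m \<omega>\<bar>} \<inter> space M)"
        by (rule measure_distr) auto
      also have "(S ^^ (m * n)) -` {\<omega> \<in> space M. t < \<bar>c m \<omega>\<bar>} \<inter> space M =
          {\<omega> \<in> space M. t < \<bar>c m ((S ^^ (m * n)) \<omega>)\<bar>}"
        using funpow_in_space by auto
      finally show ?thesis by simp
    qed
  qed auto
  \<comment> \<open>The factor \<open>2 / m\<close> bounds \<open>Suc q / n\<close> for
    \<open>q = n div m \<ge> 1\<close>; it turns the bound \<open>m * \<epsilon> / 2\<close> on the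
    mean of \<open>L0\<close> into \<epsilon>.\<close>
  define L where "L \<omega> = ennreal (2 / real m) * L0 \<omega>" for \<omega>
  have y_le: "y n \<omega> \<le> c n \<omega> / real n" if "\<omega> \<in> space M" for n \<omega>
    unfolding y_def
    by (intro divide_right_mono order_trans[OF A_le c_mono] that) auto
  show "\<exists>y g L. conv_L1 y g \<and> L \<in> borel_measurable M \<and> (\<integral>\<^sup>+\<omega>. L \<omega> \<partial>M) \<le> ennreal \<epsilon> \<and>
      (AE \<omega> in M. \<forall>e>0. \<forall>\<^sub>F n in sequentially. ennreal \<bar>c n \<omega> / real n - y n \<omega>\<bar> \<le> L \<omega> + ennreal e) \<and>
      (\<forall>\<^sub>F n in sequentially. (\<integral>\<omega>. \<bar>c n \<omega> / real n - y n \<omega>\<bar> \<partial>M) \<le> \<epsilon>)"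
  proof (intro exI conjI)
    show "conv_L1 y (\<lambda>\<omega>. 1 / real m * f \<omega>)" by (rule y)
    show "L \<in> borel_measurable M" unfolding L_def by measurable
    have "(\<integral>\<^sup>+\<omega>. L \<omega> \<partial>M) = ennreal (2 / real m) * (\<integral>\<^sup>+\<omega>. L0 \<omega> \<partial>M)"
      unfolding L_def by (rule nn_integral_cmult) measurable
    also have "\<dots> \<le> ennreal (2 / real m) * ennreal (real m * \<epsilon> / 2)" by (intro mult_left_mono L0) simp
    also have "\<dots> = ennreal \<epsilon>" using m \<epsilon> by (simp add: ennreal_mult[symmetric])
    finally show "(\<integral>\<^sup>+\<omega>. L \<omega> \<partial>M) \<le> ennreal \<epsilon>" .
    have "AE \<omega> in M. \<omega> \<in> space M" by simp
    with cm0 show "AE \<omega> in M. \<forall>e>0. \<forall>\<^sub>F n in sequentially. ennreal \<bar>c n \<omega> / real n - y n \<omega>\<bar> \<le> L \<omega> + ennreal e"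
    proof eventually_elim
      case sp: (elim \<omega>)
      show ?case
      proof (intro allI impI)
        fix e :: real assume e: "0 < e"
        \<comment> \<open>The tolerance \<open>m * e / 4\<close> becomes \<open>e / 2\<close> under
          the factor \<open>2 / m\<close>; the last block supplies the other
          \<open>e / 2\<close>.\<close>
        have "\<forall>\<^sub>F q in sequentially. ennreal (b q \<omega>) / of_nat q \<le> L0 \<omega> + ennreal (m * e / 4)"
          unfolding L0_def by (rule eventually_le_limsup_add) (use e m in simp)
        then have "\<forall>\<^sub>F q in sequentially. ennreal (b (Suc q) \<omega>) / of_nat (Suc q) \<le> L0 \<omega> + ennreal (m * e / 4)"
          by (rule eventually_compose_filterlim) (rule filterlim_Suc)
        moreover have "\<forall>\<^sub>F q in sequentially. c m ((S ^^ (m * q)) \<omega>) / real q < e / 2"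
          using sp(1) e by (intro order_tendstoD(2)) auto
        ultimately have "\<forall>\<^sub>F q in sequentially. q \<ge> 1 \<and> c m ((S ^^ (m * q)) \<omega>) / real q < e / 2 \<and>
            ennreal (b (Suc q) \<omega>) / of_nat (Suc q) \<le> L0 \<omega> + ennreal (m * e / 4)"
          using eventually_ge_at_top[of 1] by eventually_elim simp
        from eventually_compose_filterlim[OF this div_top]
        show "\<forall>\<^sub>F n in sequentially. ennreal \<bar>c n \<omega> / real n - y n \<omega>\<bar> \<le> L \<omega> + ennreal e"
        proof eventually_elim
          case (elim n)
          define q where "q = n div m"
          define cq where "cq = c m ((S ^^ (m * q)) \<omega>)"
          have q: "q \<ge> 1" "cq < e / 2 * real q" "ennreal (b (Suc q) \<omega> / real (Suc q)) \<le> L0 \<omega> + ennreal (m * e / 4)"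
            using elim b0[OF sp(2), of "Suc q"]
            by (auto simp: q_def[symmetric] cq_def field_simps ennreal_of_nat_eq_real_of_nat divide_ennreal simp del: of_nat_Suc)
          have mq: "m * q \<le> n" "n < m * Suc q"
            unfolding q_def using m by (auto simp: dividend_less_times_div)
          have n0: "0 < real n" using mq q m by (metis One_nat_def le_0_eq mult_is_0 neq0_conv not_one_le_zero of_nat_0_less_iff)
          have "real m * real q \<le> real n" using mq by (metis of_nat_le_iff of_nat_mult)
          then have qn: "real q / real n \<le> 1" and qn2: "real (Suc q) / real n \<le> 2 / real m"
          proof -
            assume *: "real m * real q \<le> real n"
            have "real q \<le> real m * real q" using m by (simp add: mult_le_cancel_right1)
            then show "real q / real n \<le> 1" using * n0 by (simp add: field_simps)
            have "real m * 1 \<le> real m * real q" using q by (intro mult_left_mono) auto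
            then have "real (Suc q) * real m \<le> 2 * real n" using * by (simp add: algebra_simps)
            then show "real (Suc q) / real n \<le> 2 / real m" using n0 m by (simp add: field_simps)
          qed
          have cq0: "0 \<le> cq" unfolding cq_def by (rule nonneg[OF funpow_in_space[OF sp(2)]])
          have "c n \<omega> \<le> c (m * Suc q) \<omega>" using mq by (intro c_mono sp) auto
          also have "\<dots> = b (Suc q) \<omega> + A q \<omega> + cq" by (simp add: b_def A_Suc cq_def)
          finally have "c n \<omega> / real n \<le> (b (Suc q) \<omega> + A q \<omega> + cq) / real n"
            by (rule divide_right_mono) simp
          then have "c n \<omega> / real n - y n \<omega> \<le> (b (Suc q) \<omega> + cq) / real n"
            by (simp add: y_def q_def[symmetric] add_divide_distrib)
          also have "\<dots> = (real (Suc q) / real n) * (b (Suc q) \<omega> / real (Suc q)) + (real q / real n) * (cq / real q)"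
            using q n0 by (simp add: field_simps del: of_nat_Suc)
          also have "\<dots> \<le> (2 / real m) * (b (Suc q) \<omega> / real (Suc q)) + 1 * (e / 2)"
            using qn qn2 q cq0 b0[OF sp(2), of "Suc q"] m e
            by (intro add_mono mult_mono) (auto simp: field_simps simp del: of_nat_Suc)
          finally have "ennreal \<bar>c n \<omega> / real n - y n \<omega>\<bar> \<le>
              ennreal ((2 / real m) * (b (Suc q) \<omega> / real (Suc q)) + e / 2)"
            using y_le[OF sp(2), of n] by (intro ennreal_leI) simp
          also have "\<dots> = ennreal (2 / real m) * ennreal (b (Suc q) \<omega> / real (Suc q)) + ennreal (e / 2)"
            using b0[OF sp(2), of "Suc q"] e by (simp add: ennreal_mult[symmetric] ennreal_plus[symmetric] del: ennreal_plus of_nat_Suc)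
          also have "\<dots> \<le> ennreal (2 / real m) * (L0 \<omega> + ennreal (m * e / 4)) + ennreal (e / 2)"
            using q by (intro add_mono mult_left_mono) auto
          also have "\<dots> = L \<omega> + (ennreal (2 / real m) * ennreal (m * e / 4) + ennreal (e / 2))"
            by (simp add: L_def distrib_left add.assoc)
          also have "ennreal (2 / real m) * ennreal (m * e / 4) + ennreal (e / 2) = ennreal e"
            using e m by (simp add: ennreal_mult[symmetric] ennreal_plus[symmetric] del: ennreal_plus)
          finally show ?case .
        qed
      qed
    qed
    have "(\<lambda>n. \<gamma> - (real (n div m) / real n) * g) \<longlonglongrightarrow> \<gamma> - 1 / real m * g"
      by (intro tendsto_intros div_lim)
    moreover have "\<gamma> - 1 / real m * g < \<epsilon>"
    proof -
      have "\<gamma> - 1 / real m * g < \<epsilon> / 2" using g m by (simp add: field_simps)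
      then show ?thesis using \<epsilon> by linarith
    qed
    ultimately have "\<forall>\<^sub>F n in sequentially. \<gamma> - (real (n div m) / real n) * g < \<epsilon>"
      by (rule order_tendstoD(2))
    then show "\<forall>\<^sub>F n in sequentially. (\<integral>\<omega>. \<bar>c n \<omega> / real n - y n \<omega>\<bar> \<partial>M) \<le> \<epsilon>"
      using eventually_gt_at_top[of 0]
    proof eventually_elim
      case (elim n)
      have "(\<integral>\<omega>. \<bar>c n \<omega> / real n - y n \<omega>\<bar> \<partial>M) = (\<integral>\<omega>. c n \<omega> / real n - y n \<omega> \<partial>M)"
        using y_le by (intro Bochner_Integration.integral_cong) auto
      also have "\<dots> = (\<integral>\<omega>. c n \<omega> \<partial>M) / real n - (real (n div m) / real n) * g"
        unfolding y_def by (simp add: A_mean)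
      also have "\<dots> \<le> \<gamma> - (real (n div m) / real n) * g"
        using mean\<gamma>[of n] elim by (simp add: divide_le_eq mult.commute)
      finally show ?case using elim by linarith
    qed
  qed
qed

text \<open>Subtracting the Birkhoff sums of \<open>a 1\<close> leaves a process that is still
  superadditive and, by superadditivity of \<open>a\<close>, nonnegative. The subtracted part
  converges by Birkhoff's theorem.\<close>

theorem kingman:
  fixes a :: "nat \<Rightarrow> 'a \<Rightarrow> real"
  assumes int: "\<And>n. integrable M (a n)"
    and zero: "\<And>\<omega>. \<omega> \<in> space M \<Longrightarrow> a 0 \<omega> = 0"
    and super: "\<And>m n \<omega>. \<omega> \<in> space M \<Longrightarrow> a m \<omega> + a n ((S ^^ m) \<omega>) \<le> a (m + n) \<omega>"
    and mean: "\<And>n. (\<integral>\<omega>. a n \<omega> \<partial>M) \<le> real n * C"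
  shows "\<exists>f. conv_L1 (\<lambda>n \<omega>. a n \<omega> / real n) f"
proof -
  note [simp] = int
  let ?A = "birkhoff_sum (a 1)"
  have A_int [simp]: "integrable M (?A n)" for n by (rule integrable_birkhoff_sum) simp
  obtain f where f: "conv_L1 (\<lambda>n \<omega>. ?A n \<omega> / real n) f" using birkhoff[OF int[of 1]] by blast
  have "\<exists>g. conv_L1 (\<lambda>n \<omega>. (a n \<omega> - ?A n \<omega>) / real n) g"
  proof (rule nonneg_superadditive_conv_L1[where C="C - (\<integral>\<omega>. a 1 \<omega> \<partial>M)"])
    fix n \<omega> assume sp: "\<omega> \<in> space M"
    show "0 \<le> a n \<omega> - ?A n \<omega>"
    proof (induction n)
      case (Suc n)
      then show ?case using super[OF sp, of n 1] by simp
    qed (simp add: zero sp)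
  next
    fix m n \<omega> assume sp: "\<omega> \<in> space M"
    show "a m \<omega> - ?A m \<omega> + (a n ((S ^^ m) \<omega>) - ?A n ((S ^^ m) \<omega>)) \<le> a (m + n) \<omega> - ?A (m + n) \<omega>"
      using super[OF sp, of m n] unfolding sum_orbit_split by linarith
  next
    show "(\<integral>\<omega>. a n \<omega> - ?A n \<omega> \<partial>M) \<le> real n * (C - (\<integral>\<omega>. a 1 \<omega> \<partial>M))" for n
      using mean[of n] by (simp add: integral_birkhoff_sum right_diff_distrib)
    show "integrable M (\<lambda>\<omega>. a n \<omega> - ?A n \<omega>)" for n by (intro Bochner_Integration.integrable_diff int A_int)
  qed (simp add: zero)
  then obtain g where g: "conv_L1 (\<lambda>n \<omega>. (a n \<omega> - ?A n \<omega>) / real n) g" by blast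
  have "conv_L1 (\<lambda>n \<omega>. a n \<omega> / real n) (\<lambda>\<omega>. f \<omega> + g \<omega>)"
    by (rule conv_L1_cong[OF conv_L1_add[OF f g]]) (simp add: diff_divide_distrib)
  then show ?thesis by blast
qed

end

section \<open>Deterministic bounds for last-passage times\<close>

text \<open>Putting the removed endpoint back makes membership a condition on one list and treats
  the empty path at \<open>u = v\<close> uniformly.\<close>

lemma mem_paths_iff: "p \<in> paths u v \<longleftrightarrow> successively lattice_step (p @ [v]) \<and> hd (p @ [v]) = u"
proof
  assume "p \<in> paths u v"
  then obtain q where q: "p = butlast q" "q \<noteq> []" "hd q = u" "last q = v" "successively lattice_step q"
    unfolding paths_def by auto
  then have "p @ [v] = q" by auto
  with q show "successively lattice_step (p @ [v]) \<and> hd (p @ [v]) = u" by simp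
next
  assume "successively lattice_step (p @ [v]) \<and> hd (p @ [v]) = u"
  then show "p \<in> paths u v"
    unfolding paths_def by (intro image_eqI[of _ _ "p @ [v]"]) auto
qed

lemma append_mem_paths:
  assumes "p \<in> paths u v" "q \<in> paths v w"
  shows "p @ q \<in> paths u w"
proof -
  have "successively lattice_step p" "p = [] \<or> lattice_step (last p) v"
    "successively lattice_step (q @ [w])" "hd (q @ [w]) = v"
    using assms by (auto simp: mem_paths_iff successively_append_iff)
  then have "successively lattice_step (p @ (q @ [w]))" by (subst successively_append_iff) auto
  then show ?thesis using assms unfolding mem_paths_iff by (cases p) auto
qed

text \<open>One transitive relation serves twice: strict growth of the coordinate sum makes the
  sites distinct, weak growth of the coordinates keeps the path above and to the right of its
  start.\<close>

lemma successively_lattice_step_sorted: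
  assumes "successively lattice_step p"
  shows "sorted_wrt (\<lambda>a b. fst a + snd a < fst b + snd b \<and> fst a \<le> fst b \<and> snd a \<le> snd b) p"
proof -
  have "successively (\<lambda>a b. fst a + snd a < fst b + snd b \<and> fst a \<le> fst b \<and> snd a \<le> snd b) p"
    using assms by (rule successively_mono) (auto simp: lattice_step_def)
  then show ?thesis
    by (subst (asm) successively_conv_sorted_wrt) (auto simp: transp_def)
qed

lemma distinct_lattice_path:
  assumes "successively lattice_step p"
  shows "distinct p"
proof -
  have "distinct q" if "sorted_wrt (\<lambda>a b. fst a + snd a < fst b + snd b \<and> fst a \<le> fst b \<and> snd a \<le> snd b) q"
    for q :: "(nat \<times> nat) list"
    using that by (induction q) auto
  then show ?thesis using successively_lattice_step_sorted[OF assms] by blast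
qed

lemma lattice_path_ge_hd:
  assumes "successively lattice_step p" "z \<in> set p"
  shows "fst (hd p) \<le> fst z \<and> snd (hd p) \<le> snd z"
  using successively_lattice_step_sorted[OF assms(1)] assms(2) by (cases p) auto

lemma paths_translate: "paths (u + s) (v + s) = (\<lambda>p. map (\<lambda>z. z + s) p) ` paths u v"
proof (intro equalityI subsetI)
  have step: "lattice_step (a + s) (b + s) \<longleftrightarrow> lattice_step a b" for a b
    by (auto simp: lattice_step_def prod_eq_iff)
  have fwd: "map (\<lambda>z. z + s) p \<in> paths (u + s) (v + s) \<longleftrightarrow> p \<in> paths u v" for p
  proof -
    have "map (\<lambda>z. z + s) p @ [v + s] = map (\<lambda>z. z + s) (p @ [v])" by simp
    then show ?thesis unfolding mem_paths_iff by (cases p) (simp_all only: successively_map step, simp_all)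
  qed
  fix p assume p: "p \<in> paths (u + s) (v + s)"
  \<comment> \<open>Subtraction on \<open>nat\<close> truncates; translating back is exact because
    every site of the path dominates \<open>u + s\<close> coordinatewise.\<close>
  then have ge: "z - s + s = z" if "z \<in> set p" for z
    using lattice_path_ge_hd[of "p @ [v + s]" z] that unfolding mem_paths_iff by (auto simp: prod_eq_iff)
  have "p = map (\<lambda>z. z + s) (map (\<lambda>z. z - s) p)"
    using ge by (simp add: map_idI)
  then show "p \<in> (\<lambda>p. map (\<lambda>z. z + s) p) ` paths u v" using fwd p by (metis image_eqI)
next
  fix p assume "p \<in> (\<lambda>p. map (\<lambda>z. z + s) p) ` paths u v"
  then obtain q where q: "q \<in> paths u v" "p = map (\<lambda>z. z + s) q" by blast
  have step: "lattice_step (a + s) (b + s) \<longleftrightarrow> lattice_step a b" for a b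
    by (auto simp: lattice_step_def prod_eq_iff)
  have "p @ [v + s] = map (\<lambda>z. z + s) (q @ [v])" using q by simp
  with q show "p \<in> paths (u + s) (v + s)"
    unfolding mem_paths_iff by (simp only: successively_map step) (auto simp: hd_append hd_map)
qed

lemma last_passage_translate:
  "last_passage (\<lambda>z. X (z + s)) u v = last_passage X (u + s) (v + s)"
  unfolding last_passage_def paths_translate by (simp add: image_image comp_def)

lemma paths_nonempty: "paths u (u + d) \<noteq> {}"
  using paths_translate[of "(0, 0)" u d] paths_origin_nonempty[of "fst d" "snd d"]
  by (simp add: zero_prod_def[symmetric] add.commute)

lemma last_passage_ge: "p \<in> paths u v \<Longrightarrow> (\<Sum>z\<leftarrow>p. X z) \<le> last_passage X u v"
  unfolding last_passage_def by (intro Max_ge) (auto simp: finite_paths)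

lemma last_passage_attained:
  obtains p where "p \<in> paths u (u + d)" "last_passage X u (u + d) = (\<Sum>z\<leftarrow>p. X z)"
proof -
  have "last_passage X u (u + d) \<in> (\<lambda>p. \<Sum>z\<leftarrow>p. X z) ` paths u (u + d)"
    unfolding last_passage_def by (intro Max_in) (auto simp: finite_paths paths_nonempty)
  then show ?thesis using that by auto
qed

lemma last_passage_superadditive:
  "last_passage X u (u + d) + last_passage X (u + d) (u + d + e) \<le> last_passage X u (u + d + e)"
proof -
  obtain p where p: "p \<in> paths u (u + d)" "last_passage X u (u + d) = (\<Sum>z\<leftarrow>p. X z)"
    by (rule last_passage_attained)
  obtain q where q: "q \<in> paths (u + d) (u + d + e)" "last_passage X (u + d) (u + d + e) = (\<Sum>z\<leftarrow>q. X z)"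
    by (rule last_passage_attained)
  show ?thesis using last_passage_ge[OF append_mem_paths[OF p(1) q(1)], of X] p q by simp
qed

lemma paths_self: "paths u u = {[]}"
proof -
  have "p = []" if "p \<in> paths u u" for p
    using that successively_lattice_step_bound[of "p @ [u]"] unfolding mem_paths_iff by auto
  then show ?thesis by (auto simp: mem_paths_iff)
qed

lemma last_passage_self [simp]: "last_passage X u u = 0"
  by (simp add: last_passage_def paths_self)

lemma path_sites:
  assumes "p \<in> paths u v" "z \<in> set p"
  shows "fst u \<le> fst z" "fst z \<le> fst v" "snd u \<le> snd z" "snd z \<le> snd v"
  using assms successively_lattice_step_bound[of "p @ [v]"] lattice_path_ge_hd[of "p @ [v]" z]
  unfolding mem_paths_iff by auto

lemma last_passage_cong:
  assumes "\<And>z. fst u \<le> fst z \<Longrightarrow> fst z \<le> fst v \<Longrightarrow> snd u \<le> snd z \<Longrightarrow> snd z \<le> snd v \<Longrightarrow> X z = Y z"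
  shows "last_passage X u v = last_passage Y u v"
proof -
  have "(\<lambda>p. \<Sum>z\<leftarrow>p. X z) ` paths u v = (\<lambda>p. \<Sum>z\<leftarrow>p. Y z) ` paths u v"
    using path_sites assms by (intro image_cong refl arg_cong[where f=sum_list] map_cong) blast+
  then show ?thesis by (simp add: last_passage_def)
qed

abbreviation box :: "nat \<times> nat \<Rightarrow> (nat \<times> nat) set" where
  "box d \<equiv> {..fst d} \<times> {..snd d}"

lemma sum_path_le_box:
  assumes "p \<in> paths 0 d"
  shows "\<bar>\<Sum>z\<leftarrow>p. X z\<bar> \<le> (\<Sum>z\<in>box d. \<bar>X z :: real\<bar>)"
proof -
  have "distinct p"
    using assms distinct_lattice_path[of "p @ [d]"] by (simp add: mem_paths_iff)
  then have "(\<Sum>z\<leftarrow>p. X z) = (\<Sum>z\<in>set p. X z)" by (simp add: sum_list_distinct_conv_sum_set)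
  also have "\<bar>\<dots>\<bar> \<le> (\<Sum>z\<in>set p. \<bar>X z\<bar>)" by (rule sum_abs)
  also have "\<dots> \<le> (\<Sum>z\<in>box d. \<bar>X z\<bar>)"
    using path_sites[OF assms] by (intro sum_mono2) auto
  finally show ?thesis .
qed

lemma abs_last_passage_le_box:
  "\<bar>last_passage X u (u + d)\<bar> \<le> (\<Sum>z\<in>box d. \<bar>X (z + u)\<bar>)"
proof -
  obtain p where p: "p \<in> paths 0 (0 + d)" "last_passage (\<lambda>z. X (z + u)) 0 (0 + d) = (\<Sum>z\<leftarrow>p. X (z + u))"
    by (rule last_passage_attained)
  have "last_passage X u (u + d) = last_passage (\<lambda>z. X (z + u)) 0 (0 + d)"
    by (simp add: last_passage_translate add.commute)
  then show ?thesis using p sum_path_le_box[of p d "\<lambda>z. X (z + u)"] by simp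
qed

lemma borel_measurable_sum_list_paths:
  fixes f :: "'b \<Rightarrow> 'a \<Rightarrow> real"
  assumes "\<And>z. f z \<in> borel_measurable M"
  shows "(\<lambda>\<omega>. \<Sum>z\<leftarrow>p. f z \<omega>) \<in> borel_measurable M"
  using assms by (induction p) auto

lemma borel_measurable_last_passage:
  assumes "\<And>z. (\<lambda>\<omega>. X \<omega> z) \<in> borel_measurable M"
  shows "(\<lambda>\<omega>. last_passage (X \<omega>) u v) \<in> borel_measurable M"
  unfolding last_passage_def
  by (intro borel_measurable_Max finite_paths borel_measurable_sum_list_paths assms)

lemma coordinate_measurable: "(\<lambda>X. X z) \<in> borel_measurable weight_space"
  unfolding weight_space_def by measurable

lemma last_passage_measurable [measurable]:
  "(\<lambda>X. last_passage X u v) \<in> borel_measurable weight_space"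
  by (rule borel_measurable_last_passage) (rule coordinate_measurable)

text \<open>This is the sum, over all chains (the empty one included) of the coordinatewise order in
  [0, k) x [0, l), of the product of \<open>Y\<close> over the chain. By inclusion-exclusion the
  bracket in the last clause sums over the chains in the enlarged rectangle that avoid its corner
  \<open>(k, l)\<close>. The corner lies above all other sites, so it may be added to any of them,
  whence the factor \<open>1 + Y (k, l)\<close>. A path with T ones contains 2^T chains of
  ones.\<close>

fun polymer :: "(nat \<times> nat \<Rightarrow> real) \<Rightarrow> nat \<Rightarrow> nat \<Rightarrow> real" where
  "polymer Y 0 l = 1"
| "polymer Y (Suc k) 0 = 1"
| "polymer Y (Suc k) (Suc l) =
    (1 + Y (k, l)) * (polymer Y k (Suc l) + polymer Y (Suc k) l - polymer Y k l)"

lemma polymer_bot [simp]: "polymer Y k 0 = 1"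
  by (cases k) auto

text \<open>The bracket is either neighbour plus a nonnegative increment, and \<open>c\<close> is at
  least 1, so monotonicity propagates from the axes. As the recursion is linear in \<open>f\<close>,
  this applies to \<open>polymer\<close> itself and also to a difference of solutions, where it is a
  comparison principle.\<close>

lemma nonneg_mono_of_recursion:
  fixes f :: "nat \<Rightarrow> nat \<Rightarrow> real"
  assumes rec: "\<And>k l. f (Suc k) (Suc l) = c k l * (f k (Suc l) + f (Suc k) l - f k l)"
    and c: "\<And>k l. 1 \<le> c k l"
    and bd: "0 \<le> f 0 0" "\<And>l. f 0 l \<le> f 0 (Suc l)" "\<And>k. f k 0 \<le> f (Suc k) 0"
  shows "0 \<le> f k l \<and> f k l \<le> f (Suc k) l \<and> f k l \<le> f k (Suc l)"
proof -
  have step: "x \<le> c k l * y" if "x \<le> y" "0 \<le> x" for x y k l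
    using mult_mono[OF c[of k l] that(1) order_trans[OF zero_le_one c] that(2)] by simp
  have row: "0 \<le> f 0 l" for l by (induction l) (use bd in \<open>auto intro: order_trans\<close>)
  show ?thesis
  proof (induction k arbitrary: l)
    case 0
    have "f 0 l \<le> f (Suc 0) l"
    proof (induction l)
      case (Suc l)
      then show ?case unfolding rec using row[of "Suc l"] by (intro step) auto
    qed (rule bd)
    then show ?case using row bd by auto
  next
    case (Suc k)
    note out = Suc.IH
    show ?case
    proof (induction l)
      case 0
      have "f (Suc k) 0 \<le> f (Suc k) (Suc 0)"
        unfolding rec using out[of 0] by (intro step) linarith+
      moreover have "0 \<le> f (Suc k) 0" using out[of 0] by linarith
      ultimately show ?case using bd by blast
    next
      case (Suc l)
      have nn: "0 \<le> f (Suc k) (Suc l)" using out[of "Suc l"] by linarith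
      have "f (Suc k) (Suc l) \<le> f (Suc (Suc k)) (Suc l)"
        unfolding rec[of "Suc k"] using Suc nn by (intro step) linarith+
      moreover have "f (Suc k) (Suc l) \<le> f (Suc k) (Suc (Suc l))"
        unfolding rec[of k "Suc l"] using out[of "Suc l"] nn by (intro step) linarith+
      ultimately show ?case using nn by simp
    qed
  qed
qed

text \<open>By monotonicity the bracket of the recursion at \<open>v\<close> dominates the value
  belonging to the predecessor of \<open>v\<close>, whichever neighbour that is. The endpoint gets
  its factor too; as \<open>polymer\<close> sees only sites strictly below its indices, these are
  one above the coordinates of \<open>v\<close>.\<close>

lemma prod_path_le_polymer:
  assumes "p \<in> paths 0 v" and Y: "\<And>z. 0 \<le> Y z"
  shows "(\<Prod>z\<leftarrow>p @ [v]. 1 + Y z) \<le> polymer Y (Suc (fst v)) (Suc (snd v))"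
  using assms(1)
proof (induction p arbitrary: v rule: rev_induct)
  case Nil
  then have "v = 0" by (simp add: mem_paths_iff)
  then show ?case by (simp add: zero_prod_def)
next
  case (snoc w p)
  have mono: "0 \<le> polymer Y k l \<and> polymer Y k l \<le> polymer Y (Suc k) l \<and> polymer Y k l \<le> polymer Y k (Suc l)" for k l
    by (rule nonneg_mono_of_recursion[where c="\<lambda>k l. 1 + Y (k, l)"]) (auto simp: Y)
  have p: "p \<in> paths 0 w" and step: "lattice_step w v"
    using snoc.prems by (auto simp: mem_paths_iff successively_append_iff hd_append split: if_splits)
  have "(\<Prod>z\<leftarrow>(p @ [w]) @ [v]. 1 + Y z) = (\<Prod>z\<leftarrow>p @ [w]. 1 + Y z) * (1 + Y v)" by simp
  also have "\<dots> \<le> polymer Y (Suc (fst w)) (Suc (snd w)) * (1 + Y v)"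
    using snoc.IH[OF p] Y by (intro mult_right_mono) auto
  also have "\<dots> \<le> (1 + Y v) * (polymer Y (fst v) (Suc (snd v)) + polymer Y (Suc (fst v)) (snd v) - polymer Y (fst v) (snd v))"
    using step mono[of "fst v" "snd v"] mono[of "fst w" "snd v"] mono[of "fst v" "snd w"] Y[of v] unfolding lattice_step_def
    by (subst mult.commute, intro mult_left_mono) auto
  also have "\<dots> = polymer Y (Suc (fst v)) (Suc (snd v))" by simp
  finally show ?case .
qed

lemma two_powr_last_passage_le_polymer:
  assumes Y: "\<And>z. Y z \<in> {0, 1}"
  shows "2 powr last_passage Y 0 v \<le> polymer Y (Suc (fst v)) (Suc (snd v))"
proof -
  obtain p where p: "p \<in> paths 0 (0 + v)" "last_passage Y 0 (0 + v) = (\<Sum>z\<leftarrow>p. Y z)"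
    by (rule last_passage_attained)
  have Y': "2 powr Y z = 1 + Y z" and Y0: "0 \<le> Y z" for z using Y[of z] by auto
  have "2 powr (\<Sum>z\<leftarrow>q. Y z) = (\<Prod>z\<leftarrow>q. 1 + Y z)" for q
    by (induction q) (simp_all add: powr_add Y')
  then have "2 powr last_passage Y 0 v = (\<Prod>z\<leftarrow>p. 1 + Y z)" using p(2) by simp
  also have "\<dots> \<le> (\<Prod>z\<leftarrow>p @ [v]. 1 + Y z)"
  proof -
    have "0 \<le> (\<Prod>z\<leftarrow>p. 1 + Y z)" using Y0 by (intro prod_list_nonneg) auto
    then show ?thesis using Y0[of v] mult_left_mono[of 1 "1 + Y v" "\<Prod>z\<leftarrow>p. 1 + Y z"] by simp
  qed
  also have "\<dots> \<le> polymer Y (Suc (fst v)) (Suc (snd v))"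
    using prod_path_le_polymer[of p v Y] p(1) Y0 by simp
  finally show ?thesis .
qed

text \<open>For \<open>\<beta> = p (1 + \<alpha>) / (\<alpha> - p)\<close> the product \<open>(1 + \<alpha>)^k \<Prod>(1 + \<beta>\<^sub>j)\<close> solves the recursion of
  \<^const>\<open>polymer\<close> exactly, with larger boundary values.\<close>

lemma polymer_row_le:
  assumes p: "\<And>j. 0 \<le> p j" "\<And>j. p j < \<alpha>"
  shows "polymer (\<lambda>z. p (snd z)) k l \<le> (1 + \<alpha>) ^ k * (\<Prod>j<l. 1 + p j * (1 + \<alpha>) / (\<alpha> - p j))"
proof -
  define b where "b j = 1 + p j * (1 + \<alpha>) / (\<alpha> - p j)" for j
  define g where "g k l = (1 + \<alpha>) ^ k * (\<Prod>j<l. b j)" for k l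
  have \<alpha>: "0 < \<alpha>" using p[of 0] by linarith
  have b1: "1 \<le> b j" for j unfolding b_def using p[of j] \<alpha> by simp
  \<comment> \<open>Solving this identity for \<open>b j\<close>, with \<alpha> and
    \<open>p j\<close> given, is where the formula for \<beta> comes from.\<close>
  have ab: "(1 + \<alpha>) * b j = (1 + p j) * (b j + (1 + \<alpha>) - 1)" for j
    unfolding b_def using p(2)[of j] by (simp add: field_simps)
  have g_rec: "g (Suc k) (Suc l) = (1 + p l) * (g k (Suc l) + g (Suc k) l - g k l)" for k l
  proof -
    define r where "r = (1 + \<alpha>) ^ k * (\<Prod>j<l. b j)"
    have "g (Suc k) (Suc l) = r * ((1 + \<alpha>) * b l)" by (simp add: g_def r_def)
    also have "\<dots> = (1 + p l) * (r * b l + r * (1 + \<alpha>) - r)" unfolding ab by (simp add: algebra_simps)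
    also have "\<dots> = (1 + p l) * (g k (Suc l) + g (Suc k) l - g k l)" by (simp add: g_def r_def algebra_simps)
    finally show ?thesis .
  qed
  \<comment> \<open>The difference solves the same linear recursion and is nonnegative and
    nondecreasing along both axes.\<close>
  have "0 \<le> g k l - polymer (\<lambda>z. p (snd z)) k l \<and>
      g k l - polymer (\<lambda>z. p (snd z)) k l \<le> g (Suc k) l - polymer (\<lambda>z. p (snd z)) (Suc k) l \<and>
      g k l - polymer (\<lambda>z. p (snd z)) k l \<le> g k (Suc l) - polymer (\<lambda>z. p (snd z)) k (Suc l)"
  proof (rule nonneg_mono_of_recursion[where c="\<lambda>k l. 1 + p l"])
    show "g (Suc k) (Suc l) - polymer (\<lambda>z. p (snd z)) (Suc k) (Suc l) =
        (1 + p l) * (g k (Suc l) - polymer (\<lambda>z. p (snd z)) k (Suc l) +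
        (g (Suc k) l - polymer (\<lambda>z. p (snd z)) (Suc k) l) - (g k l - polymer (\<lambda>z. p (snd z)) k l))" for k l
      unfolding g_rec by (simp add: algebra_simps)
    have "0 \<le> (\<Prod>j<l. b j)" for l by (intro prod_nonneg) (use b1 in \<open>auto intro: order_trans[of 0 1]\<close>)
    then have "(\<Prod>j<l. b j) \<le> (\<Prod>j<l. b j) * b l" for l
      using mult_left_mono[OF b1[of l], of "\<Prod>j<l. b j"] by simp
    then show "g 0 l - polymer (\<lambda>z. p (snd z)) 0 l \<le> g 0 (Suc l) - polymer (\<lambda>z. p (snd z)) 0 (Suc l)" for l
      by (simp add: g_def)
    show "g k 0 - polymer (\<lambda>z. p (snd z)) k 0 \<le> g (Suc k) 0 - polymer (\<lambda>z. p (snd z)) (Suc k) 0" for k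
      using \<alpha> by (simp add: g_def algebra_simps)
  qed (use p in \<open>auto simp: g_def\<close>)
  then show ?thesis unfolding g_def b_def by linarith
qed

text \<open>The choice \<open>\<alpha> = 2 * q\<close> keeps every denominator
  \<open>\<alpha> - p j\<close> at least \<open>q\<close>. The logarithm of the product
  supersolution is then a cost of \<open>2 * q\<close> per column and of
  \<open>p j * (1 + 2 * q) / q\<close> in row \<open>j\<close>.\<close>

lemma ln_polymer_row_le:
  assumes p: "\<And>j. 0 \<le> p j" "\<And>j. p j \<le> q" and q: "0 < q"
  shows "0 < polymer (\<lambda>z. p (snd z)) k l"
    and "ln (polymer (\<lambda>z. p (snd z)) k l) \<le> real k * (2 * q) + (\<Sum>j<l. p j * (1 + 2 * q) / q)"
proof -
  have mono: "1 \<le> polymer (\<lambda>z. p (snd z)) k l" for k l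
  proof (induction k arbitrary: l)
    case (Suc k)
    have "polymer (\<lambda>z. p (snd z)) k l \<le> polymer (\<lambda>z. p (snd z)) (Suc k) l"
      using nonneg_mono_of_recursion[of "polymer (\<lambda>z. p (snd z))" "\<lambda>k l. 1 + p l" k l] p by auto
    then show ?case using Suc[of l] by linarith
  qed simp
  then show pos: "0 < polymer (\<lambda>z. p (snd z)) k l" by (meson less_le_trans zero_less_one)
  let ?b = "\<lambda>j. 1 + p j * (1 + 2 * q) / (2 * q - p j)"
  have d: "0 < 2 * q - p j" "q \<le> 2 * q - p j" for j using p(2)[of j] q by auto
  have b1: "1 \<le> ?b j" for j using d[of j] p[of j] q by simp
  have "polymer (\<lambda>z. p (snd z)) k l \<le> (1 + 2 * q) ^ k * (\<Prod>j<l. ?b j)"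
    using p q d by (intro polymer_row_le) (auto simp: less_diff_eq[symmetric])
  then have "ln (polymer (\<lambda>z. p (snd z)) k l) \<le> ln ((1 + 2 * q) ^ k * (\<Prod>j<l. ?b j))"
    using pos by (subst ln_le_cancel_iff) (auto intro: less_le_trans)
  also have "\<dots> = real k * ln (1 + 2 * q) + (\<Sum>j<l. ln (?b j))"
  proof -
    have b0: "?b j > 0" for j using b1[of j] by linarith
    then have "?b j \<noteq> 0" for j by (metis less_irrefl)
    then have "ln (\<Prod>j<l. ?b j) = (\<Sum>j<l. ln (?b j))" by (subst ln_prod) auto
    then show ?thesis using q b0 by (subst ln_mult_pos) (auto simp: ln_realpow intro!: prod_pos)
  qed
  also have "\<dots> \<le> real k * (2 * q) + (\<Sum>j<l. p j * (1 + 2 * q) / q)"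
  proof (intro add_mono mult_left_mono sum_mono)
    show "ln (1 + 2 * q) \<le> 2 * q" using q ln_add_one_self_le_self[of "2 * q"] by simp
    fix j
    have "ln (?b j) \<le> p j * (1 + 2 * q) / (2 * q - p j)"
      using d[of j] p[of j] q by (intro ln_add_one_self_le_self) simp
    also have "\<dots> \<le> p j * (1 + 2 * q) / q" using d[of j] p[of j] q by (intro divide_left_mono) auto
    finally show "ln (?b j) \<le> p j * (1 + 2 * q) / q" .
  qed simp
  finally show "ln (polymer (\<lambda>z. p (snd z)) k l) \<le> real k * (2 * q) + (\<Sum>j<l. p j * (1 + 2 * q) / q)" .
qed

text \<open>A maximising path for \<open>X\<close> is a competitor at every level \<open>u\<close>,
  and the sum of the positive parts along it is the integral over \<open>u \<ge> 0\<close> of its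
  number of sites above \<open>u\<close>.\<close>

lemma last_passage_layer_cake:
  "ennreal (last_passage X 0 v) \<le>
    (\<integral>\<^sup>+u\<in>{0..}. ennreal (last_passage (\<lambda>z. indicator {u<..} (X z)) 0 v) \<partial>lborel)"
proof -
  obtain p where p: "p \<in> paths 0 (0 + v)" "last_passage X 0 (0 + v) = (\<Sum>z\<leftarrow>p. X z)"
    by (rule last_passage_attained)
  have "distinct p" using p(1) distinct_lattice_path[of "p @ [v]"] by (simp add: mem_paths_iff)
  note conv = sum_list_distinct_conv_sum_set[OF this]
  have "ennreal (last_passage X 0 v) = ennreal (\<Sum>z\<in>set p. X z)" using p by (simp add: conv)
  also have "\<dots> \<le> ennreal (\<Sum>z\<in>set p. max 0 (X z))" by (intro ennreal_leI sum_mono) simp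
  also have "\<dots> = (\<Sum>z\<in>set p. ennreal (max 0 (X z)))"
    by (rule sum_ennreal[symmetric]) simp
  also have "\<dots> = (\<Sum>z\<in>set p. \<integral>\<^sup>+u. indicator {0..<X z} u \<partial>lborel)"
    by (intro sum.cong refl) (auto simp: max_def)
  also have "\<dots> = (\<integral>\<^sup>+u. (\<Sum>z\<in>set p. indicator {0..<X z} u) \<partial>lborel)"
    by (subst nn_integral_sum) auto
  also have "\<dots> \<le> (\<integral>\<^sup>+u\<in>{0..}. ennreal (last_passage (\<lambda>z. indicator {u<..} (X z)) 0 v) \<partial>lborel)"
  proof (rule nn_integral_mono)
    fix u :: real
    show "(\<Sum>z\<in>set p. indicator {0..<X z} u :: ennreal) \<le>
        ennreal (last_passage (\<lambda>z. indicator {u<..} (X z)) 0 v) * indicator {0..} u"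
    proof (cases "0 \<le> u")
      case True
      have "(\<Sum>z\<in>set p. indicator {0..<X z} u :: ennreal) = (\<Sum>z\<in>set p. ennreal (indicator {u<..} (X z)))"
        using True by (intro sum.cong refl) (auto simp: indicator_def)
      also have "\<dots> = ennreal (\<Sum>z\<in>set p. indicator {u<..} (X z))" by (rule sum_ennreal) simp
      also have "\<dots> \<le> ennreal (last_passage (\<lambda>z. indicator {u<..} (X z)) 0 v)"
        using last_passage_ge[of p 0 v "\<lambda>z. indicator {u<..} (X z)"] p(1) by (intro ennreal_leI) (simp add: conv)
      finally show ?thesis using True by simp
    qed simp
  qed
  finally show ?thesis .
qed

section \<open>The quenched and the annealed weight distribution\<close>

lemma quenched_component:
  assumes "F \<in> space env_space"
  shows "sets (F j) = sets borel" "space (F j) = UNIV" "prob_space (F j)"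
  using env_space_component[OF assms, of j] sets_eq_imp_space_eq[of "F j" borel] by auto

lemma space_weight_space [simp]: "space weight_space = UNIV"
  by (simp add: weight_space_def space_PiM)

lemma measurable_quenched_iff:
  "F \<in> space env_space \<Longrightarrow> measurable (quenched F) N = measurable weight_space N"
  by (intro measurable_cong_sets prob_space_quenched refl)

lemma measurable_quenched_subprob [measurable]: "quenched \<in> env_space \<rightarrow>\<^sub>M subprob_algebra weight_space"
  by (rule measurable_prob_algebraD[OF measurable_quenched])

lemma indep_vars_quenched:
  assumes F: "F \<in> space env_space"
  shows "prob_space.indep_vars (quenched F) (\<lambda>z. F (snd z)) (\<lambda>z X. X z) UNIV"
proof -
  interpret prob_space "quenched F" by (rule prob_space_quenched[OF F])
  have comp: "(\<lambda>X. X z) \<in> measurable (quenched F) (F (snd z))" for z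
    unfolding quenched_def by (rule measurable_component_singleton) simp
  show ?thesis
  proof (subst indep_vars_iff_distr_eq_PiM)
    have "distr (quenched F) (\<Pi>\<^sub>M z\<in>UNIV. F (snd z)) (\<lambda>X. \<lambda>z\<in>UNIV. X z) = quenched F"
      unfolding quenched_def restrict_UNIV by (rule distr_id2) simp
    also have "\<dots> = (\<Pi>\<^sub>M z\<in>UNIV. distr (quenched F) (F (snd z)) (\<lambda>X. X z))"
      unfolding quenched_def
      by (intro PiM_cong refl distr_PiM_component[symmetric] quenched_component[OF F]) auto
    finally show "distr (quenched F) (\<Pi>\<^sub>M z\<in>UNIV. F (snd z)) (\<lambda>X. \<lambda>z\<in>UNIV. X z) =
        (\<Pi>\<^sub>M z\<in>UNIV. distr (quenched F) (F (snd z)) (\<lambda>X. X z))" .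
  qed (auto intro: comp)
qed

text \<open>Dependence on the sites of \<open>A\<close> alone is expressed as insensitivity to
  setting all other weights to 0. This keeps \<open>f\<close> and \<open>g\<close> on the full
  configuration space, and \<open>A\<close> and \<open>B\<close> may be infinite.\<close>

lemma quenched_integral_mult:
  fixes f g :: "(nat \<times> nat \<Rightarrow> real) \<Rightarrow> real"
  assumes F: "F \<in> space env_space"
    and f: "integrable (quenched F) f" "\<And>X. f (\<lambda>z. if z \<in> A then X z else 0) = f X"
    and g: "integrable (quenched F) g" "\<And>X. g (\<lambda>z. if z \<in> B then X z else 0) = g X"
    and AB: "A \<inter> B = {}"
  shows "(\<integral>X. f X * g X \<partial>quenched F) = (\<integral>X. f X \<partial>quenched F) * (\<integral>X. g X \<partial>quenched F)"
    and "integrable (quenched F) (\<lambda>X. f X * g X)"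
proof -
  interpret prob_space "quenched F" by (rule prob_space_quenched[OF F])
  let ?M = "\<lambda>z. F (snd z)"
  let ?ext = "\<lambda>C w z. if z \<in> C then w z else (0::real)"
  \<comment> \<open>Extension by 0 carries restricted families back to full configurations, which
    makes \<open>f\<close> and \<open>g\<close> functions of two independent restrictions.\<close>
  have ext: "(\<lambda>w. ?ext C w) \<in> PiM C ?M \<rightarrow>\<^sub>M weight_space" for C
    unfolding weight_space_def
  proof (rule measurable_PiM_single')
    fix z
    show "(\<lambda>w. ?ext C w z) \<in> PiM C ?M \<rightarrow>\<^sub>M borel"
    proof (cases "z \<in> C")
      case True
      then have "(\<lambda>w. w z) \<in> PiM C ?M \<rightarrow>\<^sub>M ?M z" by (rule measurable_component_singleton)
      then show ?thesis using True quenched_component(1)[OF F] by (simp cong: measurable_cong_sets)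
    qed simp
  qed (auto simp: space_PiM)
  have fg: "f \<in> borel_measurable weight_space" "g \<in> borel_measurable weight_space"
    using f(1) g(1) measurable_quenched_iff[OF F] by auto
  have "indep_var (PiM A ?M) (\<lambda>X. restrict (\<lambda>z. X z) A) (PiM B ?M) (\<lambda>X. restrict (\<lambda>z. X z) B)"
    by (rule indep_var_restrict[OF indep_vars_quenched[OF F] AB]) auto
  from indep_var_compose[OF this measurable_compose[OF ext fg(1)] measurable_compose[OF ext fg(2)]]
  have ind: "indep_var borel ((\<lambda>w. f (?ext A w)) \<circ> (\<lambda>X. restrict (\<lambda>z. X z) A))
      borel ((\<lambda>w. g (?ext B w)) \<circ> (\<lambda>X. restrict (\<lambda>z. X z) B))" .
  have eq: "(\<lambda>z. if z \<in> C then restrict X C z else 0) = (\<lambda>z. if z \<in> C then X z else (0::real))" for C X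
    by auto
  have fgX: "f (?ext A (restrict X A)) = f X" "g (?ext B (restrict X B)) = g X" for X
    by (rule trans[OF arg_cong[OF eq[of A X], of f] f(2)[of X]],
        rule trans[OF arg_cong[OF eq[of B X], of g] g(2)[of X]])
  have "indep_var borel f borel g" using ind unfolding comp_def fgX .
  from indep_var_lebesgue_integral[OF this f(1) g(1)] indep_var_integrable[OF this f(1) g(1)]
  show "(\<integral>X. f X * g X \<partial>quenched F) = (\<integral>X. f X \<partial>quenched F) * (\<integral>X. g X \<partial>quenched F)"
    "integrable (quenched F) (\<lambda>X. f X * g X)" by auto
qed

text \<open>Only sites strictly below \<open>k\<close> and \<open>l\<close> enter; hence the corner
  weight in the recursion is independent of its bracket.\<close>

lemma polymer_cong:
  "(\<And>i j. i < k \<Longrightarrow> j < l \<Longrightarrow> Y (i, j) = Y' (i, j)) \<Longrightarrow> polymer Y k l = polymer Y' k l"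
  by (induction Y k l rule: polymer.induct) auto

lemma polymer_bounded: "\<exists>C. \<forall>Y. (\<forall>z. \<bar>Y z\<bar> \<le> 1) \<longrightarrow> \<bar>polymer Y k l\<bar> \<le> C"
\<comment> \<open>\<open>polymer.induct\<close> also ranges over the weights; a dummy feeds that
  argument, since the claim itself quantifies over \<open>Y\<close>.\<close>
proof (induction "\<lambda>_::nat \<times> nat. 0 :: real" k l rule: polymer.induct)
  case (3 k l)
  then obtain C1 C2 C3 where C: "\<And>Y. (\<forall>z. \<bar>Y z\<bar> \<le> 1) \<Longrightarrow> \<bar>polymer Y k (Suc l)\<bar> \<le> C1"
    "\<And>Y. (\<forall>z. \<bar>Y z\<bar> \<le> 1) \<Longrightarrow> \<bar>polymer Y (Suc k) l\<bar> \<le> C2" "\<And>Y. (\<forall>z. \<bar>Y z\<bar> \<le> 1) \<Longrightarrow> \<bar>polymer Y k l\<bar> \<le> C3"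
    by metis
  have "\<bar>polymer Y (Suc k) (Suc l)\<bar> \<le> 2 * (C1 + C2 + C3)" if Y: "\<forall>z. \<bar>Y z\<bar> \<le> 1" for Y
    unfolding polymer.simps abs_mult
    using C(1)[OF Y] C(2)[OF Y] C(3)[OF Y] Y[rule_format, of "(k, l)"] by (intro mult_mono) auto
  then show ?case by blast
qed (auto intro: exI[of _ 1])

lemma polymer_measurable:
  assumes "\<And>z. (\<lambda>\<omega>. Y \<omega> z) \<in> borel_measurable M"
  shows "(\<lambda>\<omega>. polymer (Y \<omega>) k l) \<in> borel_measurable M"
  by (induction "\<lambda>_::nat \<times> nat. 0 :: real" k l rule: polymer.induct) (use assms in auto)

lemma quenched_integral_coordinate:
  assumes F: "F \<in> space env_space" and [measurable]: "f \<in> borel_measurable borel"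
  shows "(\<integral>X. f (X z) \<partial>quenched F) = (\<integral>x. (f x :: real) \<partial>F (snd z))"
proof -
  have m: "f \<in> borel_measurable (F (snd z))"
    using assms(2) quenched_component(1)[OF F] by (simp cong: measurable_cong_sets)
  have "(\<integral>x. f x \<partial>F (snd z)) = (\<integral>x. f x \<partial>distr (quenched F) (F (snd z)) (\<lambda>X. X z))"
    unfolding quenched_def by (subst distr_PiM_component) (auto intro: quenched_component[OF F])
  also have "\<dots> = (\<integral>X. f (X z) \<partial>quenched F)"
    unfolding quenched_def by (intro integral_distr m measurable_component_singleton) simp
  finally show ?thesis by simp
qed

text \<open>None of the three values in the bracket involves the weight at \<open>(k, l)\<close>, so
  by quenched independence the expectation passes through the product, and the means satisfy the
  same recursion.\<close>

lemma quenched_expectation_polymer: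
  fixes u :: real
  assumes F: "F \<in> space env_space"
  defines "Y \<equiv> \<lambda>X z. indicator {u<..} (X z) :: real"
  shows "integrable (quenched F) (\<lambda>X. polymer (Y X) k l)"
    and "(\<integral>X. polymer (Y X) k l \<partial>quenched F) = polymer (\<lambda>z. measure (F (snd z)) {u<..}) k l"
proof -
  interpret prob_space "quenched F" by (rule prob_space_quenched[OF F])
  have Y_meas: "(\<lambda>X. Y X z) \<in> borel_measurable (quenched F)" for z
    unfolding Y_def measurable_quenched_iff[OF F]
    by (rule measurable_compose[OF coordinate_measurable]) simp
  show int: "integrable (quenched F) (\<lambda>X. polymer (Y X) k l)" for k l
  proof -
    obtain C where "\<And>Y. (\<forall>z. \<bar>Y z\<bar> \<le> 1) \<Longrightarrow> \<bar>polymer Y k l\<bar> \<le> C" using polymer_bounded by metis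
    then have "\<bar>polymer (Y X) k l\<bar> \<le> C" for X by (auto simp: Y_def indicator_def)
    then show ?thesis
      by (intro integrable_const_bound[of _ C] polymer_measurable Y_meas) auto
  qed
  have Y_int: "integrable (quenched F) (\<lambda>X. Y X z)" for z
    by (intro integrable_const_bound[of _ 1] Y_meas) (auto simp: Y_def indicator_def)
  show "(\<integral>X. polymer (Y X) k l \<partial>quenched F) = polymer (\<lambda>z. measure (F (snd z)) {u<..}) k l"
  proof (induction "\<lambda>z::nat \<times> nat. measure (F (snd z)) {u<..}" k l rule: polymer.induct)
    case (3 k l)
    let ?g = "\<lambda>X. polymer (Y X) k (Suc l) + polymer (Y X) (Suc k) l - polymer (Y X) k l"
    have "(\<integral>X. (1 + Y X (k, l)) * ?g X \<partial>quenched F) = (\<integral>X. 1 + Y X (k, l) \<partial>quenched F) * (\<integral>X. ?g X \<partial>quenched F)"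
    proof (rule quenched_integral_mult(1)[OF F, where A="{(k, l)}" and B="- {(k, l)}"])
      fix X
      have "polymer (Y (\<lambda>z. if z \<in> - {(k, l)} then X z else 0)) i j = polymer (Y X) i j"
        if "i \<le> k \<or> j \<le> l" for i j
        using that by (intro polymer_cong) (auto simp: Y_def)
      then show "?g (\<lambda>z. if z \<in> - {(k, l)} then X z else 0) = ?g X" by simp
    qed (use int Y_int in \<open>auto simp: Y_def\<close>)
    also have "(\<integral>X. Y X (k, l) \<partial>quenched F) = measure (F l) {u<..}"
      unfolding Y_def using quenched_integral_coordinate[OF F, of "indicator {u<..}" "(k, l)"]
        quenched_component[OF F, of l] by simp
    then have "(\<integral>X. 1 + Y X (k, l) \<partial>quenched F) = 1 + measure (F l) {u<..}"
      using Y_int by (simp add: prob_space)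
    finally show ?case using 3 int by simp
  qed (auto simp: prob_space)
qed

lemma last_passage_nonneg:
  assumes "\<And>z. 0 \<le> X z"
  shows "0 \<le> last_passage X 0 v"
proof -
  obtain p where p: "p \<in> paths 0 (0 + v)" "last_passage X 0 (0 + v) = (\<Sum>z\<leftarrow>p. X z)"
    by (rule last_passage_attained)
  have "0 \<le> (\<Sum>z\<leftarrow>p. X z)" using assms by (intro sum_list_nonneg) auto
  then show ?thesis using p by simp
qed

text \<open>This is Jensen's inequality for the logarithm, applied to the domination of 2^T by
  \<open>polymer\<close>.\<close>

lemma quenched_last_passage_indicator_le:
  assumes F: "F \<in> space env_space" and q: "0 < q" "\<And>j. measure (F j) {u<..} \<le> q"
  shows "(\<integral>\<^sup>+X. ennreal (last_passage (\<lambda>z. indicator {u<..} (X z)) 0 v) \<partial>quenched F) \<le>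
    ennreal ((real (Suc (fst v)) * (2 * q) + (\<Sum>j<Suc (snd v). measure (F j) {u<..} * (1 + 2 * q) / q)) / ln 2)"
proof -
  interpret prob_space "quenched F" by (rule prob_space_quenched[OF F])
  let ?Y = "\<lambda>X z. indicator {u<..} (X z) :: real"
  let ?k = "Suc (fst v)" and ?l = "Suc (snd v)"
  define B where "B = polymer (\<lambda>z. measure (F (snd z)) {u<..}) ?k ?l"
  have B: "0 < B" "ln B \<le> real ?k * (2 * q) + (\<Sum>j<?l. measure (F j) {u<..} * (1 + 2 * q) / q)"
    unfolding B_def using ln_polymer_row_le[of "\<lambda>j. measure (F j) {u<..}" q ?k ?l] q by auto
  \<comment> \<open>Jensen in pointwise form: the logarithm is replaced by its tangent at
    \<open>B\<close>, the quenched mean of the polymer, so the correction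
    \<open>polymer / B - 1\<close> integrates to 0.\<close>
  have U: "last_passage (?Y X) 0 v \<le> (ln B - 1 + polymer (?Y X) ?k ?l / B) / ln 2" for X
  proof -
    have "1 + (ln 2 * last_passage (?Y X) 0 v - ln B) \<le> exp (ln 2 * last_passage (?Y X) 0 v - ln B)"
      by (rule exp_ge_add_one_self)
    also have "\<dots> = 2 powr last_passage (?Y X) 0 v / B"
      using B(1) by (simp add: exp_diff powr_def mult.commute)
    also have "\<dots> \<le> polymer (?Y X) ?k ?l / B"
      using B(1) two_powr_last_passage_le_polymer[of "?Y X" v]
      by (intro divide_right_mono) (auto simp: indicator_def)
    finally have "ln 2 * last_passage (?Y X) 0 v \<le> ln B - 1 + polymer (?Y X) ?k ?l / B" by linarith
    then show ?thesis by (simp add: pos_le_divide_eq mult.commute)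
  qed
  note int = quenched_expectation_polymer(1)[OF F, of u ?k ?l]
  have "(\<integral>\<^sup>+X. ennreal (last_passage (?Y X) 0 v) \<partial>quenched F) \<le>
      (\<integral>\<^sup>+X. ennreal ((ln B - 1 + polymer (?Y X) ?k ?l / B) / ln 2) \<partial>quenched F)"
    by (intro nn_integral_mono ennreal_leI U)
  also have "\<dots> = ennreal (\<integral>X. (ln B - 1 + polymer (?Y X) ?k ?l / B) / ln 2 \<partial>quenched F)"
  proof (rule nn_integral_eq_integral)
    have "0 \<le> last_passage (?Y X) 0 v" for X by (rule last_passage_nonneg) simp
    then show "AE X in quenched F. 0 \<le> (ln B - 1 + polymer (?Y X) ?k ?l / B) / ln 2"
      using U by (intro AE_I2) (rule order_trans)
  qed (use int in auto)
  also have "(\<integral>X. (ln B - 1 + polymer (?Y X) ?k ?l / B) / ln 2 \<partial>quenched F) =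
      (ln B - 1 + (\<integral>X. polymer (?Y X) ?k ?l \<partial>quenched F) / B) / ln 2"
    using int by (simp add: prob_space del: polymer.simps)
  also have "\<dots> = ln B / ln 2"
    using B(1) quenched_expectation_polymer(2)[OF F, of u ?k ?l] unfolding B_def[symmetric] by simp
  also have "\<dots> \<le> (real ?k * (2 * q) + (\<Sum>j<?l. measure (F j) {u<..} * (1 + 2 * q) / q)) / ln 2"
    using B(2) by (intro divide_right_mono) auto
  finally show ?thesis by (auto intro: ennreal_leI order_trans)
qed

section \<open>The annealed law of the weights and its translation invariance\<close>

definition weights_law :: "(nat \<Rightarrow> real measure) measure \<Rightarrow> (nat \<times> nat \<Rightarrow> real) measure" where
  "weights_law P = P \<bind> quenched"

text \<open>The quadrant admits only shifts by nonnegative vectors. These form a semigroup of maps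
  that are in general not injective, which is why the ergodic theorems above allow a non-invertible
  \<open>S\<close>.\<close>

definition translate :: "nat \<times> nat \<Rightarrow> (nat \<times> nat \<Rightarrow> real) \<Rightarrow> nat \<times> nat \<Rightarrow> real" where
  "translate s X = (\<lambda>z. X (z + s))"

lemma translate_measurable [measurable]: "translate s \<in> weight_space \<rightarrow>\<^sub>M weight_space"
  unfolding translate_def weight_space_def
  by (rule measurable_PiM_single') (auto simp: space_PiM)

lemma translate_translate: "translate s (translate t X) = translate (s + t) X"
  by (simp add: translate_def add.assoc)

lemma last_passage_translate': "last_passage (translate s X) u v = last_passage X (u + s) (v + s)"
  unfolding translate_def by (rule last_passage_translate)

lemma env_shift_measurable [measurable]: "(\<lambda>F j. F (j + n)) \<in> env_space \<rightarrow>\<^sub>M env_space"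
  unfolding env_space_def
  by (rule measurable_PiM_single') (auto simp: space_PiM intro!: measurable_component_singleton)

text \<open>A product measure is reindexed along an injection. Only the row offset survives, because
  the laws are constant along each row.\<close>

lemma distr_quenched_translate:
  assumes F: "F \<in> space env_space"
  shows "distr (quenched F) weight_space (translate s) = quenched (\<lambda>j. F (j + snd s))"
proof -
  have "distr (\<Pi>\<^sub>M z\<in>UNIV. F (snd z)) (\<Pi>\<^sub>M z\<in>UNIV. F (snd (z + s))) (\<lambda>X. \<lambda>z\<in>UNIV. X (z + s)) =
      (\<Pi>\<^sub>M z\<in>UNIV. F (snd (z + s)))"
    using quenched_component(3)[OF F] by (intro distr_PiM_reindex) (auto simp: inj_on_def)
  moreover have "sets (\<Pi>\<^sub>M z\<in>(UNIV :: (nat \<times> nat) set). F (snd (z + s))) = sets weight_space"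
    unfolding weight_space_def using quenched_component(1)[OF F] by (intro sets_PiM_cong) auto
  then have "distr (\<Pi>\<^sub>M z\<in>UNIV. F (snd z)) (\<Pi>\<^sub>M z\<in>UNIV. F (snd (z + s))) (\<lambda>X. \<lambda>z\<in>UNIV. X (z + s)) =
      distr (quenched F) weight_space (translate s)"
    unfolding quenched_def translate_def restrict_UNIV by (intro distr_cong) auto
  ultimately show ?thesis by (simp add: quenched_def)
qed

locale stationary_weights =
  fixes P :: "(nat \<Rightarrow> real measure) measure"
  assumes prob_P: "prob_space P" and sets_P: "sets P = sets env_space"
    and stationary: "stationary_env P"
begin

abbreviation "\<mu> \<equiv> weights_law P"

lemma space_P: "space P = space env_space"
  using sets_eq_imp_space_eq[OF sets_P] .

lemma P_in: "P \<in> space (prob_algebra env_space)"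
  using prob_P sets_P by (simp add: space_prob_algebra)

lemma space_P_nonempty: "space P \<noteq> {}"
  using prob_space.not_empty[OF prob_P] .

lemma sets_\<mu> [simp]: "sets \<mu> = sets weight_space"
  unfolding weights_law_def by (rule sets_bind'[OF P_in measurable_quenched])

lemma space_\<mu> [simp]: "space \<mu> = UNIV"
  using sets_eq_imp_space_eq[OF sets_\<mu>] by simp

lemma measurable_\<mu> [simp]: "measurable \<mu> N = measurable weight_space N"
  by (rule measurable_cong_sets) auto

lemma measurable_P [simp]: "measurable P N = measurable env_space N"
  by (rule measurable_cong_sets) (auto simp: sets_P)

lemma quenched_P: "quenched \<in> P \<rightarrow>\<^sub>M subprob_algebra weight_space"
  by simp

lemma distr_P_shift: "distr P env_space (\<lambda>F j. F (j + n)) = P"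
proof (induction n)
  case 0
  show ?case by (simp, rule distr_id2) (simp add: sets_P)
next
  case (Suc n)
  have [measurable]: "env_shift \<in> env_space \<rightarrow>\<^sub>M env_space"
    using env_shift_measurable[of 1] by (simp add: env_shift_def[abs_def])
  have "distr P env_space (\<lambda>F j. F (j + Suc n)) = distr (distr P env_space env_shift) env_space (\<lambda>F j. F (j + n))"
    by (subst distr_distr) (auto simp: comp_def env_shift_def)
  then show ?case using Suc stationary by (simp add: stationary_env_def)
qed

lemma AE_P_shift:
  assumes "AE F in P. Q F"
  shows "AE F in P. Q (\<lambda>j. F (j + n))"
proof -
  have "AE F in distr P env_space (\<lambda>F j. F (j + n)). Q F" by (subst distr_P_shift) (rule assms)
  then show ?thesis by (rule AE_distrD[rotated]) simp
qed

lemma nn_integral_\<mu>: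
  "f \<in> borel_measurable weight_space \<Longrightarrow> (\<integral>\<^sup>+X. f X \<partial>\<mu>) = (\<integral>\<^sup>+F. \<integral>\<^sup>+X. f X \<partial>quenched F \<partial>P)"
  unfolding weights_law_def by (rule nn_integral_bind[OF _ quenched_P])

lemma AE_\<mu>:
  "Measurable.pred weight_space Q \<Longrightarrow> (AE X in \<mu>. Q X) \<longleftrightarrow> (AE F in P. AE X in quenched F. Q X)"
  unfolding weights_law_def by (rule AE_bind[OF quenched_P])

lemma prob_space_\<mu>: "prob_space \<mu>"
  unfolding weights_law_def by (rule prob_space_bind'[OF P_in measurable_quenched])

sublocale P: prob_space P by (rule prob_P)
sublocale \<mu>: prob_space \<mu> by (rule prob_space_\<mu>)

text \<open>This moves the integrability hypothesis to \<open>\<mu>\<close> and, at the end, the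
  limits back to the joint measure.\<close>

lemma joint_snd: "distr (joint_measure P) weight_space snd = \<mu>"
proof -
  have K: "(\<lambda>F. distr (quenched F) (env_space \<Otimes>\<^sub>M weight_space) (\<lambda>X. (F, X)))
      \<in> P \<rightarrow>\<^sub>M subprob_algebra (env_space \<Otimes>\<^sub>M weight_space)"
    using measurable_prob_algebraD[OF measurable_joint_kernel] by simp
  have "distr (joint_measure P) weight_space snd =
      P \<bind> (\<lambda>F. distr (distr (quenched F) (env_space \<Otimes>\<^sub>M weight_space) (\<lambda>X. (F, X))) weight_space snd)"
    unfolding joint_measure_def by (rule distr_bind[OF K space_P_nonempty measurable_snd])
  also have "\<dots> = P \<bind> quenched"
  proof (rule bind_cong[OF refl])
    fix F assume "F \<in> space P"
    then have F: "F \<in> space env_space" by (simp add: space_P)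
    have "(\<lambda>X. (F, X)) \<in> quenched F \<rightarrow>\<^sub>M env_space \<Otimes>\<^sub>M weight_space"
      unfolding measurable_quenched_iff[OF F] using F by measurable
    then have "distr (distr (quenched F) (env_space \<Otimes>\<^sub>M weight_space) (\<lambda>X. (F, X))) weight_space snd =
        distr (quenched F) weight_space (\<lambda>X. X)"
      by (subst distr_distr) (auto simp: comp_def)
    also have "\<dots> = quenched F" by (rule distr_id2) (simp add: prob_space_quenched(2)[OF F])
    finally show "distr (distr (quenched F) (env_space \<Otimes>\<^sub>M weight_space) (\<lambda>X. (F, X))) weight_space snd = quenched F" .
  qed
  finally show ?thesis by (simp add: weights_law_def)
qed

text \<open>Horizontal translations preserve every quenched law; vertical ones shift the
  environment, whose law is stationary.\<close>

lemma distr_\<mu>_translate: "distr \<mu> weight_space (translate s) = \<mu>"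
proof -
  have "distr \<mu> weight_space (translate s) = P \<bind> (\<lambda>F. distr (quenched F) weight_space (translate s))"
    unfolding weights_law_def by (rule distr_bind[OF quenched_P space_P_nonempty translate_measurable])
  also have "\<dots> = P \<bind> (\<lambda>F. quenched (\<lambda>j. F (j + snd s)))"
    by (rule bind_cong[OF refl]) (simp add: distr_quenched_translate space_P)
  also have "\<dots> = distr P env_space (\<lambda>F j. F (j + snd s)) \<bind> quenched"
    by (subst bind_distr[where K=weight_space and X=env_space]) (auto simp: space_P_nonempty)
  also have "\<dots> = \<mu>" by (simp add: distr_P_shift weights_law_def)
  finally show ?thesis .
qed

end

section \<open>The moment bound\<close>

locale moment_weights = stationary_weights +
  assumes tail_sqrt: "(\<integral>\<^sup>+x\<in>{0..}. ennreal (sqrt (1 - (\<integral>F. cdf (F 0) x \<partial>P))) \<partial>lborel) < \<infinity>"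
    and tail_esssup: "(\<integral>\<^sup>+x\<in>{0..}. esssup P (\<lambda>F. ennreal (1 - cdf (F 0) x)) \<partial>lborel) < \<infinity>"
begin

lemma cdf_measurable [measurable]: "(\<lambda>F. cdf (F j) u) \<in> borel_measurable env_space"
proof -
  have "(\<lambda>F. F j) \<in> env_space \<rightarrow>\<^sub>M subprob_algebra borel"
    unfolding env_space_def
    by (rule measurable_prob_algebraD) (rule measurable_component_singleton, simp)
  then have "(\<lambda>F. emeasure (F j) {..u}) \<in> borel_measurable env_space"
    by (rule measurable_compose) (rule measurable_emeasure_subprob_algebra, simp)
  then show ?thesis unfolding cdf_def measure_def by measurable
qed

lemma cdf_bounds:
  assumes "F \<in> space env_space"
  shows "0 \<le> cdf (F j) u" "cdf (F j) u \<le> 1" "measure (F j) {u<..} = 1 - cdf (F j) u"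
proof -
  interpret prob_space "F j" by (rule quenched_component[OF assms])
  show "0 \<le> cdf (F j) u" "cdf (F j) u \<le> 1" by (auto simp: cdf_def)
  have "{u<..} = space (F j) - {..u}" using quenched_component[OF assms, of j] by auto
  then show "measure (F j) {u<..} = 1 - cdf (F j) u"
    using prob_compl[of "{..u}"] quenched_component[OF assms, of j] by (simp add: cdf_def)
qed

lemma cdf_mono:
  assumes "F \<in> space env_space" "u \<le> w"
  shows "cdf (F j) u \<le> cdf (F j) w"
proof -
  interpret prob_space "F j" by (rule quenched_component[OF assms(1)])
  show ?thesis unfolding cdf_def using assms quenched_component[OF assms(1), of j]
    by (intro finite_measure_mono) auto
qed

lemma integrable_cdf [simp]: "integrable P (\<lambda>F. cdf (F j) u)"
  using cdf_bounds by (intro P.integrable_const_bound[of _ 1]) (auto simp: space_P)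

lemma integral_cdf: "(\<integral>F. cdf (F j) u \<partial>P) = (\<integral>F. cdf (F 0) u \<partial>P)"
proof -
  have "(\<integral>F. cdf (F 0) u \<partial>P) = (\<integral>F. cdf (F 0) u \<partial>distr P env_space (\<lambda>F i. F (i + j)))"
    by (simp only: distr_P_shift)
  also have "\<dots> = (\<integral>F. cdf (F j) u \<partial>P)" by (subst integral_distr) auto
  finally show ?thesis by simp
qed

definition mean_tail :: "real \<Rightarrow> real" where "mean_tail u = 1 - (\<integral>F. cdf (F 0) u \<partial>P)"
definition max_tail :: "real \<Rightarrow> real" where
  "max_tail u = enn2real (esssup P (\<lambda>F. ennreal (1 - cdf (F 0) u)))"

text \<open>The summand \<open>exp (- u)\<close> only keeps the level positive.\<close>

definition level :: "real \<Rightarrow> real" where "level u = sqrt (mean_tail u) + max_tail u + exp (- u)"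

lemma mean_tail_bounds: "0 \<le> mean_tail u" "mean_tail u \<le> 1"
proof -
  have "(\<integral>F. cdf (F 0) u \<partial>P) \<le> (\<integral>F. 1 \<partial>P)"
    using cdf_bounds by (intro integral_mono) (auto simp: space_P)
  moreover have "0 \<le> (\<integral>F. cdf (F 0) u \<partial>P)"
    using cdf_bounds by (intro integral_nonneg_AE AE_I2) (auto simp: space_P)
  ultimately show "0 \<le> mean_tail u" "mean_tail u \<le> 1" by (auto simp: mean_tail_def P.prob_space)
qed

lemma esssup_le_1: "esssup P (\<lambda>F. ennreal (1 - cdf (F 0) u)) \<le> 1"
  using cdf_bounds by (intro esssup_I) (auto simp: space_P)

lemma esssup_eq_max_tail: "esssup P (\<lambda>F. ennreal (1 - cdf (F 0) u)) = ennreal (max_tail u)"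
  unfolding max_tail_def using esssup_le_1[of u] by (subst ennreal_enn2real) (auto intro: le_less_trans)

lemma max_tail_bounds: "0 \<le> max_tail u" "max_tail u \<le> 1"
proof -
  show "0 \<le> max_tail u" by (simp add: max_tail_def)
  have "ennreal (max_tail u) \<le> ennreal 1" using esssup_le_1[of u] by (simp add: esssup_eq_max_tail)
  then show "max_tail u \<le> 1" by (simp add: ennreal_le_iff)
qed

text \<open>The essential supremum concerns row 0 only. Stationarity carries the bound to each row,
  and countability to all rows at once, as the quenched estimate demands.\<close>

lemma AE_tail_le: "AE F in P. \<forall>j. measure (F j) {u<..} \<le> max_tail u"
proof (subst AE_all_countable, rule allI)
  fix j
  have "AE F in P. ennreal (1 - cdf (F 0) u) \<le> ennreal (max_tail u)"
    unfolding esssup_eq_max_tail[symmetric] by (rule esssup_AE)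
  then have "AE F in P. 1 - cdf (F 0) u \<le> max_tail u"
    by eventually_elim (simp add: ennreal_le_iff max_tail_bounds)
  then have "AE F in P. 1 - cdf (F (0 + j)) u \<le> max_tail u" by (rule AE_P_shift)
  moreover have "AE F in P. F \<in> space P" by simp
  ultimately show "AE F in P. measure (F j) {u<..} \<le> max_tail u"
    by eventually_elim (simp add: cdf_bounds(3) space_P)
qed

lemma mean_tail_antimono: "u \<le> w \<Longrightarrow> mean_tail w \<le> mean_tail u"
  unfolding mean_tail_def using cdf_mono by (intro diff_left_mono integral_mono) (auto simp: space_P)

lemma max_tail_antimono: "u \<le> w \<Longrightarrow> max_tail w \<le> max_tail u"
proof -
  assume "u \<le> w"
  then have "ennreal (max_tail w) \<le> ennreal (max_tail u)"
    unfolding esssup_eq_max_tail[symmetric] using cdf_mono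
    by (intro esssup_AE_mono AE_I2) (auto simp: space_P intro!: ennreal_leI)
  then show "max_tail w \<le> max_tail u" by (simp add: ennreal_le_iff max_tail_bounds)
qed

text \<open>Both tails are antitone in \<open>u\<close>, and monotone functions are Borel.\<close>

lemma tails_measurable [measurable]:
  "mean_tail \<in> borel_measurable borel" "max_tail \<in> borel_measurable borel" "level \<in> borel_measurable borel"
proof -
  have "(\<lambda>u. - mean_tail u) \<in> borel_measurable borel" "(\<lambda>u. - max_tail u) \<in> borel_measurable borel"
    using mean_tail_antimono max_tail_antimono by (rule_tac borel_measurable_mono, simp add: mono_def)+
  from borel_measurable_uminus[OF this(1)] borel_measurable_uminus[OF this(2)]
  show [measurable]: "mean_tail \<in> borel_measurable borel" "max_tail \<in> borel_measurable borel" by simp_all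
  show "level \<in> borel_measurable borel" unfolding level_def[abs_def] by measurable
qed

lemma level_pos: "0 < level u"
  unfolding level_def using mean_tail_bounds[of u] max_tail_bounds[of u]
  by (intro add_nonneg_pos add_nonneg_nonneg) auto

lemma level_integral_finite: "(\<integral>\<^sup>+u\<in>{0..}. ennreal (level u) \<partial>lborel) < \<infinity>"
proof -
  have "(\<integral>\<^sup>+u\<in>{0..}. ennreal (level u) \<partial>lborel) =
      (\<integral>\<^sup>+u. (ennreal (sqrt (mean_tail u)) * indicator {0..} u + ennreal (max_tail u) * indicator {0..} u)
        + ennreal (exp (- u)) * indicator {0..} u \<partial>lborel)"
    unfolding level_def using mean_tail_bounds max_tail_bounds
    by (intro nn_integral_cong) (auto simp: distrib_right)
  also have "\<dots> = (\<integral>\<^sup>+u\<in>{0..}. ennreal (sqrt (mean_tail u)) \<partial>lborel) +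
      (\<integral>\<^sup>+u\<in>{0..}. ennreal (max_tail u) \<partial>lborel) + (\<integral>\<^sup>+u\<in>{0..}. ennreal (exp (- u)) \<partial>lborel)"
    by (simp add: nn_integral_add)
  also have "(\<integral>\<^sup>+u\<in>{0..}. ennreal (exp (- u)) \<partial>lborel) < \<infinity>"
  proof -
    have "(\<integral>\<^sup>+u. ennreal (exp (- u)) * indicator {0..} u \<partial>lborel) = ennreal (0 - (- exp (- 0)))"
    proof (rule nn_integral_FTC_atLeast)
      show "((\<lambda>u. - exp (- u :: real)) \<longlongrightarrow> 0) at_top"
        by (rule tendsto_eq_intros exp_at_bot[THEN filterlim_compose] filterlim_uminus_at_bot_at_top | simp)+
    qed (auto intro!: derivative_eq_intros)
    then show ?thesis by simp
  qed
  then have "(\<integral>\<^sup>+u\<in>{0..}. ennreal (sqrt (mean_tail u)) \<partial>lborel) +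
      (\<integral>\<^sup>+u\<in>{0..}. ennreal (max_tail u) \<partial>lborel) + (\<integral>\<^sup>+u\<in>{0..}. ennreal (exp (- u)) \<partial>lborel) < \<infinity>"
    using tail_sqrt tail_esssup unfolding esssup_eq_max_tail mean_tail_def[symmetric]
    by (simp add: ennreal_add_eq_top less_top)
  finally show ?thesis .
qed

text \<open>The level \<open>q\<close> has two tasks in the quenched bound. As
  \<open>q \<ge> max_tail u\<close>, it dominates the tails of all rows of almost every environment.
  As \<open>q * q \<ge> mean_tail u\<close>, the averaged row cost
  \<open>mean_tail u * (1 + 2 * q) / q\<close> is a multiple of \<open>q\<close>, like the column
  cost.\<close>

lemma expectation_level_le:
  assumes u: "0 \<le> u"
  shows "(\<integral>\<^sup>+X. ennreal (last_passage (\<lambda>z. indicator {u<..} (X z)) 0 v) \<partial>\<mu>) \<le>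
    ennreal (7 / ln 2 * (real (fst v) + real (snd v) + 2)) * ennreal (level u)"
proof -
  define q where "q = level u"
  have q: "0 < q" unfolding q_def by (rule level_pos)
  \<comment> \<open>Each of the three summands of \<open>level u\<close> is at most 1 when
    \<open>u \<ge> 0\<close>; the constant 7 is \<open>1 + 2 * 3\<close>.\<close>
  have "q \<le> 1 + 1 + 1"
    unfolding q_def level_def using mean_tail_bounds[of u] max_tail_bounds[of u] u
    by (intro add_mono) auto
  then have q3: "1 + 2 * q \<le> 7" by simp
  have tail_q: "max_tail u \<le> q" unfolding q_def level_def using mean_tail_bounds[of u] by simp
  have "sqrt (mean_tail u) \<le> q" unfolding q_def level_def using max_tail_bounds[of u] by simp
  then have mean_q: "mean_tail u \<le> q * q"
    using mean_tail_bounds[of u] q by (metis power2_eq_square real_sqrt_le_iff real_sqrt_abs abs_of_pos real_le_lsqrt sqrt_le_D)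
  let ?l = "Suc (snd v)"
  let ?b = "\<lambda>F. (real (Suc (fst v)) * (2 * q) + (\<Sum>j<?l. measure (F j) {u<..} * (1 + 2 * q) / q)) / ln 2"
  let ?c = "\<lambda>F. (real (Suc (fst v)) * (2 * q) + (\<Sum>j<?l. (1 - cdf (F j) u) * (1 + 2 * q) / q)) / ln 2"
  have meas: "(\<lambda>X. last_passage (\<lambda>z. indicator {u<..} (X z)) 0 v) \<in> borel_measurable weight_space"
    by (rule borel_measurable_last_passage, rule measurable_compose[OF coordinate_measurable]) simp
  then have "(\<integral>\<^sup>+X. ennreal (last_passage (\<lambda>z. indicator {u<..} (X z)) 0 v) \<partial>\<mu>) =
      (\<integral>\<^sup>+F. \<integral>\<^sup>+X. ennreal (last_passage (\<lambda>z. indicator {u<..} (X z)) 0 v) \<partial>quenched F \<partial>P)"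
    by (intro nn_integral_\<mu>) simp
  also have "\<dots> \<le> (\<integral>\<^sup>+F. ennreal (?c F) \<partial>P)"
  proof (rule nn_integral_mono_AE)
    have "AE F in P. F \<in> space P" by simp
    with AE_tail_le[of u] show "AE F in P. (\<integral>\<^sup>+X. ennreal (last_passage (\<lambda>z. indicator {u<..} (X z)) 0 v) \<partial>quenched F) \<le> ennreal (?c F)"
    proof eventually_elim
      case (elim F)
      then have F: "F \<in> space env_space" by (simp add: space_P)
      have "measure (F j) {u<..} \<le> q" for j using elim(1) tail_q by (auto intro: order_trans)
      from quenched_last_passage_indicator_le[OF F q this, of v]
      show ?case unfolding cdf_bounds(3)[OF F] .
    qed
  qed
  also have "\<dots> = ennreal (\<integral>F. ?c F \<partial>P)"
  proof (rule nn_integral_eq_integral)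
    show "AE F in P. 0 \<le> ?c F"
      using cdf_bounds q by (intro AE_I2 divide_nonneg_pos add_nonneg_nonneg sum_nonneg) (auto simp: space_P)
  qed auto
  also have "(\<integral>F. ?c F \<partial>P) = (real (Suc (fst v)) * (2 * q) + (\<Sum>j<?l. mean_tail u * (1 + 2 * q) / q)) / ln 2"
  proof -
    have "(\<integral>F. cdf (F j) u \<partial>P) = 1 - mean_tail u" for j
      using integral_cdf[of j u] by (simp add: mean_tail_def)
    then have "(\<integral>F. ?c F \<partial>P) = (real (Suc (fst v)) * (2 * q) + (\<Sum>j<?l. (1 - (1 - mean_tail u)) * (1 + 2 * q) / q)) / ln 2"
      by (simp add: P.prob_space del: sum.lessThan_Suc sum_constant)
    then show ?thesis by simp
  qed
  also have "\<dots> \<le> 7 / ln 2 * (real (fst v) + real (snd v) + 2) * q"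
  proof -
    have "mean_tail u * (1 + 2 * q) / q \<le> (q * q) * 7 / q"
      using mean_q q3 q mean_tail_bounds[of u] by (intro divide_right_mono mult_mono) auto
    then have "(\<Sum>j<?l. mean_tail u * (1 + 2 * q) / q) \<le> (\<Sum>j<?l. 7 * q)" using q by (intro sum_mono) simp
    then have "real (Suc (fst v)) * (2 * q) + (\<Sum>j<?l. mean_tail u * (1 + 2 * q) / q) \<le>
        real (Suc (fst v)) * (7 * q) + real ?l * (7 * q)"
      using q by (intro add_mono mult_left_mono) auto
    also have "\<dots> = 7 * (real (fst v) + real (snd v) + 2) * q" by (simp add: algebra_simps)
    finally have "(real (Suc (fst v)) * (2 * q) + (\<Sum>j<?l. mean_tail u * (1 + 2 * q) / q)) / ln 2 \<le>
        7 * (real (fst v) + real (snd v) + 2) * q / ln 2" by (rule divide_right_mono) simp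
    then show ?thesis by simp
  qed
  finally show ?thesis unfolding q_def
    by (simp add: ennreal_mult[symmetric] less_imp_le[OF level_pos] ennreal_leI)
qed

text \<open>Layer cake and Tonelli reduce the claim to the bound for each level, which is integrable
  in \<open>u\<close>. The summand 2 stems from the polymer being taken one step beyond
  \<open>v\<close> in both coordinates.\<close>

lemma expectation_last_passage_le:
  obtains C where "0 \<le> C" "\<And>v. (\<integral>\<^sup>+X. ennreal (last_passage X 0 v) \<partial>\<mu>) \<le> ennreal (C * (real (fst v) + real (snd v) + 2))"
proof -
  define I where "I = enn2real (\<integral>\<^sup>+u\<in>{0..}. ennreal (level u) \<partial>lborel)"
  have I: "(\<integral>\<^sup>+u\<in>{0..}. ennreal (level u) \<partial>lborel) = ennreal I"
    unfolding I_def using level_integral_finite by (subst ennreal_enn2real) auto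
  have I0: "0 \<le> I" by (simp add: I_def)
  interpret pair_sigma_finite \<mu> lborel
    by (rule pair_sigma_finite.intro) (auto intro: \<mu>.sigma_finite_measure_axioms sigma_finite_lborel)
  show ?thesis
  proof (rule that[of "7 / ln 2 * I"])
    show "0 \<le> 7 / ln 2 * I" using I0 by simp
    fix v
    let ?T = "\<lambda>X u. ennreal (last_passage (\<lambda>z. indicator {u<..} (X z)) 0 v) * indicator {0..} (u :: real)"
    have lp: "(\<lambda>\<omega>. last_passage (\<lambda>z. indicator {snd \<omega><..} (fst \<omega> z)) 0 v) \<in> borel_measurable (weight_space \<Otimes>\<^sub>M lborel)"
    proof (rule borel_measurable_last_passage)
      fix z
      have [measurable]: "(\<lambda>\<omega>. fst \<omega> z) \<in> borel_measurable (weight_space \<Otimes>\<^sub>M lborel)"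
        by (rule measurable_compose[OF measurable_fst coordinate_measurable])
      have "(\<lambda>\<omega>. if snd \<omega> < fst \<omega> z then 1 else 0 :: real) \<in> borel_measurable (weight_space \<Otimes>\<^sub>M lborel)"
        by measurable
      then show "(\<lambda>\<omega>. indicator {snd \<omega><..} (fst \<omega> z) :: real) \<in> borel_measurable (weight_space \<Otimes>\<^sub>M lborel)"
        by (simp add: indicator_def of_bool_def)
    qed
    have meas: "(\<lambda>(X, u). ?T X u) \<in> borel_measurable (\<mu> \<Otimes>\<^sub>M lborel)"
    proof -
      have "(\<lambda>\<omega>. ?T (fst \<omega>) (snd \<omega>)) \<in> borel_measurable (weight_space \<Otimes>\<^sub>M lborel)"
        using lp by measurable
      then show ?thesis
        by (simp add: case_prod_unfold cong: measurable_cong_sets sets_pair_measure_cong)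
    qed
    have "(\<integral>\<^sup>+X. ennreal (last_passage X 0 v) \<partial>\<mu>) \<le> (\<integral>\<^sup>+X. \<integral>\<^sup>+u. ?T X u \<partial>lborel \<partial>\<mu>)"
      by (intro nn_integral_mono last_passage_layer_cake)
    also have "\<dots> = (\<integral>\<^sup>+u. \<integral>\<^sup>+X. ?T X u \<partial>\<mu> \<partial>lborel)"
      by (rule Fubini'[OF meas, symmetric])
    also have "\<dots> \<le> (\<integral>\<^sup>+u. ennreal (7 / ln 2 * (real (fst v) + real (snd v) + 2)) * (ennreal (level u) * indicator {0..} u) \<partial>lborel)"
      using expectation_level_le[of _ v] by (intro nn_integral_mono) (auto simp: indicator_def)
    also have "\<dots> = ennreal (7 / ln 2 * (real (fst v) + real (snd v) + 2)) * ennreal I"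
      unfolding I[symmetric] by (rule nn_integral_cmult) measurable
    also have "\<dots> = ennreal (7 / ln 2 * I * (real (fst v) + real (snd v) + 2))"
      using I0 by (simp add: ennreal_mult[symmetric] mult_ac)
    finally show "(\<integral>\<^sup>+X. ennreal (last_passage X 0 v) \<partial>\<mu>) \<le> ennreal (7 / ln 2 * I * (real (fst v) + real (snd v) + 2))" .
  qed
qed

end

section \<open>Limits along rays\<close>

context prob_space
begin

lemma conv_L1_AE_cong:
  assumes x: "conv_L1 x f" and fg: "AE \<omega> in M. f \<omega> = g \<omega>" and [measurable]: "g \<in> borel_measurable M"
  shows "conv_L1 x g"
proof -
  note [simp] = conv_L1D(1,2)[OF x]
  have [measurable]: "f \<in> borel_measurable M" "x n \<in> borel_measurable M" for n
    by (rule borel_measurable_integrable[OF conv_L1D(2)[OF x]], rule borel_measurable_integrable[OF conv_L1D(1)[OF x]])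
  have "integrable M g" using integrable_cong_AE[of f M g] fg by simp
  moreover have "AE \<omega> in M. (\<lambda>n. x n \<omega>) \<longlonglongrightarrow> g \<omega>"
    using conv_L1D(3)[OF x] fg by eventually_elim simp
  moreover have "(\<integral>\<omega>. \<bar>x n \<omega> - g \<omega>\<bar> \<partial>M) = (\<integral>\<omega>. \<bar>x n \<omega> - f \<omega>\<bar> \<partial>M)" for n
    using fg by (intro integral_cong_AE) (auto elim: eventually_mono)
  ultimately show ?thesis using conv_L1D[OF x] by (simp add: conv_L1_def)
qed

text \<open>If \<open>l \<le> x \<le> u\<close>, the distance of \<open>x\<close> from
  \<open>f\<close> is at most the sum of the distances of \<open>l\<close> and \<open>u\<close> from
  \<open>f\<close>.\<close>

lemma conv_L1_sandwich:
  assumes lo: "conv_L1 l f" and up: "conv_L1 u f" and int: "\<And>n. integrable M (x n)"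
    and le: "eventually (\<lambda>n. \<forall>\<omega>\<in>space M. l n \<omega> \<le> x n \<omega> \<and> x n \<omega> \<le> u n \<omega>) sequentially"
  shows "conv_L1 x f"
proof -
  note [simp] = conv_L1D(1,2)[OF lo] conv_L1D(1)[OF up] int
  obtain N where N: "\<And>n \<omega>. n \<ge> N \<Longrightarrow> \<omega> \<in> space M \<Longrightarrow> l n \<omega> \<le> x n \<omega> \<and> x n \<omega> \<le> u n \<omega>"
    using le by (auto simp: eventually_sequentially)
  have "AE \<omega> in M. \<omega> \<in> space M" by simp
  with conv_L1D(3)[OF lo] conv_L1D(3)[OF up] have "AE \<omega> in M. (\<lambda>n. x n \<omega>) \<longlonglongrightarrow> f \<omega>"
  proof eventually_elim
    case (elim \<omega>)
    show ?case
    proof (rule tendsto_sandwich[OF _ _ elim(1,2)])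
      show "\<forall>\<^sub>F n in sequentially. l n \<omega> \<le> x n \<omega>" "\<forall>\<^sub>F n in sequentially. x n \<omega> \<le> u n \<omega>"
        using N elim(3) by (auto simp: eventually_sequentially)
    qed
  qed
  moreover have "(\<lambda>n. \<integral>\<omega>. \<bar>x n \<omega> - f \<omega>\<bar> \<partial>M) \<longlonglongrightarrow> 0"
  proof (rule tendsto_sandwich[OF _ _ tendsto_const])
    show "(\<lambda>n. (\<integral>\<omega>. \<bar>l n \<omega> - f \<omega>\<bar> \<partial>M) + (\<integral>\<omega>. \<bar>u n \<omega> - f \<omega>\<bar> \<partial>M)) \<longlonglongrightarrow> 0"
      using tendsto_add[OF conv_L1D(4)[OF lo] conv_L1D(4)[OF up]] by simp
    show "\<forall>\<^sub>F n in sequentially. (\<integral>\<omega>. \<bar>x n \<omega> - f \<omega>\<bar> \<partial>M) \<le>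
        (\<integral>\<omega>. \<bar>l n \<omega> - f \<omega>\<bar> \<partial>M) + (\<integral>\<omega>. \<bar>u n \<omega> - f \<omega>\<bar> \<partial>M)"
      using eventually_ge_at_top[of N]
    proof eventually_elim
      case (elim n)
      have "(\<integral>\<omega>. \<bar>x n \<omega> - f \<omega>\<bar> \<partial>M) \<le> (\<integral>\<omega>. \<bar>l n \<omega> - f \<omega>\<bar> + \<bar>u n \<omega> - f \<omega>\<bar> \<partial>M)"
      proof (rule integral_mono)
        fix \<omega> assume "\<omega> \<in> space M"
        from N[OF elim this] show "\<bar>x n \<omega> - f \<omega>\<bar> \<le> \<bar>l n \<omega> - f \<omega>\<bar> + \<bar>u n \<omega> - f \<omega>\<bar>" by linarith
      qed auto
      then show ?case by (subst (asm) Bochner_Integration.integral_add) auto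
    qed
  qed simp
  ultimately show ?thesis by (simp add: conv_L1_def)
qed

text \<open>\<open>ennreal\<close> sends negative values to 0, so the hypothesis bounds the integral
  of the positive part.\<close>

lemma integral_le_of_nn_integral_le:
  assumes "integrable M f" "(\<integral>\<^sup>+\<omega>. ennreal (f \<omega>) \<partial>M) \<le> ennreal c" "0 \<le> c"
  shows "(\<integral>\<omega>. f \<omega> \<partial>M) \<le> (c :: real)"
proof -
  have "(\<integral>\<omega>. f \<omega> \<partial>M) \<le> (\<integral>\<omega>. max 0 (f \<omega>) \<partial>M)"
    using assms(1) by (intro integral_mono) auto
  moreover have "ennreal (\<integral>\<omega>. max 0 (f \<omega>) \<partial>M) = (\<integral>\<^sup>+\<omega>. ennreal (max 0 (f \<omega>)) \<partial>M)"
    using assms(1) by (intro nn_integral_eq_integral[symmetric]) auto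
  moreover have "\<dots> = (\<integral>\<^sup>+\<omega>. ennreal (f \<omega>) \<partial>M)"
    by (intro nn_integral_cong) (simp add: max_def ennreal_neg)
  ultimately have "ennreal (\<integral>\<omega>. max 0 (f \<omega>) \<partial>M) \<le> ennreal c" using assms(2) by simp
  then have "(\<integral>\<omega>. max 0 (f \<omega>) \<partial>M) \<le> c" by (simp only: ennreal_le_iff[OF assms(3)])
  with \<open>(\<integral>\<omega>. f \<omega> \<partial>M) \<le> (\<integral>\<omega>. max 0 (f \<omega>) \<partial>M)\<close> show ?thesis by linarith
qed

end

section \<open>The uniform phase, its rotation, and the ray shift\<close>

abbreviation phase :: "real measure" where "phase \<equiv> restrict_space lborel {0..<1}"

lemma space_phase [simp]: "space phase = {0..<1}"
  by (simp add: space_restrict_space)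

lemma prob_space_phase: "prob_space phase"
  by (rule prob_spaceI) (simp add: emeasure_restrict_space)

lemma frac_measurable [measurable]: "(frac :: real \<Rightarrow> real) \<in> borel_measurable borel"
  unfolding frac_def[abs_def] by measurable

lemma rotation_measurable [measurable]: "(\<lambda>t. frac (t + a)) \<in> phase \<rightarrow>\<^sub>M phase"
proof (rule measurable_restrict_space2)
  show "(\<lambda>t. frac (t + a)) \<in> phase \<rightarrow>\<^sub>M lborel"
    by (rule measurable_restrict_space1) measurable
qed (auto simp: frac_ge_0 frac_lt_1)

lemma emeasure_lborel_translate:
  fixes B :: "real set"
  assumes "B \<in> sets borel"
  shows "emeasure lborel ((\<lambda>t. t + c) -` B) = emeasure lborel B"
proof -
  have "emeasure lborel B = emeasure (distr lborel borel (\<lambda>t. c + t)) B" by (simp add: lborel_distr_plus)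
  also have "\<dots> = emeasure lborel ((\<lambda>t. c + t) -` B)"
    using assms by (subst emeasure_distr) auto
  finally show ?thesis by (simp add: add.commute)
qed

lemma distr_phase_rotation: "distr phase phase (\<lambda>t. frac (t + a)) = phase"
proof (rule measure_eqI)
  fix A assume "A \<in> sets (distr phase phase (\<lambda>t. frac (t + a)))"
  then have A': "A \<in> sets phase" by simp
  then have A: "A \<in> sets borel" "A \<subseteq> {0..<1}" by (auto simp: sets_restrict_space_iff)
  define b where "b = frac a"
  have b: "0 \<le> b" "b < 1" by (auto simp: b_def frac_lt_1)
  have fr: "frac (t + a) = (if t + b < 1 then t + b else t + (b - 1))" if "t \<in> {0..<1}" for t
  proof -
    have "t + a = (t + b) + of_int \<lfloor>a\<rfloor>" by (simp add: b_def frac_def)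
    then have "frac (t + a) = frac ((t + b) + of_int \<lfloor>a\<rfloor>)" by (simp only:)
    also have "\<dots> = frac (t + b)" by (simp add: frac_def)
    also have "\<dots> = (if t + b < 1 then t + b else t + (b - 1))"
      using that b by (auto simp: frac_unique_iff)
    finally show ?thesis .
  qed
  \<comment> \<open>The rotation moves [0, 1 - b) onto [b, 1) and [1 - b, 1) onto [0, b), and it is
    a translation on each of the two pieces.\<close>
  let ?B = "A \<inter> {b..<1}" and ?C = "A \<inter> {0..<b}"
  have BC: "?B \<in> sets borel" "?C \<in> sets borel" using A by auto
  have pre: "(\<lambda>t. frac (t + a)) -` A \<inter> space phase = ((\<lambda>t. t + b) -` ?B) \<union> ((\<lambda>t. t + (b - 1)) -` ?C)"
    using A(2) b fr by (auto split: if_splits)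
  have m: "(\<lambda>t. t + c) -` D \<in> sets borel" if "D \<in> sets borel" for c :: real and D
  proof -
    have "(\<lambda>t. t + c) \<in> borel_measurable borel" by measurable
    from measurable_sets[OF this that] show ?thesis by simp
  qed
  have "emeasure (distr phase phase (\<lambda>t. frac (t + a))) A = emeasure phase ((\<lambda>t. frac (t + a)) -` A \<inter> space phase)"
    using A' by (subst emeasure_distr) auto
  also have "\<dots> = emeasure lborel ((\<lambda>t. frac (t + a)) -` A \<inter> space phase)"
    by (rule emeasure_restrict_space) auto
  also have "\<dots> = emeasure lborel ((\<lambda>t. t + b) -` ?B) + emeasure lborel ((\<lambda>t. t + (b - 1)) -` ?C)"
    unfolding pre using m[OF BC(1)] m[OF BC(2)] by (intro plus_emeasure[symmetric]) auto
  also have "\<dots> = emeasure lborel ?B + emeasure lborel ?C"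
    using BC by (simp only: emeasure_lborel_translate)
  also have "\<dots> = emeasure lborel (?B \<union> ?C)" using BC by (intro plus_emeasure) auto
  also have "?B \<union> ?C = A" using A(2) b by auto
  also have "emeasure lborel A = emeasure phase A" using A by (simp add: emeasure_restrict_space)
  finally show "emeasure (distr phase phase (\<lambda>t. frac (t + a))) A = emeasure phase A" .
qed simp

text \<open>Convergence is the vanishing of the limsup of the distances, and that limsup is a
  measurable function.\<close>

lemma pred_LIMSEQ:
  fixes x :: "nat \<Rightarrow> 'a \<Rightarrow> real"
  assumes [measurable]: "\<And>n. x n \<in> borel_measurable M" "h \<in> borel_measurable M"
  shows "Measurable.pred M (\<lambda>X. (\<lambda>n. x n X) \<longlonglongrightarrow> h X)"
proof -
  have "(\<lambda>n. x n X) \<longlonglongrightarrow> h X \<longleftrightarrow> limsup (\<lambda>n. ennreal \<bar>x n X - h X\<bar>) = 0" for X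
  proof
    assume "(\<lambda>n. x n X) \<longlonglongrightarrow> h X"
    then have "(\<lambda>n. ennreal \<bar>x n X - h X\<bar>) \<longlonglongrightarrow> ennreal 0"
      by (rule tendsto_ennrealI[OF tendsto_rabs_zero[OF LIM_zero]])
    from lim_imp_Limsup[OF _ this] show "limsup (\<lambda>n. ennreal \<bar>x n X - h X\<bar>) = 0" by simp
  next
    assume "limsup (\<lambda>n. ennreal \<bar>x n X - h X\<bar>) = 0"
    then have "(\<lambda>n. ennreal \<bar>x n X - h X\<bar>) \<longlonglongrightarrow> ennreal 0"
      by (simp add: tendsto_0_if_Limsup_eq_0_ennreal)
    then have "(\<lambda>n. \<bar>x n X - h X\<bar>) \<longlonglongrightarrow> 0" by (subst (asm) tendsto_ennreal_iff) auto
    then show "(\<lambda>n. x n X) \<longlonglongrightarrow> h X" by (rule LIM_zero_cancel[OF tendsto_rabs_zero_cancel])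
  qed
  moreover have "Measurable.pred M (\<lambda>X. limsup (\<lambda>n. ennreal \<bar>x n X - h X\<bar>) = 0)"
    by measurable
  ultimately show ?thesis by simp
qed

definition ray :: "real \<Rightarrow> real \<Rightarrow> nat \<Rightarrow> nat \<times> nat" where
  "ray \<alpha> t n = (nat \<lfloor>t + real n * \<alpha>\<rfloor>, n)"

text \<open>A skew product: the new phase retains the fractional part lost in rounding, so that
  \<open>n\<close> iterations translate the weights by exactly \<open>ray \<alpha> t n\<close>, with
  no accumulated rounding error.\<close>

definition ray_shift :: "real \<Rightarrow> (nat \<times> nat \<Rightarrow> real) \<times> real \<Rightarrow> (nat \<times> nat \<Rightarrow> real) \<times> real" where
  "ray_shift \<alpha> = (\<lambda>(X, t). (translate (nat \<lfloor>t + \<alpha>\<rfloor>, 1) X, frac (t + \<alpha>)))"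

lemma floor_frac_add: "\<lfloor>frac t + s\<rfloor> = \<lfloor>t + s\<rfloor> - \<lfloor>t\<rfloor>"
proof -
  have "frac t + s = (t + s) - of_int \<lfloor>t\<rfloor>" by (simp add: frac_def)
  then show ?thesis by (simp only: floor_diff_of_int)
qed

lemma frac_frac_add: "frac (frac t + s) = frac (t + s)" for t s :: real
  unfolding frac_def[of "frac t + s"] floor_frac_add frac_def[of "t + s"] by (simp add: frac_def)

lemma ray_shift_funpow:
  assumes "0 \<le> \<alpha>" "t \<in> {0..<1}"
  shows "(ray_shift \<alpha> ^^ n) (X, t) = (translate (ray \<alpha> t n) X, frac (t + real n * \<alpha>))"
proof (induction n)
  case 0
  show ?case using assms(2) floor_unique[of 0 t] by (simp add: translate_def ray_def frac_eq zero_prod_def[symmetric])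
next
  case (Suc n)
  let ?s = "t + real n * \<alpha>"
  have s: "0 \<le> ?s" using assms by simp
  have e: "?s + \<alpha> = t + real (Suc n) * \<alpha>" by (simp add: algebra_simps)
  have "(nat \<lfloor>frac ?s + \<alpha>\<rfloor>, 1) + ray \<alpha> t n = ray \<alpha> t (Suc n)"
  proof -
    have "0 \<le> \<lfloor>?s\<rfloor>" "\<lfloor>?s\<rfloor> \<le> \<lfloor>?s + \<alpha>\<rfloor>" using s assms by (auto intro: floor_mono)
    then have "nat \<lfloor>frac ?s + \<alpha>\<rfloor> + nat \<lfloor>?s\<rfloor> = nat \<lfloor>?s + \<alpha>\<rfloor>"
      unfolding floor_frac_add by (simp add: nat_add_distrib[symmetric])
    then show ?thesis unfolding e by (simp add: ray_def)
  qed
  then show ?case using Suc by (simp add: ray_shift_def translate_translate frac_frac_add e[symmetric] add.assoc del: of_nat_Suc)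
qed

context stationary_weights
begin

sublocale U: prob_space phase by (rule prob_space_phase)

abbreviation "\<mu>U \<equiv> \<mu> \<Otimes>\<^sub>M phase"

sublocale \<mu>U: pair_prob_space \<mu> phase ..

lemma space_\<mu>U: "space \<mu>U = UNIV \<times> {0..<1}"
  by (simp add: space_pair_measure)

lemma distr_\<mu>U_fst: "distr \<mu>U \<mu> fst = \<mu>"
  by (rule U.distr_pair_fst)

lemma ray_shift_measurable [measurable]: "ray_shift \<alpha> \<in> \<mu>U \<rightarrow>\<^sub>M \<mu>U"
proof -
  have t [measurable]: "snd \<in> \<mu>U \<rightarrow>\<^sub>M phase" "fst \<in> \<mu>U \<rightarrow>\<^sub>M weight_space"
    by (auto intro: measurable_snd) (use measurable_fst[of \<mu> phase] in \<open>simp cong: measurable_cong_sets\<close>)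
  have "(\<lambda>t. nat \<lfloor>t + \<alpha>\<rfloor>) \<in> phase \<rightarrow>\<^sub>M count_space UNIV"
    by (rule measurable_restrict_space1) measurable
  from measurable_compose[OF t(1) this]
  have "(\<lambda>\<omega>. nat \<lfloor>snd \<omega> + \<alpha>\<rfloor>) \<in> \<mu>U \<rightarrow>\<^sub>M count_space UNIV" .
  then have "(\<lambda>\<omega>. translate (nat \<lfloor>snd \<omega> + \<alpha>\<rfloor>, 1) (fst \<omega>)) \<in> \<mu>U \<rightarrow>\<^sub>M weight_space"
    by (rule measurable_compose_countable[rotated]) measurable
  then have "(\<lambda>\<omega>. translate (nat \<lfloor>snd \<omega> + \<alpha>\<rfloor>, 1) (fst \<omega>)) \<in> \<mu>U \<rightarrow>\<^sub>M \<mu>"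
    by (simp cong: measurable_cong_sets)
  moreover have "(\<lambda>\<omega>. frac (snd \<omega> + \<alpha>)) \<in> \<mu>U \<rightarrow>\<^sub>M phase" by measurable
  ultimately show ?thesis unfolding ray_shift_def case_prod_unfold by (rule measurable_Pair)
qed

text \<open>For a fixed phase the first component is a translation, which preserves
  \<open>\<mu>\<close>; what remains is the rotation of the phase, which preserves Lebesgue measure
  on [0, 1).\<close>

lemma distr_ray_shift: "distr \<mu>U \<mu>U (ray_shift \<alpha>) = \<mu>U"
proof (rule measure_eqI)
  fix A assume "A \<in> sets (distr \<mu>U \<mu>U (ray_shift \<alpha>))"
  then have A [measurable]: "A \<in> sets \<mu>U" by simp
  define h where "h t = emeasure \<mu> ((\<lambda>X. (X, t)) -` A)" for t
  have h [measurable]: "h \<in> borel_measurable phase"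
    unfolding h_def by (rule \<mu>U.measurable_emeasure_Pair2[OF A])
  have "emeasure (distr \<mu>U \<mu>U (ray_shift \<alpha>)) A = emeasure \<mu>U (ray_shift \<alpha> -` A \<inter> space \<mu>U)"
    by (rule emeasure_distr) measurable
  also have "\<dots> = (\<integral>\<^sup>+t. emeasure \<mu> ((\<lambda>X. (X, t)) -` (ray_shift \<alpha> -` A \<inter> space \<mu>U)) \<partial>phase)"
    by (rule \<mu>U.emeasure_pair_measure_alt2) measurable
  also have "\<dots> = (\<integral>\<^sup>+t. h (frac (t + \<alpha>)) \<partial>phase)"
  proof (rule nn_integral_cong)
    fix t assume t: "t \<in> space phase"
    let ?s = "(nat \<lfloor>t + \<alpha>\<rfloor>, 1)"
    have "frac (t + \<alpha>) \<in> space phase" by (simp add: frac_lt_1)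
    then have "(\<lambda>X. (X, frac (t + \<alpha>))) -` A \<in> sets \<mu>"
      using sets_Pair2[OF A, of "frac (t + \<alpha>)"] by simp
    then have *: "(\<lambda>X. (X, frac (t + \<alpha>))) -` A \<in> sets weight_space" by simp
    have "(\<lambda>X. (X, t)) -` (ray_shift \<alpha> -` A \<inter> space \<mu>U) = translate ?s -` ((\<lambda>X. (X, frac (t + \<alpha>))) -` A) \<inter> space \<mu>"
      using t by (auto simp: ray_shift_def space_\<mu>U)
    also have "emeasure \<mu> \<dots> = emeasure (distr \<mu> weight_space (translate ?s)) ((\<lambda>X. (X, frac (t + \<alpha>))) -` A)"
      using * by (intro emeasure_distr[symmetric]) auto
    finally show "emeasure \<mu> ((\<lambda>X. (X, t)) -` (ray_shift \<alpha> -` A \<inter> space \<mu>U)) = h (frac (t + \<alpha>))"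
      by (simp only: distr_\<mu>_translate h_def)
  qed
  also have "\<dots> = (\<integral>\<^sup>+t. h t \<partial>distr phase phase (\<lambda>t. frac (t + \<alpha>)))"
    by (rule nn_integral_distr[symmetric]) measurable
  also have "\<dots> = emeasure \<mu>U A"
    unfolding distr_phase_rotation h_def by (rule \<mu>U.emeasure_pair_measure_alt2[OF A, symmetric])
  finally show "emeasure (distr \<mu>U \<mu>U (ray_shift \<alpha>)) A = emeasure \<mu>U A" .
qed simp

lemma mpt_ray_shift: "mpt \<mu>U (ray_shift \<alpha>)"
  by unfold_locales (auto simp: distr_ray_shift)

lemma conv_L1_fst_iff:
  assumes [measurable]: "\<And>n. x n \<in> borel_measurable weight_space" "h \<in> borel_measurable weight_space"
  shows "\<mu>U.conv_L1 (\<lambda>n \<omega>. x n (fst \<omega>)) (\<lambda>\<omega>. h (fst \<omega>)) \<longleftrightarrow> \<mu>.conv_L1 x h"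
proof -
  have f: "fst \<in> \<mu>U \<rightarrow>\<^sub>M \<mu>" by (rule measurable_fst)
  have 1: "integrable \<mu>U (\<lambda>\<omega>. g (fst \<omega>)) \<longleftrightarrow> integrable \<mu> g" if "g \<in> borel_measurable weight_space" for g :: "_ \<Rightarrow> real"
    using integrable_distr_eq[OF f, of g] that by (simp add: distr_\<mu>U_fst)
  have 2: "(\<integral>\<omega>. g (fst \<omega>) \<partial>\<mu>U) = (\<integral>X. g X \<partial>\<mu>)" if "g \<in> borel_measurable weight_space" for g :: "_ \<Rightarrow> real"
    using integral_distr[OF f, of g] that by (simp add: distr_\<mu>U_fst)
  have "{X \<in> space \<mu>. (\<lambda>n. x n X) \<longlonglongrightarrow> h X} \<in> sets \<mu>"
    unfolding sets_\<mu> using pred_LIMSEQ[OF assms] by (simp add: pred_def)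
  from AE_distr_iff[OF f this]
  have 3: "(AE \<omega> in \<mu>U. (\<lambda>n. x n (fst \<omega>)) \<longlonglongrightarrow> h (fst \<omega>)) \<longleftrightarrow> (AE X in \<mu>. (\<lambda>n. x n X) \<longlonglongrightarrow> h X)"
    unfolding distr_\<mu>U_fst by simp
  have 4: "(\<integral>\<omega>. \<bar>x n (fst \<omega>) - h (fst \<omega>)\<bar> \<partial>\<mu>U) = (\<integral>X. \<bar>x n X - h X\<bar> \<partial>\<mu>)" for n
    by (rule 2) measurable
  show ?thesis unfolding \<mu>U.conv_L1_def \<mu>.conv_L1_def by (simp add: 1 3 4)
qed

text \<open>The terms do not involve the phase, so neither does the limit, up to a null set.\<close>

lemma conv_L1_fst_limit:
  assumes [measurable]: "\<And>n. x n \<in> borel_measurable weight_space"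
    and conv: "\<mu>U.conv_L1 (\<lambda>n \<omega>. x n (fst \<omega>)) g"
  obtains h where "h \<in> borel_measurable weight_space" "\<mu>.conv_L1 x h" "AE \<omega> in \<mu>U. g \<omega> = h (fst \<omega>)"
proof -
  define h where "h X = lim (\<lambda>n. x n X)" for X
  have h [measurable]: "h \<in> borel_measurable weight_space" unfolding h_def by measurable
  have ae: "AE \<omega> in \<mu>U. g \<omega> = h (fst \<omega>)"
    using \<mu>U.conv_L1D(3)[OF conv] by eventually_elim (simp add: h_def limI)
  have "(\<lambda>\<omega>. h (fst \<omega>)) \<in> borel_measurable \<mu>U"
    by (rule measurable_compose[OF measurable_fst]) simp
  from \<mu>U.conv_L1_AE_cong[OF conv ae this] have "\<mu>.conv_L1 x h" by (subst (asm) conv_L1_fst_iff) auto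
  from that[OF h this ae] show ?thesis .
qed

end

section \<open>Lattice points at bounded distance from a ray\<close>

lemma ratio_tendsto:
  fixes k :: "nat \<Rightarrow> nat"
  assumes y: "0 < y" and k: "\<And>n. \<bar>real (k n) - real n * y\<bar> \<le> c"
  shows "(\<lambda>n. real (k n) / real n) \<longlonglongrightarrow> y" and "filterlim k sequentially sequentially"
proof -
  have "(\<lambda>n. real (k n) / real n - y) \<longlonglongrightarrow> 0"
  proof (rule Lim_null_comparison)
    show "\<forall>\<^sub>F n in sequentially. norm (real (k n) / real n - y) \<le> c * (1 / real n)"
      using eventually_gt_at_top[of 0]
    proof eventually_elim
      case (elim n)
      then have "real (k n) / real n - y = (real (k n) - real n * y) / real n" by (simp add: field_simps)
      then show ?case using k[of n] elim by (simp add: divide_right_mono)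
    qed
    show "(\<lambda>n. c * (1 / real n)) \<longlonglongrightarrow> 0" using tendsto_mult[OF tendsto_const lim_1_over_n] by simp
  qed
  then show "(\<lambda>n. real (k n) / real n) \<longlonglongrightarrow> y" by (rule LIM_zero_cancel)
  show "filterlim k sequentially sequentially"
    unfolding filterlim_at_top
  proof
    fix Z
    obtain N :: nat where N: "(real Z + c) / y < real N" using reals_Archimedean2 by blast
    show "\<forall>\<^sub>F n in sequentially. Z \<le> k n"
      using eventually_ge_at_top[of N]
    proof eventually_elim
      case (elim n)
      have "real Z + c < real N * y" using N y by (simp add: divide_less_eq)
      also have "\<dots> \<le> real n * y" using elim y by (intro mult_right_mono) auto
      finally have "real Z \<le> real (k n)" using k[of n] by linarith
      then show ?case by simp
    qed
  qed
qed

lemma nat_floor_bounds: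
  assumes "0 \<le> a"
  shows "real (nat \<lfloor>a\<rfloor>) \<le> a" "a < real (nat \<lfloor>a\<rfloor>) + 1"
proof -
  have "real (nat \<lfloor>a\<rfloor>) = of_int \<lfloor>a\<rfloor>" using assms by simp
  then show "real (nat \<lfloor>a\<rfloor>) \<le> a" "a < real (nat \<lfloor>a\<rfloor>) + 1" by linarith+
qed

lemma nat_floor_diff_le:
  assumes "0 \<le> a" "a \<le> b" "b - a + 1 \<le> real D"
  shows "nat \<lfloor>a\<rfloor> \<le> nat \<lfloor>b\<rfloor>" "nat \<lfloor>b\<rfloor> - nat \<lfloor>a\<rfloor> \<le> D"
proof -
  show "nat \<lfloor>a\<rfloor> \<le> nat \<lfloor>b\<rfloor>" using assms by (intro nat_mono floor_mono)
  have "\<lfloor>b\<rfloor> - \<lfloor>a\<rfloor> \<le> int D" using assms by linarith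
  then show "nat \<lfloor>b\<rfloor> - nat \<lfloor>a\<rfloor> \<le> D" using assms by (simp add: nat_diff_distrib')
qed

definition point :: "real \<Rightarrow> real \<Rightarrow> nat \<Rightarrow> nat \<times> nat" where
  "point x y n = (nat \<lfloor>real n * x\<rfloor>, nat \<lfloor>real n * y\<rfloor>)"

text \<open>A short passage from \<open>w\<close> can have either sign, so it is charged by absolute
  values over a whole square with corner \<open>w\<close>. This bounds every passage time from
  \<open>w\<close> inside the square, and its law under \<open>\<mu>\<close> is the same for all
  \<open>w\<close>.\<close>

definition gap :: "nat \<Rightarrow> (nat \<times> nat \<Rightarrow> real) \<Rightarrow> nat \<times> nat \<Rightarrow> real" where
  "gap D X w = (\<Sum>z\<in>box (D, D). \<bar>X (z + w)\<bar>)"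

lemma gap_nonneg: "0 \<le> gap D X w"
  unfolding gap_def by (intro sum_nonneg) auto

lemma gap_translate: "gap D (translate s X) w = gap D X (w + s)"
  by (simp add: gap_def translate_def add.assoc)

lemma gap_measurable [measurable]: "(\<lambda>X. gap D X w) \<in> borel_measurable weight_space"
  unfolding gap_def by (intro borel_measurable_sum borel_measurable_abs coordinate_measurable)

lemma abs_last_passage_le_gap:
  assumes "fst u \<le> fst v" "fst v - fst u \<le> D" "snd u \<le> snd v" "snd v - snd u \<le> D"
  shows "\<bar>last_passage X u v\<bar> \<le> gap D X u"
proof -
  have v: "v = u + (v - u)" using assms by (simp add: prod_eq_iff)
  have "\<bar>last_passage X u (u + (v - u))\<bar> \<le> (\<Sum>z\<in>box (v - u). \<bar>X (z + u)\<bar>)"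
    by (rule abs_last_passage_le_box)
  also have "\<dots> \<le> gap D X u"
    unfolding gap_def using assms by (intro sum_mono2) auto
  finally show ?thesis using v by simp
qed

lemma ray_coords: "fst (ray \<alpha> t j) = nat \<lfloor>t + real j * \<alpha>\<rfloor>" "snd (ray \<alpha> t j) = j"
  by (simp_all add: ray_def)

lemma last_passage_superadditive':
  assumes "fst u \<le> fst v" "snd u \<le> snd v" "fst v \<le> fst w" "snd v \<le> snd w"
  shows "last_passage X u v + last_passage X v w \<le> last_passage X u w"
proof -
  have "u + (v - u) = v" "v + (w - v) = w" using assms by (auto simp: prod_eq_iff)
  then show ?thesis using last_passage_superadditive[of X u "v - u" "w - v"] by simp
qed

lemma gap_shift_le:
  assumes "fst s \<le> 1" "snd s \<le> 1"
  shows "gap D X (w + s) \<le> gap (Suc D) X w"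
proof -
  have "gap D X (w + s) = (\<Sum>z\<in>(\<lambda>z. z + s) ` box (D, D). \<bar>X (z + w)\<bar>)"
    unfolding gap_def by (subst sum.reindex) (auto simp: inj_on_def ac_simps)
  also have "\<dots> \<le> gap (Suc D) X w"
    unfolding gap_def using assms by (intro sum_mono2) (auto simp: image_subset_iff mem_Times_iff)
  finally show ?thesis .
qed

locale lpp = moment_weights +
  assumes ergodic: "ergodic_env P"
    and integrable_joint: "\<And>z. integrable (joint_measure P) (\<lambda>(F, X). X z)"
begin

lemma snd_measurable_joint: "snd \<in> joint_measure P \<rightarrow>\<^sub>M weight_space"
  using sets_joint_measure[OF prob_P sets_P] measurable_snd[of env_space weight_space]
  by (simp cong: measurable_cong_sets)

lemma integrable_coordinate: "integrable \<mu> (\<lambda>X. X z)"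
proof -
  have "integrable (distr (joint_measure P) weight_space snd) (\<lambda>X. X z)"
    using integrable_joint[of z]
    by (subst integrable_distr_eq[OF snd_measurable_joint coordinate_measurable]) (simp add: case_prod_unfold)
  then show ?thesis by (simp add: joint_snd)
qed

lemma integrable_translate:
  assumes "integrable \<mu> f"
  shows "integrable \<mu> (\<lambda>X. f (translate s X) :: real)"
proof -
  have f: "f \<in> borel_measurable weight_space" using borel_measurable_integrable[OF assms] by simp
  have "translate s \<in> \<mu> \<rightarrow>\<^sub>M weight_space" by simp
  from integrable_distr_eq[OF this f] assms show ?thesis by (simp add: distr_\<mu>_translate)
qed

lemma integral_translate:
  assumes "f \<in> borel_measurable weight_space"
  shows "(\<integral>X. f (translate s X) \<partial>\<mu>) = (\<integral>X. f X \<partial>\<mu> :: real)"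
proof -
  have "translate s \<in> \<mu> \<rightarrow>\<^sub>M weight_space" by simp
  from integral_distr[OF this assms] show ?thesis by (simp add: distr_\<mu>_translate)
qed

lemma AE_translate:
  assumes "AE X in \<mu>. Q X"
  shows "AE X in \<mu>. Q (translate s X)"
proof -
  have "AE X in distr \<mu> weight_space (translate s). Q X" using assms by (simp only: distr_\<mu>_translate)
  then show ?thesis by (rule AE_distrD[rotated]) simp
qed

lemma integrable_gap: "integrable \<mu> (\<lambda>X. gap D X w)"
  unfolding gap_def by (intro Bochner_Integration.integrable_sum integrable_abs integrable_coordinate)

lemma integral_gap: "(\<integral>X. gap D X w \<partial>\<mu>) = (\<integral>X. gap D X 0 \<partial>\<mu>)"
proof -
  have "(\<integral>X. gap D (translate w X) 0 \<partial>\<mu>) = (\<integral>X. gap D X 0 \<partial>\<mu>)"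
    by (rule integral_translate) measurable
  then show ?thesis by (simp add: gap_translate)
qed

lemma integrable_last_passage:
  assumes "fst u \<le> fst v" "snd u \<le> snd v"
  shows "integrable \<mu> (\<lambda>X. last_passage X u v)"
proof (rule Bochner_Integration.integrable_bound[OF integrable_gap[of "fst v + snd v" u]])
  show "AE X in \<mu>. norm (last_passage X u v) \<le> norm (gap (fst v + snd v) X u)"
    using abs_last_passage_le_gap[of u v "fst v + snd v"] assms by (intro AE_I2) (simp add: gap_nonneg)
qed simp

text \<open>All gaps have the law of the integrable one at the origin, so their tails are dominated
  by it. The sites \<open>w n\<close> are arbitrary but deterministic; base points that move with
  the phase must be replaced before this applies.\<close>

lemma gap_conv: "\<mu>.conv_L1 (\<lambda>n X. gap D X (w n) / real n) (\<lambda>_. 0)"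
proof (rule \<mu>.conv_L1_I)
  show "integrable \<mu> (\<lambda>X. gap D X (w n) / real n)" for n
    using integrable_gap by auto
  show "AE X in \<mu>. (\<lambda>n. gap D X (w n) / real n) \<longlonglongrightarrow> 0"
  proof (rule \<mu>.AE_tail_dominated_div_tendsto_0)
    show "\<mu>.prob {X \<in> space \<mu>. t < \<bar>gap D X (w n)\<bar>} \<le> \<mu>.prob {X \<in> space \<mu>. t < \<bar>gap D X 0\<bar>}" for n t
    proof -
      have m: "translate (w n) \<in> \<mu> \<rightarrow>\<^sub>M weight_space" by simp
      have "{X. t < \<bar>gap D X 0\<bar>} = {X \<in> space weight_space. t < \<bar>gap D X 0\<bar>}" by simp
      also have "\<dots> \<in> sets weight_space" by measurable
      finally have A: "{X. t < \<bar>gap D X 0\<bar>} \<in> sets weight_space" .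
      have "\<mu>.prob {X. t < \<bar>gap D X 0\<bar>} = measure (distr \<mu> weight_space (translate (w n))) {X. t < \<bar>gap D X 0\<bar>}"
        by (simp only: distr_\<mu>_translate)
      also have "\<dots> = \<mu>.prob {X. t < \<bar>gap D X (w n)\<bar>}"
        by (subst measure_distr[OF m A]) (simp add: vimage_def gap_translate)
      finally show ?thesis by simp
    qed
  qed (use integrable_gap in auto)
  have "(\<integral>X. \<bar>gap D X (w n) / real n - 0\<bar> \<partial>\<mu>) = (\<integral>X. gap D X (w n) / real n \<partial>\<mu>)" for n
    by (intro Bochner_Integration.integral_cong refl) (simp add: gap_nonneg)
  then show "(\<integral>X. \<bar>gap D X (w n) / real n - 0\<bar> \<partial>\<mu>) \<le> (\<integral>X. gap D X 0 \<partial>\<mu>) * (1 / real n)" for n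
    using integral_gap[of D "w n"] by (simp add: abs_of_nonneg[OF gap_nonneg])
  show "(\<lambda>n. (\<integral>X. gap D X 0 \<partial>\<mu>) * (1 / real n)) \<longlonglongrightarrow> 0"
    using tendsto_mult[OF tendsto_const lim_1_over_n] by simp
qed simp

lemma integrable_fst:
  assumes "integrable \<mu> g"
  shows "integrable \<mu>U (\<lambda>\<omega>. g (fst \<omega>) :: real)"
proof -
  have g: "g \<in> borel_measurable \<mu>" using assms by (rule borel_measurable_integrable)
  show ?thesis
    using integrable_distr_eq[OF measurable_fst g, of phase] assms by (simp add: distr_\<mu>U_fst)
qed

text \<open>The end point takes countably many values, so joint measurability in weights and phase
  reduces to fixed end points.\<close>

lemma ray_last_passage_measurable [measurable]:
  "(\<lambda>\<omega>. last_passage (fst \<omega>) 0 (ray \<alpha> (snd \<omega>) n)) \<in> borel_measurable \<mu>U"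
proof -
  have "(\<lambda>t. nat \<lfloor>t + real n * \<alpha>\<rfloor>) \<in> phase \<rightarrow>\<^sub>M count_space UNIV"
    by (rule measurable_restrict_space1) measurable
  from measurable_compose[OF measurable_snd this]
  have k: "(\<lambda>\<omega>. nat \<lfloor>snd \<omega> + real n * \<alpha>\<rfloor>) \<in> \<mu>U \<rightarrow>\<^sub>M count_space UNIV" .
  have "(\<lambda>\<omega>. last_passage (fst \<omega>) 0 (k, n)) \<in> borel_measurable \<mu>U" for k
    by (rule measurable_compose[OF measurable_fst]) simp
  from measurable_compose_countable[OF this k] show ?thesis unfolding ray_def .
qed

lemma ray_integrable:
  assumes "0 \<le> \<alpha>"
  shows "integrable \<mu>U (\<lambda>\<omega>. last_passage (fst \<omega>) 0 (ray \<alpha> (snd \<omega>) n))"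
proof (rule Bochner_Integration.integrable_bound[OF integrable_fst[OF integrable_gap[of "nat \<lfloor>1 + real n * \<alpha>\<rfloor> + n" 0]]])
  have "\<bar>last_passage X 0 (ray \<alpha> t n)\<bar> \<le> gap (nat \<lfloor>1 + real n * \<alpha>\<rfloor> + n) X 0" if "t \<in> {0..<1}" for X t
  proof -
    have "nat \<lfloor>t + real n * \<alpha>\<rfloor> \<le> nat \<lfloor>1 + real n * \<alpha>\<rfloor>" using that by (intro nat_mono floor_mono) auto
    then show ?thesis by (intro abs_last_passage_le_gap) (auto simp: ray_def)
  qed
  then show "AE \<omega> in \<mu>U. norm (last_passage (fst \<omega>) 0 (ray \<alpha> (snd \<omega>) n)) \<le> norm (gap (nat \<lfloor>1 + real n * \<alpha>\<rfloor> + n) (fst \<omega>) 0)"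
    by (intro AE_I2) (auto simp: space_\<mu>U gap_nonneg)
qed simp

lemma ray_mean_bound:
  assumes \<alpha>: "0 \<le> \<alpha>"
  obtains C where "\<And>n. (\<integral>\<omega>. last_passage (fst \<omega>) 0 (ray \<alpha> (snd \<omega>) n) \<partial>\<mu>U) \<le> real n * C"
proof -
  obtain C where C: "0 \<le> C" "\<And>v. (\<integral>\<^sup>+X. ennreal (last_passage X 0 v) \<partial>\<mu>) \<le> ennreal (C * (real (fst v) + real (snd v) + 2))"
    by (rule expectation_last_passage_le, rule that)
  show ?thesis
  \<comment> \<open>For \<open>n \<ge> 1\<close> the rows give \<open>n\<close> and the remainder
    \<open>t + 2\<close> is at most \<open>3 * n\<close>, whence the 4. For \<open>n = 0\<close> the
    bound must be 0, and the ray is still at the origin.\<close>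
  proof (rule that[of "C * (\<alpha> + 4)"])
    fix n :: nat
    have bd: "(\<integral>\<^sup>+\<omega>. ennreal (last_passage (fst \<omega>) 0 (ray \<alpha> (snd \<omega>) n)) \<partial>\<mu>U) \<le> ennreal (real n * (C * (\<alpha> + 4)))"
    proof -
      have "(\<integral>\<^sup>+\<omega>. ennreal (last_passage (fst \<omega>) 0 (ray \<alpha> (snd \<omega>) n)) \<partial>\<mu>U) =
          (\<integral>\<^sup>+t. \<integral>\<^sup>+X. ennreal (last_passage X 0 (ray \<alpha> t n)) \<partial>\<mu> \<partial>phase)"
        by (subst \<mu>U.nn_integral_snd[symmetric]) (auto simp: case_prod_unfold)
      also have "\<dots> \<le> (\<integral>\<^sup>+t. ennreal (real n * (C * (\<alpha> + 4))) \<partial>phase)"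
      proof (rule nn_integral_mono)
        fix t assume "t \<in> space phase"
        then have t: "0 \<le> t" "t < 1" by auto
        show "(\<integral>\<^sup>+X. ennreal (last_passage X 0 (ray \<alpha> t n)) \<partial>\<mu>) \<le> ennreal (real n * (C * (\<alpha> + 4)))"
        proof (cases "n = 0")
          case True
          have "\<lfloor>t\<rfloor> = 0" using t by (simp add: floor_eq_iff)
          then have "ray \<alpha> t n = 0" using True by (simp add: ray_def zero_prod_def)
          then show ?thesis by simp
        next
          case False
          have "real (nat \<lfloor>t + real n * \<alpha>\<rfloor>) \<le> t + real n * \<alpha>" using t \<alpha> by simp
          then have "real (fst (ray \<alpha> t n)) + real (snd (ray \<alpha> t n)) + 2 \<le> real n * (\<alpha> + 4)"
            using t False by (simp add: ray_def algebra_simps)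
          then have "C * (real (fst (ray \<alpha> t n)) + real (snd (ray \<alpha> t n)) + 2) \<le> C * (real n * (\<alpha> + 4))"
            using C(1) by (rule mult_left_mono)
          then show ?thesis using C(2)[of "ray \<alpha> t n"] by (auto intro: order_trans ennreal_leI simp: mult_ac)
        qed
      qed
      also have "\<dots> = ennreal (real n * (C * (\<alpha> + 4)))" using U.emeasure_space_1 by simp
      finally show ?thesis .
    qed
    show "(\<integral>\<omega>. last_passage (fst \<omega>) 0 (ray \<alpha> (snd \<omega>) n) \<partial>\<mu>U) \<le> real n * (C * (\<alpha> + 4))"
      by (rule \<mu>U.integral_le_of_nn_integral_le[OF ray_integrable[OF \<alpha>] bd]) (use C \<alpha> in auto)
  qed
qed

lemma ray_conv:
  assumes \<alpha>: "0 \<le> \<alpha>"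
  shows "\<exists>f. \<mu>U.conv_L1 (\<lambda>n \<omega>. last_passage (fst \<omega>) 0 (ray \<alpha> (snd \<omega>) n) / real n) f"
proof -
  interpret ray: mpt \<mu>U "ray_shift \<alpha>" by (rule mpt_ray_shift)
  obtain C where C: "\<And>n. (\<integral>\<omega>. last_passage (fst \<omega>) 0 (ray \<alpha> (snd \<omega>) n) \<partial>\<mu>U) \<le> real n * C"
    using ray_mean_bound[OF \<alpha>] by blast
  show ?thesis
  proof (rule ray.kingman[OF ray_integrable[OF \<alpha>] _ _ C])
    fix \<omega> assume "\<omega> \<in> space \<mu>U"
    then obtain X t where \<omega>: "\<omega> = (X, t)" and t: "t \<in> {0..<1}" by (auto simp: space_\<mu>U)
    have "\<lfloor>t\<rfloor> = 0" using t by (simp add: floor_eq_iff)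
    then show "last_passage (fst \<omega>) 0 (ray \<alpha> (snd \<omega>) 0) = 0"
      by (simp add: \<omega> ray_def zero_prod_def[symmetric])
    fix m n
    let ?s = "t + real m * \<alpha>"
    have 0: "0 \<le> ?s" using t \<alpha> by simp
    \<comment> \<open>The exact cocycle identity, with the rotated phase \<open>frac ?s\<close>: it
      turns superadditivity of passage times into superadditivity over
      \<open>ray_shift\<close>.\<close>
    have sum: "ray \<alpha> (frac ?s) n + ray \<alpha> t m = ray \<alpha> t (m + n)"
    proof -
      have e: "?s + real n * \<alpha> = t + real (m + n) * \<alpha>" by (simp add: algebra_simps)
      have "0 \<le> \<lfloor>?s\<rfloor>" "\<lfloor>?s\<rfloor> \<le> \<lfloor>?s + real n * \<alpha>\<rfloor>" using 0 \<alpha> by (auto intro: floor_mono)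
      then have "nat \<lfloor>frac ?s + real n * \<alpha>\<rfloor> + nat \<lfloor>?s\<rfloor> = nat \<lfloor>?s + real n * \<alpha>\<rfloor>"
        unfolding floor_frac_add by (simp add: nat_add_distrib[symmetric])
      then show ?thesis unfolding e by (simp add: ray_def)
    qed
    have "last_passage X 0 (ray \<alpha> t m) + last_passage X (ray \<alpha> t m) (ray \<alpha> t m + ray \<alpha> (frac ?s) n) \<le>
        last_passage X 0 (ray \<alpha> t m + ray \<alpha> (frac ?s) n)"
      using last_passage_superadditive[of X 0 "ray \<alpha> t m" "ray \<alpha> (frac ?s) n"] by simp
    then show "last_passage (fst \<omega>) 0 (ray \<alpha> (snd \<omega>) m) +
        last_passage (fst ((ray_shift \<alpha> ^^ m) \<omega>)) 0 (ray \<alpha> (snd ((ray_shift \<alpha> ^^ m) \<omega>)) n) \<le>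
        last_passage (fst \<omega>) 0 (ray \<alpha> (snd \<omega>) (m + n))"
      unfolding \<omega> ray_shift_funpow[OF \<alpha> t]
      by (simp add: last_passage_translate' sum[symmetric] add.commute)
  qed
qed

text \<open>With \<open>m\<close> the row of the lattice point, the ray in row \<open>m + 1\<close>
  is not to its left and the ray in row \<open>m - k\<close> is not to its right; there
  \<open>k * \<alpha> \<ge> 1\<close> pays for the phase \<open>t < 1\<close>. Both ray points lie
  within distance \<open>D\<close> in each coordinate, so a gap pays for each connection.\<close>

lemma point_sandwich:
  assumes \<alpha>: "0 < \<alpha>" "1 \<le> real k * \<alpha>" and y: "0 < y" and t: "t \<in> {0..<1}"
    and D: "\<alpha> * (real k + 1) + real k + 3 \<le> real D" and m: "m = nat \<lfloor>real n * y\<rfloor>" "k \<le> m"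
  shows "last_passage X 0 (ray \<alpha> t (m - k)) - gap (Suc D) X (ray \<alpha> 0 (m - k)) \<le> last_passage X 0 (point (\<alpha> * y) y n)"
    and "last_passage X 0 (point (\<alpha> * y) y n) \<le> last_passage X 0 (ray \<alpha> t (Suc m)) + gap D X (point (\<alpha> * y) y n)"
proof -
  let ?p = "point (\<alpha> * y) y n"
  have m1: "real m \<le> real n * y" "real n * y < real m + 1" using nat_floor_bounds[of "real n * y"] m(1) y by simp_all
  have x0: "0 \<le> real n * (\<alpha> * y)" using \<alpha> y by simp
  have x1: "\<alpha> * real m \<le> real n * (\<alpha> * y)" using mult_left_mono[OF m1(1), of \<alpha>] \<alpha> by (simp add: mult_ac)
  have x2: "real n * (\<alpha> * y) \<le> \<alpha> * (real m + 1)"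
    using mult_left_mono[OF less_imp_le[OF m1(2)], of \<alpha>] \<alpha> by (simp add: mult_ac)
  have \<alpha>k: "0 \<le> \<alpha> * real k" using \<alpha> by simp
  have D': "\<alpha> * real k + \<alpha> + real k + 3 \<le> real D" using D by (simp add: algebra_simps)
  have kD: "real k \<le> real D" using D' \<alpha>k \<alpha>(1) by linarith
  have mk: "real (m - k) = real m - real k" using m(2) by simp
  have up: "real n * (\<alpha> * y) \<le> t + real (Suc m) * \<alpha>" "t + real (Suc m) * \<alpha> - real n * (\<alpha> * y) + 1 \<le> real D"
  proof -
    have e: "t + real (Suc m) * \<alpha> = t + \<alpha> * real m + \<alpha>" by (simp add: algebra_simps)
    show "real n * (\<alpha> * y) \<le> t + real (Suc m) * \<alpha>"
      using x2 t unfolding e by (simp add: algebra_simps)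
    have "0 \<le> real k" by simp
    then show "t + real (Suc m) * \<alpha> - real n * (\<alpha> * y) + 1 \<le> real D"
      using x1 t D' \<alpha>k unfolding e atLeastLessThan_iff by linarith
  qed
  note up' = nat_floor_diff_le[OF x0 up]
  have lo: "0 \<le> t + real (m - k) * \<alpha>" "t + real (m - k) * \<alpha> \<le> real n * (\<alpha> * y)"
    "real n * (\<alpha> * y) - (t + real (m - k) * \<alpha>) + 1 \<le> real D"
  proof -
    show "0 \<le> t + real (m - k) * \<alpha>" using t \<alpha>(1) by simp
    have e: "t + real (m - k) * \<alpha> = t + \<alpha> * real m - real k * \<alpha>" unfolding mk by (simp add: algebra_simps)
    show "t + real (m - k) * \<alpha> \<le> real n * (\<alpha> * y)"
      using x1 t \<alpha>(2) unfolding e by simp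
    have "\<alpha> * (real m + 1) = \<alpha> * real m + \<alpha>" "real k * \<alpha> = \<alpha> * real k" "0 \<le> real k" by (simp_all add: algebra_simps)
    then show "real n * (\<alpha> * y) - (t + real (m - k) * \<alpha>) + 1 \<le> real D"
      using x2 t D' unfolding e atLeastLessThan_iff by linarith
  qed
  note lo' = nat_floor_diff_le[OF lo]
  have pf: "fst ?p = nat \<lfloor>real n * (\<alpha> * y)\<rfloor>" "snd ?p = m" by (simp_all add: point_def m(1))
  have up_le: "fst ?p \<le> fst (ray \<alpha> t (Suc m))" "fst (ray \<alpha> t (Suc m)) - fst ?p \<le> D"
    unfolding pf ray_coords by (rule up')+
  have lo_le: "fst (ray \<alpha> t (m - k)) \<le> fst ?p" "fst ?p - fst (ray \<alpha> t (m - k)) \<le> D"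
    unfolding pf ray_coords by (rule lo')+
  show "last_passage X 0 ?p \<le> last_passage X 0 (ray \<alpha> t (Suc m)) + gap D X ?p"
  proof -
    have "last_passage X 0 ?p + last_passage X ?p (ray \<alpha> t (Suc m)) \<le> last_passage X 0 (ray \<alpha> t (Suc m))"
      by (rule last_passage_superadditive'[OF _ _ up_le(1)]) (simp_all add: pf(2) ray_coords(2))
    moreover have "1 \<le> D" using D' \<alpha>k \<alpha>(1) by linarith
    then have "\<bar>last_passage X ?p (ray \<alpha> t (Suc m))\<bar> \<le> gap D X ?p"
      by (intro abs_last_passage_le_gap[OF up_le]) (simp_all add: pf(2) ray_coords(2))
    ultimately show ?thesis by linarith
  qed
  show "last_passage X 0 (ray \<alpha> t (m - k)) - gap (Suc D) X (ray \<alpha> 0 (m - k)) \<le> last_passage X 0 ?p"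
  proof -
    let ?r = "ray \<alpha> t (m - k)" and ?rz = "ray \<alpha> 0 (m - k)"
    have "last_passage X 0 ?r + last_passage X ?r ?p \<le> last_passage X 0 ?p"
      by (rule last_passage_superadditive'[OF _ _ lo_le(1)]) (simp_all add: pf(2) ray_coords(2))
    moreover have "\<bar>last_passage X ?r ?p\<bar> \<le> gap D X ?r"
      using m(2) kD by (intro abs_last_passage_le_gap[OF lo_le]) (simp_all add: pf(2) ray_coords(2))
    \<comment> \<open>The base point is moved to phase 0, at most one column to the left, since
      \<open>gap_conv\<close> requires sites that are not random.\<close>
    moreover have "gap D X ?r \<le> gap (Suc D) X ?rz"
    proof -
      have "\<lfloor>0 + real (m - k) * \<alpha>\<rfloor> \<le> \<lfloor>t + real (m - k) * \<alpha>\<rfloor>" "\<lfloor>t + real (m - k) * \<alpha>\<rfloor> \<le> \<lfloor>0 + real (m - k) * \<alpha>\<rfloor> + 1"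
        "0 \<le> \<lfloor>0 + real (m - k) * \<alpha>\<rfloor>"
        using t \<alpha> by (auto intro!: floor_mono) linarith
      then have "nat \<lfloor>0 + real (m - k) * \<alpha>\<rfloor> \<le> nat \<lfloor>t + real (m - k) * \<alpha>\<rfloor>"
        "nat \<lfloor>t + real (m - k) * \<alpha>\<rfloor> - nat \<lfloor>0 + real (m - k) * \<alpha>\<rfloor> \<le> 1" by linarith+
      then have "?r = ?rz + (?r - ?rz)" "fst (?r - ?rz) \<le> 1" "snd (?r - ?rz) \<le> 1"
        by (auto simp: ray_def prod_eq_iff)
      then show ?thesis by (metis gap_shift_le)
    qed
    ultimately show ?thesis by linarith
  qed
qed

text \<open>The point with index \<open>n\<close> lies in row \<open>m n\<close>, and
  \<open>m n / n\<close> tends to \<open>y\<close>; hence the factor \<open>y\<close>. The limit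
  \<open>f\<close> may still depend on the phase here.\<close>

lemma point_conv:
  assumes \<alpha>: "0 < \<alpha>" and y: "0 < y"
    and f: "\<mu>U.conv_L1 (\<lambda>n \<omega>. last_passage (fst \<omega>) 0 (ray \<alpha> (snd \<omega>) n) / real n) f"
  shows "\<mu>U.conv_L1 (\<lambda>n \<omega>. last_passage (fst \<omega>) 0 (point (\<alpha> * y) y n) / real n) (\<lambda>\<omega>. y * f \<omega>)"
proof -
  obtain k :: nat where "1 / \<alpha> < real k" using reals_Archimedean2 by blast
  then have k: "1 \<le> real k * \<alpha>" using \<alpha> by (simp add: divide_less_eq)
  obtain D :: nat where D: "\<alpha> * (real k + 1) + real k + 3 \<le> real D" using real_arch_simple by blast
  define m where "m n = nat \<lfloor>real n * y\<rfloor>" for n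
  have m: "real (m n) \<le> real n * y" "real n * y < real (m n) + 1" for n
    using nat_floor_bounds[of "real n * y"] y by (simp_all add: m_def)
  have m_up: "\<bar>real (Suc (m n)) - real n * y\<bar> \<le> real k + 1" for n using m[of n] by auto
  \<comment> \<open>If \<open>m n < k\<close>, the truncated difference is 0 and
    \<open>n * y < k\<close>, so the bound persists.\<close>
  have m_lo: "\<bar>real (m n - k) - real n * y\<bar> \<le> real k + 1" for n
    using m[of n] y by (cases "k \<le> m n") (auto simp: of_nat_diff abs_if)
  note ratio_up = ratio_tendsto[OF y m_up] and ratio_lo = ratio_tendsto[OF y m_lo]
  have gap: "\<mu>U.conv_L1 (\<lambda>n \<omega>. gap D (fst \<omega>) (w n) / real n) (\<lambda>_. 0)" for D w
    using gap_conv[of D w] conv_L1_fst_iff[of "\<lambda>n X. gap D X (w n) / real n" "\<lambda>_. 0"] by simp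
  let ?a = "\<lambda>n \<omega>. last_passage (fst \<omega>) 0 (ray \<alpha> (snd \<omega>) n)"
  let ?lo = "\<lambda>n \<omega>. (real (m n - k) / real n) * (?a (m n - k) \<omega> / real (m n - k)) +
      (- 1) * (gap (Suc D) (fst \<omega>) (ray \<alpha> 0 (m n - k)) / real n)"
  let ?up = "\<lambda>n \<omega>. (real (Suc (m n)) / real n) * (?a (Suc (m n)) \<omega> / real (Suc (m n))) +
      1 * (gap D (fst \<omega>) (point (\<alpha> * y) y n) / real n)"
  have "\<mu>U.conv_L1 ?lo (\<lambda>\<omega>. y * f \<omega> + (- 1) * 0)"
    by (intro \<mu>U.conv_L1_add \<mu>U.conv_L1_scale[OF \<mu>U.conv_L1_subseq[OF f ratio_lo(2)] ratio_lo(1)]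
        \<mu>U.conv_L1_scale[OF gap tendsto_const])
  then have lo: "\<mu>U.conv_L1 ?lo (\<lambda>\<omega>. y * f \<omega>)" by simp
  have "\<mu>U.conv_L1 ?up (\<lambda>\<omega>. y * f \<omega> + 1 * 0)"
    by (intro \<mu>U.conv_L1_add \<mu>U.conv_L1_scale[OF \<mu>U.conv_L1_subseq[OF f ratio_up(2)] ratio_up(1)]
        \<mu>U.conv_L1_scale[OF gap tendsto_const])
  then have up: "\<mu>U.conv_L1 ?up (\<lambda>\<omega>. y * f \<omega>)" by simp
  show ?thesis
  proof (rule \<mu>U.conv_L1_sandwich[OF lo up])
    show "integrable \<mu>U (\<lambda>\<omega>. last_passage (fst \<omega>) 0 (point (\<alpha> * y) y n) / real n)" for n
      by (intro integrable_divide integrable_fst integrable_last_passage) auto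
    have "\<forall>\<^sub>F n in sequentially. Suc k \<le> m n - k"
      using ratio_lo(2) by (auto simp: filterlim_at_top)
    then show "\<forall>\<^sub>F n in sequentially. \<forall>\<omega>\<in>space \<mu>U.
        ?lo n \<omega> \<le> last_passage (fst \<omega>) 0 (point (\<alpha> * y) y n) / real n \<and>
        last_passage (fst \<omega>) 0 (point (\<alpha> * y) y n) / real n \<le> ?up n \<omega>"
    proof eventually_elim
      case (elim n)
      then have mk: "k \<le> m n" "0 < m n - k" by auto
      show ?case
      proof
        fix \<omega> assume "\<omega> \<in> space \<mu>U"
        then have t: "snd \<omega> \<in> {0..<1}" by (auto simp: space_\<mu>U)
        note s = point_sandwich[OF \<alpha> k y t D _ mk(1), of n "fst \<omega>", OF m_def]
        have "?lo n \<omega> = (?a (m n - k) \<omega> - gap (Suc D) (fst \<omega>) (ray \<alpha> 0 (m n - k))) / real n"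
        proof -
          have "(r / N) * (b / r) = b / N" if "r \<noteq> 0" for r N b :: real using that by simp
          from this[of "real (m n - k)" "real n" "?a (m n - k) \<omega>"] mk(2) show ?thesis
            by (simp only: diff_divide_distrib of_nat_0_eq_iff)
        qed
        moreover have "?up n \<omega> = (?a (Suc (m n)) \<omega> + gap D (fst \<omega>) (point (\<alpha> * y) y n)) / real n"
          by (simp add: add_divide_distrib del: of_nat_Suc)
        ultimately show "?lo n \<omega> \<le> last_passage (fst \<omega>) 0 (point (\<alpha> * y) y n) / real n \<and>
            last_passage (fst \<omega>) 0 (point (\<alpha> * y) y n) / real n \<le> ?up n \<omega>"
          using s by (simp add: divide_right_mono)
      qed
    qed
  qed
qed

end

section \<open>The limit is deterministic\<close>

context lpp
begin

abbreviation quenched_mean :: "((nat \<times> nat \<Rightarrow> real) \<Rightarrow> real) \<Rightarrow> (nat \<Rightarrow> real measure) \<Rightarrow> real" where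
  "quenched_mean f F \<equiv> \<integral>X. f X \<partial>quenched F"

lemma quenched_mean_measurable:
  assumes "f \<in> borel_measurable weight_space"
  shows "quenched_mean f \<in> borel_measurable env_space"
  using measurable_compose[OF measurable_quenched_subprob integral_measurable_subprob_algebra[OF assms]] .

lemma quenched_integrable:
  fixes f :: "(nat \<times> nat \<Rightarrow> real) \<Rightarrow> real"
  assumes "F \<in> space env_space" "f \<in> borel_measurable weight_space" "\<And>X. \<bar>f X\<bar> \<le> B"
  shows "integrable (quenched F) f"
proof -
  interpret prob_space "quenched F" by (rule prob_space_quenched[OF assms(1)])
  show ?thesis
    using assms(2,3) by (intro integrable_const_bound[of _ B]) (auto simp: measurable_quenched_iff[OF assms(1)])
qed

lemma quenched_mean_bound:
  assumes F: "F \<in> space env_space" and f: "f \<in> borel_measurable weight_space" "\<And>X. \<bar>f X\<bar> \<le> B"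
  shows "\<bar>quenched_mean f F\<bar> \<le> B"
proof -
  interpret prob_space "quenched F" by (rule prob_space_quenched[OF F])
  have "\<bar>quenched_mean f F\<bar> \<le> (\<integral>X. \<bar>f X\<bar> \<partial>quenched F)" by (rule integral_abs_bound)
  also have "\<dots> \<le> (\<integral>X. B \<partial>quenched F)"
    using f quenched_integrable[OF F f] by (intro integral_mono) auto
  finally show ?thesis by (simp add: prob_space)
qed

lemma integrable_\<mu>_bounded:
  "f \<in> borel_measurable weight_space \<Longrightarrow> (\<And>X. \<bar>f X\<bar> \<le> B) \<Longrightarrow> integrable \<mu> (f :: _ \<Rightarrow> real)"
  by (intro \<mu>.integrable_const_bound[of _ B]) auto

lemma integral_\<mu>:
  assumes f: "f \<in> borel_measurable weight_space" "\<And>X. \<bar>f X\<bar> \<le> B"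
  shows "(\<integral>X. f X \<partial>\<mu>) = (\<integral>F. quenched_mean f F \<partial>P)"
  unfolding weights_law_def
proof (rule integral_bind[OF f(1) _ quenched_P])
  show "finite_measure P" by (rule P.finite_measure_axioms)
  show "AE F in P. emeasure (quenched F) (space (quenched F)) \<le> ennreal 1"
    using prob_space.emeasure_space_1[OF prob_space_quenched(1)] by (intro AE_I2) (simp add: space_P)
qed (rule f(2))

lemma quenched_mean_translate:
  assumes F: "F \<in> space env_space" and f: "f \<in> borel_measurable weight_space"
  shows "quenched_mean (\<lambda>X. f (translate s X)) F = quenched_mean f (\<lambda>j. F (j + snd s))"
proof -
  have "translate s \<in> quenched F \<rightarrow>\<^sub>M weight_space" by (simp add: measurable_quenched_iff[OF F])
  from integral_distr[OF this f] show ?thesis by (simp add: distr_quenched_translate[OF F])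
qed

text \<open>\<open>ergodic_env\<close> speaks of exactly invariant sets, but \<open>v\<close> is
  invariant only almost everywhere. The set \<open>A\<close>, where \<open>v (shift n F) < c\<close>
  for all large \<open>n\<close>, is exactly invariant and agrees almost everywhere with
  \<open>v F < c\<close>. As \<open>c\<close> is the mean of \<open>v\<close>, having
  \<open>v < c\<close> almost everywhere is impossible, and \<open>v \<ge> c\<close> forces
  equality.\<close>

lemma ergodic_const:
  assumes v [measurable]: "v \<in> borel_measurable env_space" and int: "integrable P v"
    and inv: "AE F in P. v (env_shift F) = v F"
  shows "AE F in P. v F = (\<integral>F. v F \<partial>P :: real)"
proof -
  define c where "c = (\<integral>F. v F \<partial>P)"
  define shift where "shift n F = (\<lambda>j. F (j + n))" for n and F :: "nat \<Rightarrow> real measure"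
  have [measurable]: "shift n \<in> env_space \<rightarrow>\<^sub>M env_space" for n
    unfolding shift_def[abs_def] by (rule env_shift_measurable)
  have shift_Suc: "shift (Suc n) F = shift n (env_shift F)" "shift (Suc n) F = env_shift (shift n F)" for n F
    by (auto simp: shift_def env_shift_def)
  have shift_space: "shift n F \<in> space env_space" if "F \<in> space env_space" for n F
    using that measurable_space[of "shift n" env_space env_space] by simp
  define A where "A = {F \<in> space env_space. eventually (\<lambda>n. v (shift n F) < c) sequentially}"
  have "A \<in> sets env_space" unfolding A_def eventually_sequentially by measurable
  then have A: "A \<in> sets P" by (simp add: sets_P)
  have "env_shift F \<in> A \<longleftrightarrow> F \<in> A" if F: "F \<in> space env_space" for F
  proof -
    have "env_shift F \<in> space env_space" using shift_space[OF F, of 1] by (simp add: shift_def env_shift_def)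
    then show ?thesis
      using F eventually_sequentially_Suc[of "\<lambda>n. v (shift n F) < c"] by (simp add: A_def shift_Suc(1))
  qed
  then have "env_shift -` A \<inter> space P = A" using sets.sets_into_space[OF A] by (auto simp: space_P)
  then have cases: "measure P A = 0 \<or> measure P A = 1" using ergodic A unfolding ergodic_env_def by blast
  have "AE F in P. \<forall>n. v (env_shift (shift n F)) = v (shift n F)"
    unfolding AE_all_countable shift_def by (intro allI AE_P_shift inv)
  then have orbit: "AE F in P. \<forall>n. v (shift n F) = v F"
  proof eventually_elim
    case (elim F)
    show ?case
    proof
      fix n show "v (shift n F) = v F"
        by (induction n) (use elim in \<open>simp_all add: shift_Suc(2) shift_def[of 0]\<close>)
    qed
  qed
  have sp: "AE F in P. F \<in> space P" by simp
  have A_iff: "AE F in P. F \<in> A \<longleftrightarrow> v F < c"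
    using orbit sp by eventually_elim (simp add: A_def space_P)
  have zero: "(\<integral>F. v F - c \<partial>P) = 0" using int by (simp add: P.prob_space c_def)
  show ?thesis
  proof (cases "measure P A = 1")
    case True
    then have "AE F in P. F \<in> A" using A by (simp add: P.prob_eq_1)
    with A_iff have lt: "AE F in P. v F < c" by eventually_elim simp
    have "(\<integral>F. c - v F \<partial>P) = 0" using int by (simp add: P.prob_space c_def)
    then have "AE F in P. c - v F = 0"
      using lt int by (subst (asm) integral_nonneg_eq_0_iff_AE) (auto elim: eventually_mono)
    with lt have "AE F in P. False" by eventually_elim simp
    then show ?thesis by simp
  next
    case False
    then have "measure P A = 0" using cases by blast
    then have "AE F in P. F \<notin> A" using A by (simp add: P.prob_eq_0)
    with A_iff have ge: "AE F in P. c \<le> v F" by eventually_elim simp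
    have "AE F in P. v F - c = 0"
      using zero ge int by (subst (asm) integral_nonneg_eq_0_iff_AE) (auto elim: eventually_mono)
    then show ?thesis by eventually_elim (simp add: c_def)
  qed
qed

text \<open>Columns are conditionally independent and identically distributed, so a column-invariant
  limit \<open>u\<close> of functions of finitely many columns is conditionally uncorrelated with itself, that
  is, it depends on the environment only; row invariance and ergodicity then make it constant.\<close>

lemma invariant_limit_const:
  assumes u [measurable]: "u \<in> borel_measurable weight_space" and uB: "\<And>X. \<bar>u X\<bar> \<le> B"
    and g [measurable]: "\<And>n. g n \<in> borel_measurable weight_space" and gB: "\<And>n X. \<bar>g n X\<bar> \<le> B"
    and dep: "\<And>n X. g n (\<lambda>z. if fst z < N n then X z else 0) = g n X"
    and lim: "AE X in \<mu>. (\<lambda>n. g n X) \<longlonglongrightarrow> u X"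
    and col: "AE X in \<mu>. u (translate (1, 0) X) = u X"
    and row: "AE X in \<mu>. u (translate (0, 1) X) = u X"
  shows "\<exists>c::real. AE X in \<mu>. u X = c"
proof -
  let ?v = "quenched_mean u" and ?c = "\<lambda>n. quenched_mean (g n)"
  have B: "0 \<le> B" using uB[of undefined] by linarith
  have sp: "AE F in P. F \<in> space env_space" using AE_space[of P] unfolding space_P .
  have v_meas [measurable]: "?v \<in> borel_measurable env_space" by (rule quenched_mean_measurable[OF u])
  have c_meas [measurable]: "?c n \<in> borel_measurable env_space" for n by (rule quenched_mean_measurable[OF g])
  have sq: "\<bar>x * y\<bar> \<le> B * B" if "\<bar>x\<bar> \<le> B" "\<bar>y\<bar> \<le> B" for x y :: real
    unfolding abs_mult using that by (intro mult_mono) auto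
  have sq2: "x * x \<le> B * B" if "\<bar>x\<bar> \<le> B" for x :: real
    using sq[OF that that] by simp
  have v_lim: "AE F in P. (\<lambda>n. ?c n F) \<longlonglongrightarrow> ?v F"
  proof -
    have "AE F in P. AE X in quenched F. (\<lambda>n. g n X) \<longlonglongrightarrow> u X"
      using lim by (subst (asm) AE_\<mu>) (auto intro: pred_LIMSEQ)
    with sp show ?thesis
    proof eventually_elim
      case (elim F)
      interpret prob_space "quenched F" by (rule prob_space_quenched[OF elim(1)])
      show ?case
        by (rule integral_dominated_convergence[where w="\<lambda>_. B"])
          (use elim gB in \<open>auto simp: measurable_quenched_iff\<close>)
    qed
  qed
  \<comment> \<open>Translation by \<open>N n\<close> columns makes the second factor depend on
    other columns than the first but keeps its quenched mean, so the quenched expectation of the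
    product is a square.\<close>
  have g_prod: "(\<integral>X. g n X * g n (translate (N n, 0) X) \<partial>\<mu>) = (\<integral>F. ?c n F * ?c n F \<partial>P)" for n
  proof -
    have "(\<integral>X. g n X * g n (translate (N n, 0) X) \<partial>\<mu>) =
        (\<integral>F. quenched_mean (\<lambda>X. g n X * g n (translate (N n, 0) X)) F \<partial>P)"
      by (rule integral_\<mu>[where B="B * B"]) (auto intro: sq gB)
    also have "\<dots> = (\<integral>F. ?c n F * ?c n F \<partial>P)"
    proof (rule Bochner_Integration.integral_cong[OF refl])
      fix F assume "F \<in> space P"
      then have F: "F \<in> space env_space" by (simp add: space_P)
      have gi: "integrable (quenched F) (g n)" by (rule quenched_integrable[OF F g gB])
      have gti: "integrable (quenched F) (\<lambda>X. g n (translate (N n, 0) X))"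
        by (rule quenched_integrable[OF F _ gB]) measurable
      have "quenched_mean (\<lambda>X. g n X * g n (translate (N n, 0) X)) F =
          ?c n F * quenched_mean (\<lambda>X. g n (translate (N n, 0) X)) F"
      proof (rule quenched_integral_mult(1)[OF F gi _ gti, where A="{z. fst z < N n}" and B="{z. N n \<le> fst z}"])
        fix X
        show "g n (\<lambda>z. if z \<in> {z. fst z < N n} then X z else 0) = g n X" using dep[of n X] by simp
        have "translate (N n, 0) (\<lambda>z. if z \<in> {z. N n \<le> fst z} then X z else 0) = translate (N n, 0) X"
          by (auto simp: translate_def)
        then show "g n (translate (N n, 0) (\<lambda>z. if z \<in> {z. N n \<le> fst z} then X z else 0)) =
            g n (translate (N n, 0) X)" by (simp only:)
      qed auto
      also have "quenched_mean (\<lambda>X. g n (translate (N n, 0) X)) F = ?c n F"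
        by (subst quenched_mean_translate[OF F g]) simp
      finally show "quenched_mean (\<lambda>X. g n X * g n (translate (N n, 0) X)) F = ?c n F * ?c n F" .
    qed
    finally show ?thesis .
  qed
  have lim_cc: "(\<lambda>n. \<integral>F. ?c n F * ?c n F \<partial>P) \<longlonglongrightarrow> (\<integral>F. ?v F * ?v F \<partial>P)"
  proof (rule integral_dominated_convergence[where w="\<lambda>_. B * B"])
    show "AE F in P. (\<lambda>n. ?c n F * ?c n F) \<longlonglongrightarrow> ?v F * ?v F"
      using v_lim by eventually_elim (intro tendsto_mult)
    show "AE F in P. norm (?c n F * ?c n F) \<le> B * B" for n
      using sp
    proof eventually_elim
      case (elim F)
      show ?case unfolding real_norm_def by (intro sq quenched_mean_bound elim g gB)
    qed
  qed auto
  define d where "d n = (\<integral>X. \<bar>g n X - u X\<bar> \<partial>\<mu>)" for n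
  have "d \<longlonglongrightarrow> (\<integral>X. 0 \<partial>\<mu>)"
    unfolding d_def
  proof (rule integral_dominated_convergence[where w="\<lambda>_. 2 * B"])
    show "AE X in \<mu>. (\<lambda>n. \<bar>g n X - u X\<bar>) \<longlonglongrightarrow> 0"
      using lim by eventually_elim (rule tendsto_rabs_zero[OF LIM_zero])
    show "AE X in \<mu>. norm \<bar>g n X - u X\<bar> \<le> 2 * B" for n
    proof (rule AE_I2)
      fix X show "norm \<bar>g n X - u X\<bar> \<le> 2 * B" using gB[of n X] uB[of X] by simp
    qed
  qed auto
  then have d: "d \<longlonglongrightarrow> 0" by simp
  have u_col: "AE X in \<mu>. u (translate (k, 0) X) = u X" for k
  proof (induction k)
    case 0
    show ?case by (simp add: translate_def zero_prod_def[symmetric])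
  next
    case (Suc k)
    from col AE_translate[OF Suc, of "(1, 0)"] show ?case
      by eventually_elim (simp add: translate_translate)
  qed
  have gi: "integrable \<mu> (g n)" for n by (rule integrable_\<mu>_bounded[OF g gB])
  have ui: "integrable \<mu> u" by (rule integrable_\<mu>_bounded[OF u uB])
  have uui: "integrable \<mu> (\<lambda>X. u X * u X)" by (rule integrable_\<mu>_bounded[where B="B * B"]) (auto intro: sq sq2 uB)
  \<comment> \<open>The translation grows with \<open>n\<close>, but it preserves
    \<open>\<mu>\<close> and almost everywhere fixes \<open>u\<close>; hence the product of
    \<open>g n\<close> with its translate approaches \<open>u * u\<close> in mean.\<close>
  have close: "\<bar>(\<integral>X. g n X * g n (translate (N n, 0) X) \<partial>\<mu>) - (\<integral>X. u X * u X \<partial>\<mu>)\<bar> \<le> 2 * B * d n" for n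
  proof -
    let ?t = "translate (N n, 0)"
    have gg: "integrable \<mu> (\<lambda>X. g n X * g n (?t X))"
      by (rule integrable_\<mu>_bounded[where B="B * B"]) (auto intro: sq gB)
    have uu: "integrable \<mu> (\<lambda>X. u X * u (?t X))"
      by (rule integrable_\<mu>_bounded[where B="B * B"]) (auto intro: sq sq2 uB)
    have "(\<integral>X. u X * u (?t X) \<partial>\<mu>) = (\<integral>X. u X * u X \<partial>\<mu>)"
      using u_col[of "N n"] by (intro integral_cong_AE) (auto elim: eventually_mono)
    then have "\<bar>(\<integral>X. g n X * g n (?t X) \<partial>\<mu>) - (\<integral>X. u X * u X \<partial>\<mu>)\<bar> =
        \<bar>\<integral>X. g n X * g n (?t X) - u X * u (?t X) \<partial>\<mu>\<bar>"
      using gg uu by simp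
    also have "\<dots> \<le> (\<integral>X. \<bar>g n X * g n (?t X) - u X * u (?t X)\<bar> \<partial>\<mu>)" by (rule integral_abs_bound)
    also have "\<dots> \<le> (\<integral>X. B * \<bar>g n (?t X) - u (?t X)\<bar> + B * \<bar>g n X - u X\<bar> \<partial>\<mu>)"
    proof (rule integral_mono)
      fix X
      have "g n X * g n (?t X) - u X * u (?t X) = g n X * (g n (?t X) - u (?t X)) + (g n X - u X) * u (?t X)"
        by (simp add: algebra_simps)
      then have "\<bar>g n X * g n (?t X) - u X * u (?t X)\<bar> \<le>
          \<bar>g n X\<bar> * \<bar>g n (?t X) - u (?t X)\<bar> + \<bar>g n X - u X\<bar> * \<bar>u (?t X)\<bar>"
        by (simp only: abs_mult[symmetric] abs_triangle_ineq)
      also have "\<dots> \<le> B * \<bar>g n (?t X) - u (?t X)\<bar> + \<bar>g n X - u X\<bar> * B"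
        using gB uB by (intro add_mono mult_right_mono mult_left_mono) auto
      finally show "\<bar>g n X * g n (?t X) - u X * u (?t X)\<bar> \<le> B * \<bar>g n (?t X) - u (?t X)\<bar> + B * \<bar>g n X - u X\<bar>"
        by (simp add: mult.commute)
    qed (use gg uu gi ui integrable_translate[OF gi, of n "(N n, 0)"] integrable_translate[OF ui, of "(N n, 0)"] in auto)
    also have "\<dots> = B * (\<integral>X. \<bar>g n (?t X) - u (?t X)\<bar> \<partial>\<mu>) + B * d n"
      using gi ui integrable_translate[OF gi, of n "(N n, 0)"] integrable_translate[OF ui, of "(N n, 0)"]
      by (simp add: d_def)
    also have "(\<integral>X. \<bar>g n (?t X) - u (?t X)\<bar> \<partial>\<mu>) = d n"
      unfolding d_def by (rule integral_translate) measurable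
    finally show ?thesis by simp
  qed
  have "(\<lambda>n. (\<integral>X. g n X * g n (translate (N n, 0) X) \<partial>\<mu>) - (\<integral>X. u X * u X \<partial>\<mu>)) \<longlonglongrightarrow> 0"
  proof (rule Lim_null_comparison)
    show "(\<lambda>n. 2 * B * d n) \<longlonglongrightarrow> 0" using tendsto_mult[OF tendsto_const d] by simp
  qed (use close in \<open>auto intro!: always_eventually\<close>)
  then have "(\<lambda>n. \<integral>F. ?c n F * ?c n F \<partial>P) \<longlonglongrightarrow> (\<integral>X. u X * u X \<partial>\<mu>)"
    unfolding g_prod by (rule LIM_zero_cancel)
  \<comment> \<open>Both sides are limits of the same expectations. Their equality says that the
    variance of \<open>u\<close> given the environment has mean 0.\<close>
  from LIMSEQ_unique[OF this lim_cc]
  have eq: "(\<integral>F. quenched_mean (\<lambda>X. u X * u X) F \<partial>P) = (\<integral>F. ?v F * ?v F \<partial>P)"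
    by (subst integral_\<mu>[where B="B * B", symmetric]) (auto intro: sq sq2 uB)
  have vv: "integrable P (\<lambda>F. ?v F * ?v F)"
    using sp by (intro P.integrable_const_bound[of _ "B * B"]) (auto elim!: eventually_mono intro!: sq2 quenched_mean_bound uB)
  have q2: "integrable P (quenched_mean (\<lambda>X. u X * u X))"
  proof (rule P.integrable_const_bound[of _ "B * B"])
    show "AE F in P. norm (quenched_mean (\<lambda>X. u X * u X) F) \<le> B * B"
      using sp
    proof eventually_elim
      case (elim F)
      show ?case unfolding real_norm_def by (rule quenched_mean_bound[OF elim]) (auto intro: sq sq2 uB)
    qed
  qed (simp add: quenched_mean_measurable)
  have var: "quenched_mean (\<lambda>X. u X * u X) F - ?v F * ?v F = quenched_mean (\<lambda>X. (u X - ?v F)\<^sup>2) F"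
    and var_int: "integrable (quenched F) (\<lambda>X. (u X - ?v F)\<^sup>2)"
    if F: "F \<in> space env_space" for F
  proof -
    interpret prob_space "quenched F" by (rule prob_space_quenched[OF F])
    have 1: "integrable (quenched F) u" by (rule quenched_integrable[OF F u uB])
    have 2: "integrable (quenched F) (\<lambda>X. u X * u X)"
      by (rule quenched_integrable[OF F, where B="B * B"]) (auto intro: sq sq2 uB)
    have e: "(u X - ?v F)\<^sup>2 = u X * u X - 2 * ?v F * u X + ?v F * ?v F" for X
      by (simp add: power2_eq_square algebra_simps)
    show "integrable (quenched F) (\<lambda>X. (u X - ?v F)\<^sup>2)" unfolding e using 1 2 by auto
    show "quenched_mean (\<lambda>X. u X * u X) F - ?v F * ?v F = quenched_mean (\<lambda>X. (u X - ?v F)\<^sup>2) F"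
      unfolding e using 1 2 by (simp add: prob_space)
  qed
  have "(\<integral>F. quenched_mean (\<lambda>X. u X * u X) F - ?v F * ?v F \<partial>P) = 0" using eq vv q2 by simp
  moreover have "AE F in P. 0 \<le> quenched_mean (\<lambda>X. u X * u X) F - ?v F * ?v F"
    using sp
  proof eventually_elim
    case (elim F)
    show ?case unfolding var[OF elim] by (rule integral_nonneg_AE) simp
  qed
  ultimately have "AE F in P. quenched_mean (\<lambda>X. u X * u X) F - ?v F * ?v F = 0"
    using vv q2 by (subst (asm) integral_nonneg_eq_0_iff_AE) auto
  with sp have u_eq: "AE F in P. AE X in quenched F. u X = ?v F"
  proof eventually_elim
    case (elim F)
    have "quenched_mean (\<lambda>X. (u X - ?v F)\<^sup>2) F = 0" using elim var[OF elim(1)] by simp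
    then have "AE X in quenched F. (u X - ?v F)\<^sup>2 = 0"
      by (subst (asm) integral_nonneg_eq_0_iff_AE[OF var_int[OF elim(1)]]) auto
    then show ?case by eventually_elim simp
  qed
  have "(\<lambda>X. u (translate (0, 1) X) - u X) \<in> borel_measurable weight_space"
    by (intro borel_measurable_diff measurable_compose[OF translate_measurable u] u)
  moreover have "Measurable.pred borel (\<lambda>x::real. x = 0)" by measurable
  ultimately have "Measurable.pred weight_space (\<lambda>X. u (translate (0, 1) X) - u X = 0)"
    by (rule measurable_compose)
  then have "Measurable.pred weight_space (\<lambda>X. u (translate (0, 1) X) = u X)" by simp
  from row[unfolded AE_\<mu>[OF this]]
  have "AE F in P. AE X in quenched F. u (translate (0, 1) X) = u X" .
  \<comment> \<open>Translating the weights by one row shifts the environment, so row invariance of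
    \<open>u\<close> is shift invariance of its quenched mean.\<close>
  with sp have v_inv: "AE F in P. ?v (env_shift F) = ?v F"
  proof eventually_elim
    case (elim F)
    have "?v (env_shift F) = quenched_mean (\<lambda>X. u (translate (0, 1) X)) F"
      by (subst quenched_mean_translate[OF elim(1) u]) (simp add: env_shift_def)
    also have "\<dots> = ?v F"
      using elim(2) by (intro integral_cong_AE) (auto simp: measurable_quenched_iff[OF elim(1)])
    finally show ?case .
  qed
  have vi: "integrable P ?v"
    using sp by (intro P.integrable_const_bound[of _ B]) (auto elim!: eventually_mono intro!: quenched_mean_bound uB)
  have "AE F in P. AE X in quenched F. u X = (\<integral>F. ?v F \<partial>P)"
    using u_eq ergodic_const[OF v_meas vi v_inv] by eventually_elim simp
  then have "AE X in \<mu>. u X = (\<integral>F. ?v F \<partial>P)" by (subst AE_\<mu>) auto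
  then show ?thesis by blast
qed

text \<open>A path for the translated weights becomes one for \<open>X\<close> after prefixing a
  passage from 0 to \<open>s\<close> and continuing to the point of index \<open>n + k\<close>.
  Since \<open>k * \<alpha> \<ge> 1\<close> and \<open>k \<ge> 1\<close>, that point is still
  reachable after a shift by at most one in each coordinate. Both additions are gaps, hence
  o(n).\<close>

lemma point_limit_translate_le:
  assumes \<alpha>: "0 < \<alpha>" and s: "fst s \<le> 1" "snd s \<le> 1"
    and h: "\<mu>.conv_L1 (\<lambda>n X. last_passage X 0 (point \<alpha> 1 n) / real n) h"
  shows "AE X in \<mu>. h (translate s X) \<le> h X"
proof -
  obtain k :: nat where "1 / \<alpha> + 1 < real k" using reals_Archimedean2 by blast
  moreover have "0 < 1 / \<alpha>" using \<alpha> by simp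
  ultimately have "1 / \<alpha> < real k" "1 < real k" by linarith+
  then have k: "1 \<le> real k * \<alpha>" "1 \<le> k" using \<alpha> by (simp_all add: divide_less_eq)
  obtain D :: nat where D: "real k * \<alpha> + real k + 2 \<le> real D" using real_arch_simple by blast
  have "real k \<le> real D" using D k(1) by linarith
  then have kD: "k \<le> D" by simp
  let ?T = "\<lambda>X n. last_passage X 0 (point \<alpha> 1 n)"
  have le: "?T (translate s X) n \<le> ?T X (n + k) + gap D X (point \<alpha> 1 n + s) + gap 1 X 0" for X n
  proof -
    let ?p = "point \<alpha> 1 n" and ?q = "point \<alpha> 1 (n + k)"
    have f: "nat \<lfloor>real n * \<alpha>\<rfloor> + 1 \<le> nat \<lfloor>real (n + k) * \<alpha>\<rfloor>" "nat \<lfloor>real (n + k) * \<alpha>\<rfloor> - nat \<lfloor>real n * \<alpha>\<rfloor> \<le> D"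
    proof -
      have e: "real (n + k) * \<alpha> = real n * \<alpha> + real k * \<alpha>" by (simp add: algebra_simps)
      have a0: "0 \<le> real n * \<alpha>" using \<alpha> by simp
      show "nat \<lfloor>real (n + k) * \<alpha>\<rfloor> - nat \<lfloor>real n * \<alpha>\<rfloor> \<le> D"
        by (rule nat_floor_diff_le[OF a0]) (use k D e in auto)
      have "\<lfloor>real n * \<alpha>\<rfloor> + 1 \<le> \<lfloor>real (n + k) * \<alpha>\<rfloor>" "0 \<le> \<lfloor>real n * \<alpha>\<rfloor>" using k a0 unfolding e by linarith+
      then show "nat \<lfloor>real n * \<alpha>\<rfloor> + 1 \<le> nat \<lfloor>real (n + k) * \<alpha>\<rfloor>" by linarith
    qed
    have pq: "fst ?p + 1 \<le> fst ?q" "fst ?q - fst ?p \<le> D" "snd ?p = n" "snd ?q = n + k"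
      unfolding point_def fst_conv using f by (auto simp del: of_nat_add)
    have "last_passage X 0 s + last_passage X s (?p + s) \<le> last_passage X 0 (?p + s)"
      by (rule last_passage_superadditive') auto
    moreover have "last_passage X s (?p + s) = ?T (translate s X) n"
      by (simp add: last_passage_translate')
    moreover have "last_passage X 0 (?p + s) + last_passage X (?p + s) ?q \<le> last_passage X 0 ?q"
      using pq s k by (intro last_passage_superadditive') auto
    moreover have "\<bar>last_passage X (?p + s) ?q\<bar> \<le> gap D X (?p + s)"
      using pq s k kD by (intro abs_last_passage_le_gap) auto
    moreover have "\<bar>last_passage X 0 s\<bar> \<le> gap 1 X 0"
      using s by (intro abs_last_passage_le_gap) auto
    ultimately show ?thesis by linarith
  qed
  have r: "(\<lambda>n. real (n + k) / real n) \<longlonglongrightarrow> 1"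
    by (rule ratio_tendsto(1)[where c="real k"]) auto
  have shift: "filterlim (\<lambda>n. n + k) sequentially sequentially" by (rule filterlim_add_const_nat_at_top)
  have conv: "\<mu>.conv_L1 (\<lambda>n X. real (n + k) / real n * (?T X (n + k) / real (n + k))) (\<lambda>X. 1 * h X)"
    by (rule \<mu>.conv_L1_scale[OF \<mu>.conv_L1_subseq[OF h shift] r])
  from \<mu>.conv_L1D(3)[OF conv] AE_translate[OF \<mu>.conv_L1D(3)[OF h], of s]
    \<mu>.conv_L1D(3)[OF gap_conv[of D "\<lambda>n. point \<alpha> 1 n + s"]] \<mu>.conv_L1D(3)[OF gap_conv[of 1 "\<lambda>n. 0"]]
  show ?thesis
  proof eventually_elim
    case (elim X)
    have "(\<lambda>n. real (n + k) / real n * (?T X (n + k) / real (n + k)) +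
        gap D X (point \<alpha> 1 n + s) / real n + gap 1 X 0 / real n) \<longlonglongrightarrow> 1 * h X + 0 + 0"
      by (intro tendsto_add elim)
    then have lim: "(\<lambda>n. real (n + k) / real n * (?T X (n + k) / real (n + k)) +
        gap D X (point \<alpha> 1 n + s) / real n + gap 1 X 0 / real n) \<longlonglongrightarrow> h X" by simp
    show ?case
    proof (rule LIMSEQ_le[OF elim(2) lim], intro exI allI impI)
      fix n :: nat assume n: "1 \<le> n"
      have "?T (translate s X) n / real n \<le> (?T X (n + k) + gap D X (point \<alpha> 1 n + s) + gap 1 X 0) / real n"
        by (rule divide_right_mono[OF le]) simp
      also have "\<dots> = real (n + k) / real n * (?T X (n + k) / real (n + k)) +
        gap D X (point \<alpha> 1 n + s) / real n + gap 1 X 0 / real n"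
        using n by (simp add: add_divide_distrib del: of_nat_add)
      finally show "?T (translate s X) n / real n \<le> real (n + k) / real n * (?T X (n + k) / real (n + k)) +
        gap D X (point \<alpha> 1 n + s) / real n + gap 1 X 0 / real n" .
    qed
  qed
qed

lemma point_limit_const:
  assumes \<alpha>: "0 < \<alpha>" and h: "\<mu>.conv_L1 (\<lambda>n X. last_passage X 0 (point \<alpha> 1 n) / real n) h"
  shows "\<exists>c. AE X in \<mu>. h X = c"
proof -
  have hi: "integrable \<mu> h" by (rule \<mu>.conv_L1D(2)[OF h])
  have h_meas [measurable]: "h \<in> borel_measurable weight_space" using borel_measurable_integrable[OF hi] by simp
  \<comment> \<open>The one-sided inequality is an equality because both sides have the same
    integral.\<close>
  have inv: "AE X in \<mu>. h (translate s X) = h X" if s: "fst s \<le> 1" "snd s \<le> 1" for s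
  proof -
    have i: "integrable \<mu> (\<lambda>X. h (translate s X))" by (rule integrable_translate[OF hi])
    have le: "AE X in \<mu>. 0 \<le> h X - h (translate s X)"
      using point_limit_translate_le[OF \<alpha> s h] by eventually_elim simp
    have "(\<integral>X. h X - h (translate s X) \<partial>\<mu>) = 0"
      using hi i integral_translate[OF h_meas, of s] by simp
    then have "AE X in \<mu>. h X - h (translate s X) = 0"
      using hi i le by (subst (asm) integral_nonneg_eq_0_iff_AE) auto
    then show ?thesis by eventually_elim simp
  qed
  \<comment> \<open>The limit \<open>h\<close> may be unbounded; \<open>arctan\<close> makes it
    bounded and, being continuous and injective, preserves both the convergence and the
    conclusion.\<close>
  have bound: "\<bar>arctan x\<bar> \<le> 2" for x :: real
    using arctan_bounded[of x] pi_less_4 by (auto simp: abs_le_iff)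
  have "\<exists>c. AE X in \<mu>. arctan (h X) = c"
  proof (rule invariant_limit_const[where B=2 and g="\<lambda>n X. arctan (last_passage X 0 (point \<alpha> 1 n) / real n)"
      and N="\<lambda>n. Suc (fst (point \<alpha> 1 n))"])
    show "AE X in \<mu>. (\<lambda>n. arctan (last_passage X 0 (point \<alpha> 1 n) / real n)) \<longlonglongrightarrow> arctan (h X)"
      using \<mu>.conv_L1D(3)[OF h] by eventually_elim (rule tendsto_arctan)
    show "AE X in \<mu>. arctan (h (translate (1, 0) X)) = arctan (h X)"
      using inv[of "(1, 0)"] by (auto elim: eventually_mono)
    show "AE X in \<mu>. arctan (h (translate (0, 1) X)) = arctan (h X)"
      using inv[of "(0, 1)"] by (auto elim: eventually_mono)
    \<comment> \<open>A path stays in the columns up to that of its end point, hence the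
      \<open>Suc\<close> in \<open>N\<close>.\<close>
    fix n X
    have "last_passage (\<lambda>z. if fst z < Suc (fst (point \<alpha> 1 n)) then X z else 0) 0 (point \<alpha> 1 n) =
        last_passage X 0 (point \<alpha> 1 n)"
      by (rule last_passage_cong) simp
    then show "arctan (last_passage (\<lambda>z. if fst z < Suc (fst (point \<alpha> 1 n)) then X z else 0) 0 (point \<alpha> 1 n) / real n) =
        arctan (last_passage X 0 (point \<alpha> 1 n) / real n)" by (simp only:)
  qed (auto simp: bound)
  then obtain c where "AE X in \<mu>. arctan (h X) = c" by blast
  then have "AE X in \<mu>. h X = tan c" by eventually_elim (metis tan_arctan)
  then show ?thesis by blast
qed

text \<open>One \<open>\<psi>\<close> has to serve all \<open>y\<close>. For \<open>y = 1\<close>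
  the terms are free of the phase, so \<open>f\<close> is a function of the weights and then a
  constant; \<open>point_conv\<close> with the same \<open>f\<close> carries this constant to every
  \<open>y\<close>.\<close>

lemma direction_conv:
  assumes \<alpha>: "0 < \<alpha>"
  shows "\<exists>\<psi>. \<forall>y>0. \<mu>.conv_L1 (\<lambda>n X. last_passage X 0 (point (\<alpha> * y) y n) / real n) (\<lambda>_. y * \<psi>)"
proof -
  obtain f where f: "\<mu>U.conv_L1 (\<lambda>n \<omega>. last_passage (fst \<omega>) 0 (ray \<alpha> (snd \<omega>) n) / real n) f"
    using ray_conv[of \<alpha>] \<alpha> by auto
  have "\<mu>U.conv_L1 (\<lambda>n \<omega>. last_passage (fst \<omega>) 0 (point \<alpha> 1 n) / real n) f"
    using point_conv[OF \<alpha> zero_less_one f] by simp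
  then obtain h where h: "\<mu>.conv_L1 (\<lambda>n X. last_passage X 0 (point \<alpha> 1 n) / real n) h"
    and fh: "AE \<omega> in \<mu>U. f \<omega> = h (fst \<omega>)"
    by (rule conv_L1_fst_limit[rotated]) auto
  obtain c where c: "AE X in \<mu>. h X = c" using point_limit_const[OF \<alpha> h] by blast
  have "AE X in distr \<mu>U \<mu> fst. h X = c" using c by (simp only: distr_\<mu>U_fst)
  then have "AE \<omega> in \<mu>U. h (fst \<omega>) = c" by (rule AE_distrD[rotated]) (rule measurable_fst)
  with fh have fc: "AE \<omega> in \<mu>U. f \<omega> = c" by eventually_elim simp
  have "\<mu>.conv_L1 (\<lambda>n X. last_passage X 0 (point (\<alpha> * y) y n) / real n) (\<lambda>_. y * c)" if y: "0 < y" for y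
  proof -
    have "AE \<omega> in \<mu>U. y * f \<omega> = y * c" using fc by eventually_elim simp
    from \<mu>U.conv_L1_AE_cong[OF point_conv[OF \<alpha> y f] this]
    have "\<mu>U.conv_L1 (\<lambda>n \<omega>. last_passage (fst \<omega>) 0 (point (\<alpha> * y) y n) / real n) (\<lambda>\<omega>. y * c)" by simp
    then show ?thesis
      using conv_L1_fst_iff[of "\<lambda>n X. last_passage X 0 (point (\<alpha> * y) y n) / real n" "\<lambda>_. y * c"] by simp
  qed
  then show ?thesis by blast
qed

section \<open>The time constant and its regularity\<close>

definition time_constant :: "real \<times> real \<Rightarrow> real" where
  "time_constant p = snd p * (SOME \<psi>. \<forall>y>0. \<mu>.conv_L1
     (\<lambda>n X. last_passage X 0 (point (fst p / snd p * y) y n) / real n) (\<lambda>_. y * \<psi>))"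

lemma time_constant_conv:
  assumes "0 < x" "0 < y"
  shows "\<mu>.conv_L1 (\<lambda>n X. last_passage X 0 (point x y n) / real n) (\<lambda>_. time_constant (x, y))"
proof -
  have "0 < x / y" using assms by simp
  from someI_ex[OF direction_conv[OF this], rule_format, OF assms(2)] assms
  show ?thesis by (simp add: time_constant_def)
qed

text \<open>True by construction: the chosen \<open>\<psi>\<close> depends only on the ratio of the
  coordinates, and the prefactor \<open>snd p\<close> scales.\<close>

lemma time_constant_homogeneous:
  assumes "0 < c" "0 < x" "0 < y"
  shows "time_constant (c * x, c * y) = c * time_constant (x, y)"
  using assms by (simp add: time_constant_def)

lemma mean_last_passage_tendsto:
  assumes "0 < x" "0 < y"
  shows "(\<lambda>n. (\<integral>X. last_passage X 0 (point x y n) \<partial>\<mu>) / real n) \<longlonglongrightarrow> time_constant (x, y)"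
  using \<mu>.conv_L1_integral[OF time_constant_conv[OF assms]] \<mu>.prob_space by simp

text \<open>The comparison is made in mean because the second path starts at a point that moves with
  \<open>n\<close>; translation invariance gives its passage time the mean of one started at the
  origin. Rounding loses at most one unit in each coordinate, hence a gap of size 1.\<close>

lemma time_constant_superadditive:
  assumes xy: "0 < x" "0 < y" and xy': "0 < x'" "0 < y'"
  shows "time_constant (x, y) + time_constant (x', y') \<le> time_constant (x + x', y + y')"
proof -
  let ?E = "\<lambda>x y n. \<integral>X. last_passage X 0 (point x y n) \<partial>\<mu>"
  let ?G = "\<integral>X. gap 1 X 0 \<partial>\<mu>"
  have le: "?E x y n + ?E x' y' n - ?G \<le> ?E (x + x') (y + y') n" for n
  proof -
    let ?p = "point x y n" and ?q = "point x' y' n" and ?r = "point (x + x') (y + y') n"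
    have fl: "nat \<lfloor>real n * a\<rfloor> + nat \<lfloor>real n * b\<rfloor> \<le> nat \<lfloor>real n * (a + b)\<rfloor> \<and>
        nat \<lfloor>real n * (a + b)\<rfloor> - (nat \<lfloor>real n * a\<rfloor> + nat \<lfloor>real n * b\<rfloor>) \<le> 1" if "0 < a" "0 < b" for a b
    proof -
      have "0 \<le> real n * a" "0 \<le> real n * b" using that by auto
      then have "0 \<le> \<lfloor>real n * a\<rfloor>" "0 \<le> \<lfloor>real n * b\<rfloor>" by auto
      moreover have "\<lfloor>real n * a\<rfloor> + \<lfloor>real n * b\<rfloor> \<le> \<lfloor>real n * (a + b)\<rfloor>"
        "\<lfloor>real n * (a + b)\<rfloor> \<le> \<lfloor>real n * a\<rfloor> + \<lfloor>real n * b\<rfloor> + 1"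
        unfolding distrib_left by linarith+
      ultimately show ?thesis by linarith
    qed
    have r: "fst (?p + ?q) \<le> fst ?r" "fst ?r - fst (?p + ?q) \<le> 1" "snd (?p + ?q) \<le> snd ?r" "snd ?r - snd (?p + ?q) \<le> 1"
      using fl[OF xy(1) xy'(1)] fl[OF xy(2) xy'(2)] unfolding point_def by simp_all
    have pt: "last_passage X 0 ?p + last_passage (translate ?p X) 0 ?q - gap 1 X (?p + ?q) \<le> last_passage X 0 ?r" for X
    proof -
      have "last_passage X 0 ?p + last_passage X ?p (?p + ?q) \<le> last_passage X 0 (?p + ?q)"
        by (rule last_passage_superadditive') auto
      moreover have "last_passage X ?p (?p + ?q) = last_passage (translate ?p X) 0 ?q"
        by (simp add: last_passage_translate' add.commute)
      moreover have "last_passage X 0 (?p + ?q) + last_passage X (?p + ?q) ?r \<le> last_passage X 0 ?r"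
        by (rule last_passage_superadditive'[OF _ _ r(1,3)]) auto
      moreover have "\<bar>last_passage X (?p + ?q) ?r\<bar> \<le> gap 1 X (?p + ?q)"
        by (rule abs_last_passage_le_gap[OF r])
      ultimately show ?thesis by linarith
    qed
    have i: "integrable \<mu> (\<lambda>X. last_passage X 0 v)" for v by (rule integrable_last_passage) auto
    have "(\<integral>X. last_passage X 0 ?p + last_passage (translate ?p X) 0 ?q - gap 1 X (?p + ?q) \<partial>\<mu>) \<le> ?E (x + x') (y + y') n"
      using i integrable_translate[OF i] integrable_gap by (intro integral_mono pt) auto
    also have "(\<integral>X. last_passage X 0 ?p + last_passage (translate ?p X) 0 ?q - gap 1 X (?p + ?q) \<partial>\<mu>) =
        ?E x y n + (\<integral>X. last_passage (translate ?p X) 0 ?q \<partial>\<mu>) - (\<integral>X. gap 1 X (?p + ?q) \<partial>\<mu>)"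
      using i integrable_translate[OF i] integrable_gap by simp
    also have "(\<integral>X. last_passage (translate ?p X) 0 ?q \<partial>\<mu>) = ?E x' y' n"
      by (rule integral_translate) measurable
    finally show ?thesis using integral_gap[of 1 "?p + ?q"] by simp
  qed
  have "(\<lambda>n. ?E x y n / real n + ?E x' y' n / real n - ?G * (1 / real n)) \<longlonglongrightarrow>
      time_constant (x, y) + time_constant (x', y') - ?G * 0"
    by (intro tendsto_intros mean_last_passage_tendsto lim_1_over_n xy xy')
  then have lim: "(\<lambda>n. ?E x y n / real n + ?E x' y' n / real n - ?G * (1 / real n)) \<longlonglongrightarrow>
      time_constant (x, y) + time_constant (x', y')" by simp
  show ?thesis
  proof (rule LIMSEQ_le[OF lim mean_last_passage_tendsto[OF add_pos_pos[OF xy(1) xy'(1)] add_pos_pos[OF xy(2) xy'(2)]]],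
      intro exI allI impI)
    fix n :: nat
    from divide_right_mono[OF le[of n], of "real n"]
    show "?E x y n / real n + ?E x' y' n / real n - ?G * (1 / real n) \<le> ?E (x + x') (y + y') n / real n"
      by (simp add: add_divide_distrib diff_divide_distrib)
  qed
qed

lemma time_constant_concave: "concave_on ({0<..} \<times> {0<..}) time_constant"
  unfolding concave_on_def
proof (rule convex_onI)
  show "convex ({0 :: real<..} \<times> {0 :: real<..})" by (intro convex_Times) auto
  fix t :: real and p q :: "real \<times> real"
  assume t: "0 < t" "t < 1" and p: "p \<in> {0<..} \<times> {0<..}" and q: "q \<in> {0<..} \<times> {0<..}"
  obtain a b a' b' where pq: "p = (a, b)" "q = (a', b')" by (cases p; cases q) auto
  have pos: "0 < a" "0 < b" "0 < a'" "0 < b'" using p q by (auto simp: pq)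
  have "(1 - t) * time_constant p + t * time_constant q =
      time_constant ((1 - t) * a, (1 - t) * b) + time_constant (t * a', t * b')"
    using t pos by (simp add: pq time_constant_homogeneous)
  also have "\<dots> \<le> time_constant ((1 - t) * a + t * a', (1 - t) * b + t * b')"
    using t pos by (intro time_constant_superadditive) auto
  finally show "- time_constant ((1 - t) *\<^sub>R p + t *\<^sub>R q) \<le> (1 - t) * - time_constant p + t * - time_constant q"
    by (simp add: pq)
qed

lemma time_constant_continuous: "continuous_on ({0<..} \<times> {0<..}) time_constant"
proof -
  have "continuous_on ({0<..} \<times> {0<..}) (\<lambda>p. - time_constant p)"
    using time_constant_concave unfolding concave_on_def
    by (intro convex_on_continuous open_Times) auto
  from continuous_on_minus[OF this] show ?thesis by simp
qed

lemma time_constant_joint: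
  assumes "0 < x" "0 < y"
  shows "AE (F, X) in joint_measure P. (\<lambda>n. last_passage X 0 (point x y n) / real n) \<longlonglongrightarrow> time_constant (x, y)"
    and "integrable (joint_measure P) (\<lambda>(F, X). last_passage X 0 (point x y n) / real n)"
    and "(\<lambda>n. \<integral>(F, X). \<bar>last_passage X 0 (point x y n) / real n - time_constant (x, y)\<bar> \<partial>joint_measure P) \<longlonglongrightarrow> 0"
proof -
  note c = time_constant_conv[OF assms]
  have "AE X in distr (joint_measure P) weight_space snd. (\<lambda>n. last_passage X 0 (point x y n) / real n) \<longlonglongrightarrow> time_constant (x, y)"
    using \<mu>.conv_L1D(3)[OF c] by (simp only: joint_snd)
  from AE_distrD[OF snd_measurable_joint this]
  show "AE (F, X) in joint_measure P. (\<lambda>n. last_passage X 0 (point x y n) / real n) \<longlonglongrightarrow> time_constant (x, y)"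
    by (simp add: case_prod_unfold)
  have "integrable (distr (joint_measure P) weight_space snd) (\<lambda>X. last_passage X 0 (point x y n) / real n)" for n
    using \<mu>.conv_L1D(1)[OF c, of n] by (simp only: joint_snd)
  from integrable_distr[OF snd_measurable_joint this]
  show "integrable (joint_measure P) (\<lambda>(F, X). last_passage X 0 (point x y n) / real n)"
    by (simp add: case_prod_unfold)
  have "(\<integral>(F, X). \<bar>last_passage X 0 (point x y n) / real n - time_constant (x, y)\<bar> \<partial>joint_measure P) =
      (\<integral>X. \<bar>last_passage X 0 (point x y n) / real n - time_constant (x, y)\<bar> \<partial>\<mu>)" for n
    unfolding joint_snd[symmetric] case_prod_unfold
    by (rule integral_distr[OF snd_measurable_joint, symmetric]) measurable
  then show "(\<lambda>n. \<integral>(F, X). \<bar>last_passage X 0 (point x y n) / real n - time_constant (x, y)\<bar> \<partial>joint_measure P) \<longlonglongrightarrow> 0"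
    using \<mu>.conv_L1D(4)[OF c] by (simp only:)
qed

end

theorem proposition2p2p1:
  fixes P :: "(nat \<Rightarrow> real measure) measure"
  assumes "prob_space P" and "sets P = sets env_space"
    and "stationary_env P" and "ergodic_env P"
    and "\<And>z. integrable (joint_measure P) (\<lambda>(F, X). X z)"
    and "(\<integral>\<^sup>+x\<in>{0..}. ennreal (sqrt (1 - (\<integral>F. cdf (F 0) x \<partial>P))) \<partial>lborel) < \<infinity>"
    and "(\<integral>\<^sup>+x\<in>{0..}. esssup P (\<lambda>F. ennreal (1 - cdf (F 0) x)) \<partial>lborel) < \<infinity>"
  shows "\<exists>\<Psi> :: real \<times> real \<Rightarrow> real.
    (\<forall>x>0. \<forall>y>0.
      (AE (F, X) in joint_measure P.
        (\<lambda>n. last_passage X (0, 0) (nat \<lfloor>real n * x\<rfloor>, nat \<lfloor>real n * y\<rfloor>) / real n)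
          \<longlonglongrightarrow> \<Psi> (x, y)) \<and>
      (\<forall>n. integrable (joint_measure P)
        (\<lambda>(F, X). last_passage X (0, 0) (nat \<lfloor>real n * x\<rfloor>, nat \<lfloor>real n * y\<rfloor>) / real n)) \<and>
      (\<lambda>n. \<integral>(F, X). \<bar>last_passage X (0, 0) (nat \<lfloor>real n * x\<rfloor>, nat \<lfloor>real n * y\<rfloor>) / real n
                        - \<Psi> (x, y)\<bar> \<partial>joint_measure P) \<longlonglongrightarrow> 0) \<and>
    (\<forall>c>0. \<forall>x>0. \<forall>y>0. \<Psi> (c * x, c * y) = c * \<Psi> (x, y)) \<and>
    concave_on ({0<..} \<times> {0<..}) \<Psi> \<and>
    continuous_on ({0<..} \<times> {0<..}) \<Psi>"
proof -
  interpret lpp P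
    by (intro lpp.intro moment_weights.intro stationary_weights.intro lpp_axioms.intro
        moment_weights_axioms.intro assms)
  have unfold_point: "(0, 0) = (0 :: nat \<times> nat)" "(nat \<lfloor>real n * x\<rfloor>, nat \<lfloor>real n * y\<rfloor>) = point x y n" for x y n
    by (simp_all add: point_def zero_prod_def)
  show ?thesis
    unfolding unfold_point
  proof (intro exI[of _ time_constant] conjI allI impI)
    fix c x y :: real assume "0 < c" "0 < x" "0 < y"
    then show "time_constant (c * x, c * y) = c * time_constant (x, y)" by (rule time_constant_homogeneous)
  qed (rule time_constant_joint time_constant_concave time_constant_continuous; assumption?)+
qed

end
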